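(* Let $-\infty\le a<b\le\infty$, let $0 < p,q <\infty$ and let $u,v,w$ be weights on $(a,b)$. Consider the inequality $$\bigg(\int_a^b \bigg(\int_a^x f(s) u(s)\, ds \bigg)^q w(x)\, dx \bigg)^{\frac{1}{q}} \leq C \bigg(\int_a^b f(x)^p v(x)\, dx \bigg)^{\frac{1}{p}}. \qquad ( * )$$ Define $$\mathcal{C}_1 := \operatorname*{ess\,sup}_{x \in (a, b)} \bigg(\int_x^b w(t) \bigg(\int_x^t u \bigg)^q dt \bigg)^{\frac{1}{q}} \bigg(\int_x^b v \bigg)^{-\frac{1}{p}},$$ and, when the exponents are in the ranges in which they are used below, $$\mathcal{C}_2 :=\bigg(\int_a^b \bigg(\int_x^b w \bigg)^{\frac{q}{p-q}} w(x) \operatorname*{ess\,sup}_{t \in (a, x)} \bigg(\int_t^{x} u \bigg)^{\frac{pq}{p-q}} \bigg(\int_t^b v \bigg)^{-\frac{q}{p-q}} dx \bigg)^{\frac{p-q}{pq}},$$ $$\mathcal{C}_3 := \bigg( \int_a^b \bigg(\int_x^b w(s) \bigg(\int_{x}^s u \bigg)^q ds \bigg)^{\frac{q}{p-q}} w(x) \operatorname*{ess\,sup}_{t \in (a, x)} \bigg(\int_t^{x} u \bigg)^q \bigg(\int_t^b v \bigg)^{-\frac{q}{p-q}} dx \bigg)^{\frac{p-q}{pq}},$$ $$\mathcal{C}_4 := \sup_{x \in (a, b)} \bigg(\int_x^b w \bigg)^{\frac1q} \bigg( \int_a^x \bigg(\int_{t}^x u \bigg)^{\frac{1}{p-1}}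 u(t) \bigg(\int_t^b v \bigg)^{-\frac{1}{p-1}} dt \bigg)^{\frac{p-1}{p}},$$ $$\mathcal{C}_5 := \bigg( \int_a^b \bigg(\int_x^b w \bigg)^{\frac{q}{p-q}} w(x) \bigg( \int_a^x \bigg(\int_{t}^x u \bigg)^{\frac{1}{p-1}} u(t) \bigg(\int_t^b v \bigg)^{-\frac{1}{p-1}} dt \bigg)^{\frac{q(p-1)}{p-q}} dx \bigg)^{\frac{p-q}{pq}}.$$ Then there is a constant $C\in(0,\infty)$ such that $( * )$ holds for all $f \in \mathfrak{M}^{\uparrow}(a,b)$ if and only if the following holds: (i) in the case $p \leq q$, $p\leq 1$: $\mathcal{C}_1<\infty$; moreover, the best constant $C$ in $( * )$ satisfies $C \approx \mathcal{C}_1$; (ii) in the case $q < p \leq 1$: $\mathcal{C}_2<\infty$ and $\mathcal{C}_3<\infty$; moreover, the best constant $C$ in $( * )$ satisfies $C \approx \mathcal{C}_2 + \mathcal{C}_3$; (iii) in the case $1 < p \leq q$: $\mathcal{C}_1 < \infty$ and $\mathcal{C}_4<\infty$; moreover, the best constant $C$ in $( * )$ satisfies $C \approx \mathcal{C}_1 + \mathcal{C}_4$; (iv) in the case $q < p$, $1 < p$: $\mathcal{C}_3 < \infty$ and $\mathcal{C}_5<\infty$; moreover, the best constant $C$ in $( * )$ satisfies $C \approx \mathcal{C}_3 + \mathcal{C}_5$.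
   Context: $\mathfrak{M}^+(a,b)$ is the set of all non-negative measurable functions on $(a,b)$ and $\mathfrak{M}^{\uparrow}(a,b)$ is the class of non-decreasing elements of $\mathfrak{M}^+(a,b)$. A weight on $(a,b)$ is a positive measurable function on $(a,b)$ (values in $(0,\infty)$; no integrability is assumed). Conventions: $0\cdot\infty=\infty/\infty=0/0=0$ (and a negative power of $\infty$ is $0$). $A\lesssim B$ means $A\le cB$ with a constant $c>0$ depending only on $p,q$; $A\approx B$ means $A\lesssim B$ and $B\lesssim A$. *)

theory Defs
  imports "HOL-Analysis.Analysis" "HOL-Probability.Essential_Supremum"
begin

text \<open>
  Functions and constants take values in \<^typ>\<open>ennreal\<close>, where \<open>0 * \<infinity> = 0\<close>. Quotients are written as
  products with negative powers, a negative power of \<open>\<infinity>\<close> being \<open>0\<close>. The values \<open>epowr x 0 = 1\<close> and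
  \<open>epowr 0 r = \<infinity>\<close> for \<open>r < 0\<close> do not affect the constants below: exponents are nonzero and the bases
  of negative powers are positive there.
\<close>

definition epowr :: "ennreal \<Rightarrow> real \<Rightarrow> ennreal" where
  "epowr x r =
    (if r = 0 then 1
     else if x = \<infinity> then (if r > 0 then \<infinity> else 0)
     else if x = 0 then (if r > 0 then 0 else \<infinity>)
     else ennreal (enn2real x powr r))"

definition intg :: "ereal \<Rightarrow> ereal \<Rightarrow> (real \<Rightarrow> ennreal) \<Rightarrow> ennreal" where
  "intg a b g = (\<integral>\<^sup>+ x \<in> einterval a b. g x \<partial>lebesgue)"

definition ess_sup :: "ereal \<Rightarrow> ereal \<Rightarrow> (real \<Rightarrow> ennreal) \<Rightarrow> ennreal" where
  "ess_sup a b g = esssup (lebesgue_on (einterval a b)) g"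

definition weight :: "ereal \<Rightarrow> ereal \<Rightarrow> (real \<Rightarrow> ennreal) \<Rightarrow> bool" where
  "weight a b u \<longleftrightarrow>
     u \<in> borel_measurable (lebesgue_on (einterval a b)) \<and>
     (\<forall>x \<in> einterval a b. 0 < u x \<and> u x < \<infinity>)"

definition M_plus :: "ereal \<Rightarrow> ereal \<Rightarrow> (real \<Rightarrow> ennreal) set" where
  "M_plus a b = borel_measurable (lebesgue_on (einterval a b))"

definition M_up :: "ereal \<Rightarrow> ereal \<Rightarrow> (real \<Rightarrow> ennreal) set" where
  "M_up a b = {f \<in> M_plus a b. mono_on (einterval a b) f}"

definition hardy_ineq ::
  "real \<Rightarrow> real \<Rightarrow> ereal \<Rightarrow> ereal \<Rightarrow> (real \<Rightarrow> ennreal) \<Rightarrow> (real \<Rightarrow> ennreal) \<Rightarrow> (real \<Rightarrow> ennreal)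
     \<Rightarrow> real \<Rightarrow> (real \<Rightarrow> ennreal) \<Rightarrow> bool" where
  "hardy_ineq p q a b u v w C f \<longleftrightarrow>
     epowr (intg a b (\<lambda>x. epowr (intg a x (\<lambda>s. f s * u s)) q * w x)) (1 / q)
       \<le> ennreal C * epowr (intg a b (\<lambda>x. epowr (f x) p * v x)) (1 / p)"

definition admissible_const ::
  "real \<Rightarrow> real \<Rightarrow> ereal \<Rightarrow> ereal \<Rightarrow> (real \<Rightarrow> ennreal) \<Rightarrow> (real \<Rightarrow> ennreal) \<Rightarrow> (real \<Rightarrow> ennreal)
     \<Rightarrow> real \<Rightarrow> bool" where
  "admissible_const p q a b u v w C \<longleftrightarrow> 0 < C \<and> (\<forall>f \<in> M_up a b. hardy_ineq p q a b u v w C f)"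

text \<open>The best constant is \<open>\<infinity>\<close> if no constant is admissible.\<close>

definition best_const ::
  "real \<Rightarrow> real \<Rightarrow> ereal \<Rightarrow> ereal \<Rightarrow> (real \<Rightarrow> ennreal) \<Rightarrow> (real \<Rightarrow> ennreal) \<Rightarrow> (real \<Rightarrow> ennreal)
     \<Rightarrow> ennreal" where
  "best_const p q a b u v w = (INF C \<in> {C. admissible_const p q a b u v w C}. ennreal C)"

definition equiv_upto :: "real \<Rightarrow> ennreal \<Rightarrow> ennreal \<Rightarrow> bool" where
  "equiv_upto c A B \<longleftrightarrow> A \<le> ennreal c * B \<and> B \<le> ennreal c * A"

definition C\<^sub>1 ::
  "real \<Rightarrow> real \<Rightarrow> ereal \<Rightarrow> ereal \<Rightarrow> (real \<Rightarrow> ennreal) \<Rightarrow> (real \<Rightarrow> ennreal) \<Rightarrow> (real \<Rightarrow> ennreal)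
     \<Rightarrow> ennreal" where
  "C\<^sub>1 p q a b u v w =
     ess_sup a b (\<lambda>x.
       epowr (intg x b (\<lambda>t. w t * epowr (intg x t u) q)) (1 / q)
       * epowr (intg x b v) (- (1 / p)))"

definition C\<^sub>2 ::
  "real \<Rightarrow> real \<Rightarrow> ereal \<Rightarrow> ereal \<Rightarrow> (real \<Rightarrow> ennreal) \<Rightarrow> (real \<Rightarrow> ennreal) \<Rightarrow> (real \<Rightarrow> ennreal)
     \<Rightarrow> ennreal" where
  "C\<^sub>2 p q a b u v w =
     epowr
       (intg a b (\<lambda>x.
          epowr (intg x b w) (q / (p - q)) * w x
          * ess_sup a x (\<lambda>t.
              epowr (intg t x u) (p * q / (p - q)) * epowr (intg t b v) (- (q / (p - q))))))
       ((p - q) / (p * q))"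

definition C\<^sub>3 ::
  "real \<Rightarrow> real \<Rightarrow> ereal \<Rightarrow> ereal \<Rightarrow> (real \<Rightarrow> ennreal) \<Rightarrow> (real \<Rightarrow> ennreal) \<Rightarrow> (real \<Rightarrow> ennreal)
     \<Rightarrow> ennreal" where
  "C\<^sub>3 p q a b u v w =
     epowr
       (intg a b (\<lambda>x.
          epowr (intg x b (\<lambda>s. w s * epowr (intg x s u) q)) (q / (p - q)) * w x
          * ess_sup a x (\<lambda>t.
              epowr (intg t x u) q * epowr (intg t b v) (- (q / (p - q))))))
       ((p - q) / (p * q))"

definition C\<^sub>4 ::
  "real \<Rightarrow> real \<Rightarrow> ereal \<Rightarrow> ereal \<Rightarrow> (real \<Rightarrow> ennreal) \<Rightarrow> (real \<Rightarrow> ennreal) \<Rightarrow> (real \<Rightarrow> ennreal)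
     \<Rightarrow> ennreal" where
  "C\<^sub>4 p q a b u v w =
     (SUP x \<in> einterval a b.
        epowr (intg x b w) (1 / q)
        * epowr
            (intg a x (\<lambda>t.
               epowr (intg t x u) (1 / (p - 1)) * u t * epowr (intg t b v) (- (1 / (p - 1)))))
            ((p - 1) / p))"

definition C\<^sub>5 ::
  "real \<Rightarrow> real \<Rightarrow> ereal \<Rightarrow> ereal \<Rightarrow> (real \<Rightarrow> ennreal) \<Rightarrow> (real \<Rightarrow> ennreal) \<Rightarrow> (real \<Rightarrow> ennreal)
     \<Rightarrow> ennreal" where
  "C\<^sub>5 p q a b u v w =
     epowr
       (intg a b (\<lambda>x.
          epowr (intg x b w) (q / (p - q)) * w x
          * epowr
              (intg a x (\<lambda>t.
                 epowr (intg t x u) (1 / (p - 1)) * u t * epowr (intg t b v) (- (1 / (p - 1)))))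
              (q * (p - 1) / (p - q))))
       ((p - q) / (p * q))"

end

theory Submission
  imports Defs "HOL-Probability.Distribution_Functions"
begin

text \<open>
  A nondecreasing \<open>f\<close> is comparable to the sum of its dyadic levels \<open>2\<^sup>k\<close> on \<open>{f > 2\<^sup>k}\<close>, and these sets
  are final segments of the line. This reduces norm inequalities on the cone of nondecreasing functions to
  final segments: directly if the target exponent is at least \<open>p\<close>, and otherwise through the maximal function
  \<open>sup {\<sigma>[s, \<infinity>) / V s | s \<le> t}\<close>, where \<open>\<sigma>\<close> is the target measure and
  \<open>V s\<close> is the integral of \<open>v\<close> over \<open>[s, \<infinity>)\<close>. For the
  functional \<open>f \<mapsto> \<integral> f u\<close> over \<open>(a, x)\<close> it gives the norm \<open>A x\<close>, up to constants: a supremum if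
  \<open>p \<le> 1\<close>, and Sawyer's integral if \<open>p > 1\<close>.

  For the Hardy inequality, choose points \<open>y 0 < y 1 < \<dots>\<close> at which the tail of \<open>w\<close> decreases
  geometrically. Then the left-hand side is comparable to a weighted sum of the integrals of \<open>f u\<close> over the
  blocks \<open>(y k, y (k+1))\<close>. On a block, \<open>f\<close> is split into \<open>f (y k)\<close>, which gives an
  inequality between \<open>f\<close> and a discrete measure whose tail is comparable to that of the Hardy kernel
  (\<open>C\<^sub>1\<close> and \<open>C\<^sub>3\<close>), and an increment, which is controlled by \<open>A\<close>
  (\<open>C\<^sub>2\<close>, \<open>C\<^sub>4\<close> and \<open>C\<^sub>5\<close>). Necessity follows from test functions adapted to the same points.
\<close>

section \<open>Extended real powers\<close>

text \<open>For q < p everything is governed by r = q / (p - q): 1 + r is the exponent conjugate to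
  p / q, and q (1 + r) = p r. The main necessity estimates there end in X <= K X^s with s < 1, and
  X^s may be cancelled only if X is finite. As no integrability is assumed, u and w are replaced by
  bounded functions of compact support; the bounds do not depend on this truncation, and monotone
  convergence removes it. The weight v is never truncated. The second obstacle is infinity itself:
  where the tail of v is infinite, all quotients are 0 and the constants say nothing. The case p <=
  q therefore uses its hypothesis at finite tails only, and both cases are run for functions of
  finite norm. Finally, two monotonicities compete on a block: the tail of the kernel decreases, the
  supremum of quotients increases. Comparing sums with integrals thus detaches neighbouring terms,
  which are local and are paid for by A.\<close>

notation epowr (infixr "powe" 80)

lemma epowr_0_right [simp]: "x powe 0 = 1"
  by (simp add: epowr_def)

lemma epowr_0_left [simp]: "0 < r \<Longrightarrow> 0 powe r = 0"
  by (simp add: epowr_def)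

lemma epowr_0_left_neg [simp]: "r < 0 \<Longrightarrow> 0 powe r = top"
  by (simp add: epowr_def)

lemma epowr_top [simp]: "0 < r \<Longrightarrow> top powe r = top"
  by (simp add: epowr_def)

lemma epowr_top_neg [simp]: "r < 0 \<Longrightarrow> top powe r = 0"
  by (simp add: epowr_def)

lemma epowr_ennreal: "0 < x \<Longrightarrow> ennreal x powe r = ennreal (x powr r)"
  by (auto simp: epowr_def)

lemma ennreal_cases3:
  fixes x :: ennreal
  obtains "x = 0" | "x = top" | a where "x = ennreal a" "0 < a"
proof (cases x)
  case (real r)
  then show ?thesis using that by (cases "r = 0") auto
next
  case top
  then show ?thesis using that by auto
qed

lemma epowr_1 [simp]: "x powe 1 = x"
  by (cases x rule: ennreal_cases3) (auto simp: epowr_ennreal)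

lemma epowr_1_left [simp]: "1 powe r = 1"
  using epowr_ennreal[of 1 r] by simp

lemma epowr_mono:
  assumes "x \<le> y" "0 \<le> r" shows "x powe r \<le> y powe r"
proof (cases "r = 0")
  case False
  with assms show ?thesis
    by (cases x rule: ennreal_cases3; cases y rule: ennreal_cases3)
       (auto simp: epowr_ennreal powr_mono2 ennreal_le_iff top_unique)
qed auto

lemma epowr_antimono:
  assumes "x \<le> y" "r \<le> 0" shows "y powe r \<le> x powe r"
proof (cases "r = 0")
  case False
  with assms show ?thesis
    by (cases x rule: ennreal_cases3; cases y rule: ennreal_cases3)
       (auto simp: epowr_ennreal powr_mono2' ennreal_le_iff top_unique)
qed auto

text \<open>The sign restriction comes from \<open>0 * top = 0\<close>: for r < 0, x = 0 and y = top
  the left side is top and the right side is 0.\<close>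

lemma epowr_mult:
  assumes "0 \<le> r" shows "(x * y) powe r = x powe r * y powe r"
proof (cases "r = 0")
  case False
  with assms show ?thesis
    by (cases x rule: ennreal_cases3; cases y rule: ennreal_cases3)
       (auto simp: epowr_ennreal powr_mult ennreal_mult[symmetric] ennreal_top_mult ennreal_mult_top)
qed auto

lemma epowr_epowr: "(x powe r) powe s = x powe (r * s)"
proof -
  consider "r = 0" | "s = 0" | "r < 0" "s < 0" | "r < 0" "s > 0" | "r > 0" "s < 0" | "r > 0" "s > 0"
    by linarith
  then show ?thesis
    by cases (cases x rule: ennreal_cases3;
      auto simp: epowr_ennreal powr_powr mult_pos_neg mult_neg_pos mult_neg_neg)+
qed

lemma epowr_add:
  assumes "0 \<le> r" "0 \<le> s" shows "x powe (r + s) = x powe r * x powe s"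
proof -
  consider "r = 0" | "s = 0" | "r > 0" "s > 0" using assms by linarith
  then show ?thesis
    by cases (cases x rule: ennreal_cases3;
      auto simp: epowr_ennreal powr_add ennreal_mult[symmetric])+
qed

text \<open>Lets exponents of opposite sign cancel. This fails at 0 and top, where for r nonzero
  \<open>x powe (r + - r)\<close> is 1 but the product is 0.\<close>

lemma epowr_add_finite:
  assumes "0 < x" "x < top" shows "x powe (r + s) = x powe r * x powe s"
  using assms
  by (cases x rule: ennreal_cases3) (auto simp: epowr_ennreal powr_add ennreal_mult[symmetric])

lemma epowr_less_top [simp]: "0 \<le> r \<Longrightarrow> x < top \<Longrightarrow> x powe r < top"
  by (cases "r = 0"; cases x rule: ennreal_cases3) (auto simp: epowr_ennreal)

lemma epowr_neg_less_top: "0 < x \<Longrightarrow> r \<le> 0 \<Longrightarrow> x powe r < top"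
  by (cases "r = 0"; cases x rule: ennreal_cases3) (auto simp: epowr_ennreal)

lemma epowr_eq_0_iff: "0 < r \<Longrightarrow> x powe r = 0 \<longleftrightarrow> x = 0"
  by (cases x rule: ennreal_cases3) (auto simp: epowr_ennreal)

lemma epowr_le_iff:
  assumes "0 < r" shows "x powe r \<le> y \<longleftrightarrow> x \<le> y powe (1 / r)"
proof
  assume "x powe r \<le> y"
  then have "(x powe r) powe (1 / r) \<le> y powe (1 / r)" using assms by (intro epowr_mono) auto
  then show "x \<le> y powe (1 / r)" using assms by (simp add: epowr_epowr)
next
  assume "x \<le> y powe (1 / r)"
  then have "x powe r \<le> (y powe (1 / r)) powe r" using assms by (intro epowr_mono) auto
  then show "x powe r \<le> y" using assms by (simp add: epowr_epowr)
qed

lemma epowr_SUP: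
  assumes "0 < r" "A \<noteq> {}"
  shows "(SUP x\<in>A. f x) powe r = (SUP x\<in>A. f x powe r)"
proof (rule antisym)
  show "(SUP x\<in>A. f x) powe r \<le> (SUP x\<in>A. f x powe r)"
    unfolding epowr_le_iff[OF assms(1)]
    by (intro SUP_least) (auto simp: epowr_le_iff[OF assms(1), symmetric] intro: SUP_upper)
  show "(SUP x\<in>A. f x powe r) \<le> (SUP x\<in>A. f x) powe r"
    using assms by (intro SUP_least epowr_mono) (auto intro: SUP_upper)
qed

lemma epowr_max: "0 \<le> r \<Longrightarrow> max x y powe r = max (x powe r) (y powe r)"
  by (cases "x \<le> y") (auto simp: max_def epowr_mono intro: antisym epowr_mono)

lemma epowr_add_le:
  assumes "0 \<le> r" shows "(x + y) powe r \<le> 2 powe r * (x powe r + y powe r)"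
proof -
  have "(x + y) powe r \<le> (2 * max x y) powe r"
    using assms by (intro epowr_mono) (auto simp: mult_2 intro: add_mono)
  also have "\<dots> = 2 powe r * max (x powe r) (y powe r)"
    using assms by (simp add: epowr_mult epowr_max)
  also have "\<dots> \<le> 2 powe r * (x powe r + y powe r)"
    by (intro mult_left_mono) auto
  finally show ?thesis .
qed

lemma epowr_add3_le:
  assumes "0 \<le> r"
  shows "(x + y + z) powe r \<le> 4 powe r * (x powe r + y powe r + z powe r)"
proof -
  have "(x + y + z) powe r \<le> 2 powe r * (2 powe r * (x powe r + y powe r) + z powe r)"
    using assms by (intro order_trans[OF epowr_add_le] mult_left_mono add_mono epowr_add_le) auto
  also have "\<dots> \<le> 2 powe r * (2 powe r * (x powe r + y powe r) + 2 powe r * z powe r)"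
    using epowr_mono[of 1 2 r] assms mult_right_mono[of 1 "2 powe r" "z powe r"]
    by (intro mult_left_mono add_mono) auto
  also have "\<dots> = (2 * 2) powe r * (x powe r + y powe r + z powe r)"
    unfolding epowr_mult[OF assms] by (simp add: algebra_simps)
  finally show ?thesis by simp
qed

section \<open>Hoelder's inequality, embeddings of sequence spaces and absorption\<close>

lemma epowr_measurable [measurable]:
  assumes [measurable]: "f \<in> borel_measurable M"
  shows "(\<lambda>x. f x powe r) \<in> borel_measurable M"
  unfolding epowr_def by measurable

text \<open>The crude form \<open>a\<^sup>\<theta> b\<^sup>1\<^sup>-\<^sup>\<theta> \<le> a + b\<close> of Young's inequality costs a factor \<open>2\<close>.\<close>

lemma epowr_Young:
  assumes "0 < t" "t < 1"
  shows "a powe t * b powe (1 - t) \<le> a + b"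
proof -
  have "a powe t * b powe (1 - t) \<le> max a b powe t * max a b powe (1 - t)"
    using assms by (intro mult_mono epowr_mono) auto
  also have "\<dots> = max a b" using assms by (simp flip: epowr_add)
  also have "\<dots> \<le> a + b" by simp
  finally show ?thesis .
qed

text \<open>Both functions are normalised to integral 1 and the crude Young inequality is
  integrated. Its right side then has integral 1 + 1, whence the factor 2.\<close>

lemma nn_integral_Holder:
  assumes [measurable]: "f \<in> borel_measurable M" "g \<in> borel_measurable M"
    and t: "0 < t" "t < 1"
  shows "(\<integral>\<^sup>+x. f x powe t * g x powe (1 - t) \<partial>M)
    \<le> 2 * ((\<integral>\<^sup>+x. f x \<partial>M) powe t * (\<integral>\<^sup>+x. g x \<partial>M) powe (1 - t))"
    (is "?L \<le> 2 * (?F powe t * ?G powe (1 - t))")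
proof -
  consider "?F = 0 \<or> ?G = 0" | "?F \<noteq> 0" "?G \<noteq> 0" "?F = top \<or> ?G = top"
    | "?F \<noteq> 0" "?G \<noteq> 0" "?F \<noteq> top" "?G \<noteq> top" by blast
  then show ?thesis
  proof cases
    case 1
    \<comment> \<open>If the other integral is infinite, the right side is
      \<open>0 * top = 0\<close>, so the left side has to vanish exactly.\<close>
    then have "?L = 0"
    proof
      assume "?F = 0"
      then have "AE x in M. f x = 0" by (simp add: nn_integral_0_iff_AE)
      then have "AE x in M. f x powe t * g x powe (1 - t) = 0" by eventually_elim (use t in simp)
      then show ?thesis by (simp add: nn_integral_0_iff_AE)
    next
      assume "?G = 0"
      then have "AE x in M. g x = 0" by (simp add: nn_integral_0_iff_AE)
      then have "AE x in M. f x powe t * g x powe (1 - t) = 0" by eventually_elim (use t in simp)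
      then show ?thesis by (simp add: nn_integral_0_iff_AE)
    qed
    then show ?thesis by simp
  next
    case 2
    then have "?F powe t * ?G powe (1 - t) = top"
      using t by (auto simp: ennreal_top_mult ennreal_mult_top epowr_eq_0_iff)
    then show ?thesis by (simp add: ennreal_mult_top)
  next
    case 3
    obtain F where F: "?F = ennreal F" "0 < F"
      using 3 by (cases "?F" rule: ennreal_cases3) auto
    obtain G where G: "?G = ennreal G" "0 < G"
      using 3 by (cases "?G" rule: ennreal_cases3) auto
    have *: "f x powe t * g x powe (1 - t) \<le>
        (ennreal F powe t * ennreal G powe (1 - t)) * (ennreal (1/F) * f x + ennreal (1/G) * g x)" for x
    proof -
      have 1: "ennreal F * (ennreal (1/F) * f x) = f x"
        using F by (simp add: mult.assoc[symmetric] ennreal_mult[symmetric])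
      have 2: "ennreal G * (ennreal (1/G) * g x) = g x"
        using G by (simp add: mult.assoc[symmetric] ennreal_mult[symmetric])
      have "f x powe t * g x powe (1 - t) =
        (ennreal F * (ennreal (1/F) * f x)) powe t * (ennreal G * (ennreal (1/G) * g x)) powe (1 - t)"
        unfolding 1 2 ..
      also have "\<dots> = (ennreal F powe t * ennreal G powe (1 - t)) *
          ((ennreal (1/F) * f x) powe t * (ennreal (1/G) * g x) powe (1 - t))"
        using t by (simp add: epowr_mult mult_ac)
      also have "\<dots> \<le> (ennreal F powe t * ennreal G powe (1 - t)) * (ennreal (1/F) * f x + ennreal (1/G) * g x)"
        using t by (intro mult_left_mono epowr_Young) auto
      finally show ?thesis .
    qed
    have "?L \<le> (\<integral>\<^sup>+x. (ennreal F powe t * ennreal G powe (1 - t)) * (ennreal (1/F) * f x + ennreal (1/G) * g x) \<partial>M)"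
      by (intro nn_integral_mono *)
    also have "\<dots> = (ennreal F powe t * ennreal G powe (1 - t)) * (ennreal (1/F) * ?F + ennreal (1/G) * ?G)"
      by (simp add: nn_integral_cmult nn_integral_add)
    also have "ennreal (1/F) * ?F + ennreal (1/G) * ?G = 2"
      unfolding F(1) G(1) using F(2) G(2) by (simp add: ennreal_mult[symmetric])
    finally show ?thesis unfolding F(1) G(1) by (simp add: mult.commute)
  qed
qed

text \<open>One factor of \<open>f x powe s\<close> is kept, the remaining power s - 1 is bounded by
  the total integral. Counting measure satisfies the pointwise hypothesis, which yields the
  embedding of l^1 into l^s.\<close>

lemma nn_integral_epowr_le:
  assumes [measurable]: "f \<in> borel_measurable M" and s: "1 \<le> s"
    and le: "\<And>i. i \<in> space M \<Longrightarrow> f i \<le> (\<integral>\<^sup>+x. f x \<partial>M)"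
  shows "(\<integral>\<^sup>+x. f x powe s \<partial>M) \<le> (\<integral>\<^sup>+x. f x \<partial>M) powe s"
proof -
  let ?X = "\<integral>\<^sup>+x. f x \<partial>M"
  have "(\<integral>\<^sup>+x. f x powe s \<partial>M) \<le> (\<integral>\<^sup>+x. f x * ?X powe (s - 1) \<partial>M)"
  proof (rule nn_integral_mono)
    fix x assume "x \<in> space M"
    have "f x powe s = f x powe 1 * f x powe (s - 1)" using s by (simp flip: epowr_add del: epowr_1)
    also have "\<dots> \<le> f x * ?X powe (s - 1)"
      using s le[OF \<open>x \<in> space M\<close>] by (auto intro!: mult_left_mono epowr_mono)
    finally show "f x powe s \<le> f x * ?X powe (s - 1)" .
  qed
  also have "\<dots> = ?X powe 1 * ?X powe (s - 1)" by (simp add: nn_integral_multc)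
  also have "\<dots> = ?X powe s" using s by (simp flip: epowr_add del: epowr_1)
  finally show ?thesis .
qed

lemma suminf_epowr_le:
  fixes f :: "nat \<Rightarrow> ennreal"
  assumes "1 \<le> s"
  shows "(\<Sum>k. f k powe s) \<le> (\<Sum>k. f k) powe s"
proof -
  have "(\<integral>\<^sup>+k. f k powe s \<partial>count_space UNIV) \<le> (\<integral>\<^sup>+k. f k \<partial>count_space UNIV) powe s"
    using assms by (intro nn_integral_epowr_le) (auto intro: nn_integral_ge_point)
  then show ?thesis by (simp add: nn_integral_count_space_nat)
qed

lemma suminf_Holder:
  fixes f g :: "nat \<Rightarrow> ennreal"
  assumes "0 < t" "t < 1"
  shows "(\<Sum>k. f k powe t * g k powe (1 - t)) \<le> 2 * ((\<Sum>k. f k) powe t * (\<Sum>k. g k) powe (1 - t))"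
  using nn_integral_Holder[of f "count_space UNIV" g t] assms
  by (simp add: nn_integral_count_space_nat)

text \<open>Cancels \<open>X powe s\<close>. The value X = top satisfies the second hypothesis for
  every K > 0, so each application has to establish finiteness of X beforehand.\<close>

lemma epowr_absorb:
  assumes "X < top" "X \<le> K * X powe s" "0 < s" "s < 1"
  shows "X \<le> K powe (1 / (1 - s))"
proof (cases "X = 0")
  case False
  have "X powe (1 - s) * X powe s = X" using assms by (simp flip: epowr_add)
  then have *: "X powe s * X powe (1 - s) \<le> X powe s * K" using assms by (simp add: mult.commute)
  have "X powe s \<noteq> 0" "X powe s < top" using assms False by (auto simp: epowr_eq_0_iff)
  then have "X powe (1 - s) \<le> K"
    using * by (subst (asm) ennreal_mult_le_mult_iff) auto
  then show ?thesis using assms by (simp add: epowr_le_iff)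
qed auto

section \<open>Dyadic levels\<close>

definition lev :: "int \<Rightarrow> ennreal" where
  "lev m = ennreal (2 powr real_of_int m)"

text \<open>The geometric series with ratio 2 powr (- q), that is, the sum of the q-th powers of the
  dyadic levels up to 1.\<close>

definition clev :: "real \<Rightarrow> ennreal" where
  "clev q = ennreal (1 / (1 - 2 powr - q))"

lemma lev_pos [simp]: "0 < lev m" "lev m \<noteq> 0" "lev m < top" "lev m \<noteq> top"
  by (auto simp: lev_def)

lemma clev_finite [simp]: "clev q < top" "clev q \<noteq> top"
  by (auto simp: clev_def)

lemma lev_powe: "lev m powe q = ennreal (2 powr (q * m))"
  by (simp add: lev_def epowr_ennreal powr_powr mult.commute)

lemma lev_inverse: "lev (- m) * (lev m * x) = x"
  by (simp add: lev_def mult.assoc[symmetric] ennreal_mult[symmetric] flip: powr_add)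

lemma lev_mult_le: "lev m * a \<le> b \<longleftrightarrow> a \<le> lev (- m) * b"
proof
  assume "lev m * a \<le> b"
  then have "lev (- m) * (lev m * a) \<le> lev (- m) * b" by (rule mult_left_mono) auto
  then show "a \<le> lev (- m) * b" by (simp add: lev_inverse)
next
  assume "a \<le> lev (- m) * b"
  then have "lev m * a \<le> lev m * (lev (- m) * b)" by (rule mult_left_mono) auto
  then show "lev m * a \<le> b" using lev_inverse[of "- m"] by simp
qed

text \<open>For finite x > 0 a single level suffices, the largest one below x. For x = top
  infinitely many levels contribute at least 1 each.\<close>

lemma level_lower:
  assumes q: "0 < q"
  shows "x powe q \<le> 2 powe q *
    (\<integral>\<^sup>+m. lev m powe q * indicator {m. lev m < x} m \<partial>count_space UNIV)"
    (is "_ \<le> _ * ?I")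
proof (cases x rule: ennreal_cases3)
  case 2
  have "(\<integral>\<^sup>+m. indicator {0::int..} m \<partial>count_space UNIV) = top"
    by (simp add: emeasure_count_space_infinite infinite_Ici)
  moreover have "(\<integral>\<^sup>+m. indicator {0::int..} m \<partial>count_space UNIV) \<le> ?I"
  proof (rule nn_integral_mono)
    fix m :: int
    have "1 \<le> lev m powe q" if "0 \<le> m"
      using that q by (simp add: lev_powe ge_one_powr_ge_zero)
    then show "indicator {0::int..} m \<le> lev m powe q * indicator {m. lev m < x} m"
      using 2 by (auto split: split_indicator)
  qed
  ultimately have "?I = top" by (simp add: top_unique)
  then show ?thesis using q by (simp add: ennreal_mult_top epowr_eq_0_iff)
next
  case (3 a)
  \<comment> \<open>The largest m with 2 powr m < a. Rounding up and subtracting 1 keeps the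
    inequality strict when a is itself a power of 2.\<close>
  define m where "m = \<lceil>log 2 a\<rceil> - 1"
  have "real_of_int m < log 2 a" "log 2 a \<le> m + 1" unfolding m_def by linarith+
  then have m: "2 powr m < a" "a \<le> 2 powr (m + 1)" using 3 by (simp_all add: less_log_iff log_le_iff)
  have "x powe q = ennreal (a powr q)" using 3 by (simp add: epowr_ennreal)
  also have "\<dots> \<le> ennreal ((2 powr (m + 1)) powr q)"
    using m 3 q by (intro ennreal_leI powr_mono2) auto
  also have "\<dots> = 2 powe q * lev m powe q"
    using epowr_ennreal[of 2 q] by (simp add: lev_powe powr_powr ennreal_mult[symmetric] powr_add[symmetric] algebra_simps)
  also have "lev m powe q = lev m powe q * indicator {m. lev m < x} m"
    using m 3 by (simp add: lev_def ennreal_lessI)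
  also have "\<dots> \<le> ?I"
    by (rule nn_integral_ge_point) auto
  finally show ?thesis by (simp add: mult_left_mono)
qed (use q in auto)

text \<open>The levels below x are terms of a geometric series headed by the largest dyadic number
  not above x.\<close>

lemma level_upper:
  assumes q: "0 < q"
  shows "(\<integral>\<^sup>+m. lev m powe q * indicator {m. lev m < x} m \<partial>count_space UNIV) \<le> clev q * x powe q"
    (is "?I \<le> _")
proof (cases x rule: ennreal_cases3)
  case 2
  have "2 powr - q < 2 powr 0" using q by (intro powr_less_mono) auto
  then have "clev q \<noteq> 0" using q by (simp add: clev_def)
  then show ?thesis using 2 q by (simp add: ennreal_mult_top)
next
  case (3 a)
  define m0 where "m0 = \<lfloor>log 2 a\<rfloor>"
  have "m0 \<le> log 2 a" unfolding m0_def by linarith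
  then have m0: "2 powr m0 \<le> a" using 3 by (simp add: le_log_iff)
  have *: "m \<le> m0" if "lev m < x" for m
  proof -
    have "2 powr m < a" using that 3 by (simp add: lev_def ennreal_less_iff)
    then have "m < log 2 a" using 3 by (simp add: less_log_iff)
    then show ?thesis unfolding m0_def by linarith
  qed
  have "?I \<le> (\<integral>\<^sup>+m. lev m powe q * indicator {..m0} m \<partial>count_space UNIV)"
    using * by (intro nn_integral_mono) (auto split: split_indicator)
  also have "\<dots> = (\<integral>\<^sup>+m. lev m powe q \<partial>count_space {..m0})"
    by (simp add: nn_integral_count_space_indicator)
  also have "\<dots> = (\<integral>\<^sup>+n. lev (m0 - int n) powe q \<partial>count_space UNIV)"
  proof (rule nn_integral_bij_count_space[symmetric])
    show "bij_betw (\<lambda>n. m0 - int n) UNIV {..m0}"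
      by (rule bij_betwI[where g = "\<lambda>m. nat (m0 - m)"]) auto
  qed
  also have "\<dots> = (\<Sum>n. ennreal (2 powr (q * m0) * (2 powr - q) ^ n))"
    by (simp add: nn_integral_count_space_nat lev_powe powr_realpow[symmetric] powr_powr powr_add[symmetric] algebra_simps)
  also have "\<dots> = ennreal (2 powr (q * m0) * (1 / (1 - 2 powr - q)))"
  proof (rule suminf_ennreal_eq)
    have "2 powr - q < 2 powr 0" using q by (intro powr_less_mono) auto
    then have lt1: "2 powr - q < 1" by simp
    from lt1 show "(\<lambda>n. 2 powr (q * real_of_int m0) * (2 powr - q) ^ n) sums (2 powr (q * m0) * (1 / (1 - 2 powr - q)))"
      by (intro sums_mult geometric_sums) auto
  qed simp
  also have "\<dots> \<le> ennreal (a powr q * (1 / (1 - 2 powr - q)))"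
    using m0 powr_less_mono[of "- q" 0 2] 3 q powr_mono2[of q "2 powr m0" a]
    by (intro ennreal_leI mult_right_mono) (auto simp: powr_powr mult.commute)
  also have "\<dots> = clev q * x powe q"
    using 3 q by (simp add: clev_def epowr_ennreal ennreal_mult[symmetric] powr_less_one mult.commute
        less_imp_le[OF powr_less_mono[of "- q" 0 2, simplified]])
  finally show ?thesis .
qed (use q in auto)

text \<open>A discrete layer-cake formula: Tonelli's theorem for M and the counting measure on the
  levels.\<close>

lemma nn_integral_levels:
  assumes [measurable]: "f \<in> borel_measurable M"
  shows "(\<integral>\<^sup>+x. \<integral>\<^sup>+m. c m * indicator {m. lev m < f x} m \<partial>count_space UNIV \<partial>M)
    = (\<integral>\<^sup>+m. c m * emeasure M {x \<in> space M. lev m < f x} \<partial>count_space UNIV)"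
proof -
  have "(\<integral>\<^sup>+x. \<integral>\<^sup>+m. c m * indicator {m. lev m < f x} m \<partial>count_space UNIV \<partial>M)
    = (\<integral>\<^sup>+x. \<integral>\<^sup>+m. c m * indicator {x \<in> space M. lev m < f x} x \<partial>count_space UNIV \<partial>M)"
    by (auto intro!: nn_integral_cong split: split_indicator)
  also have "\<dots> = (\<integral>\<^sup>+m. \<integral>\<^sup>+x. c m * indicator {x \<in> space M. lev m < f x} x \<partial>M \<partial>count_space UNIV)"
    by (rule nn_integral_count_space_nn_integral) auto
  finally show ?thesis by (simp add: nn_integral_cmult)
qed

lemma nn_integral_epowr_le_levels:
  assumes [measurable]: "f \<in> borel_measurable M" and q: "0 < q"
  shows "(\<integral>\<^sup>+x. f x powe q \<partial>M) \<le> 2 powe q *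
    (\<integral>\<^sup>+m. lev m powe q * emeasure M {x \<in> space M. lev m < f x} \<partial>count_space UNIV)"
proof -
  have "(\<integral>\<^sup>+x. f x powe q \<partial>M) \<le>
    (\<integral>\<^sup>+x. 2 powe q * (\<integral>\<^sup>+m. lev m powe q * indicator {m. lev m < f x} m \<partial>count_space UNIV) \<partial>M)"
    using q by (intro nn_integral_mono level_lower)
  also have "\<dots> = (\<integral>\<^sup>+x. \<integral>\<^sup>+m. (2 powe q * lev m powe q) * indicator {m. lev m < f x} m \<partial>count_space UNIV \<partial>M)"
    by (simp add: nn_integral_cmult mult.assoc)
  also have "\<dots> = 2 powe q *
    (\<integral>\<^sup>+m. lev m powe q * emeasure M {x \<in> space M. lev m < f x} \<partial>count_space UNIV)"
    unfolding nn_integral_levels[OF assms(1)] by (simp add: nn_integral_cmult mult.assoc)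
  finally show ?thesis .
qed

lemma levels_le_nn_integral_epowr:
  assumes [measurable]: "f \<in> borel_measurable M" and q: "0 < q"
  shows "(\<integral>\<^sup>+m. lev m powe q * emeasure M {x \<in> space M. lev m < f x} \<partial>count_space UNIV)
    \<le> clev q * (\<integral>\<^sup>+x. f x powe q \<partial>M)"
proof -
  have "(\<integral>\<^sup>+m. lev m powe q * emeasure M {x \<in> space M. lev m < f x} \<partial>count_space UNIV)
    \<le> (\<integral>\<^sup>+x. clev q * f x powe q \<partial>M)"
    unfolding nn_integral_levels[OF assms(1), symmetric]
    using q by (intro nn_integral_mono level_upper)
  then show ?thesis by (simp add: nn_integral_cmult)
qed

section \<open>Final segments of the real line\<close>

lemma borel_upset:
  fixes J :: "real set"
  assumes "\<And>x y. x \<in> J \<Longrightarrow> x \<le> y \<Longrightarrow> y \<in> J"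
  shows "J \<in> sets borel"
proof -
  have "mono (indicator J :: real \<Rightarrow> real)"
    using assms by (intro monoI) (auto split: split_indicator)
  then have "(indicator J :: real \<Rightarrow> real) \<in> borel_measurable borel"
    by (rule borel_measurable_mono)
  then show ?thesis by (simp add: borel_measurable_indicator_iff)
qed

lemma borel_measurable_mono_ennreal:
  fixes f :: "real \<Rightarrow> ennreal"
  assumes "mono f" shows "f \<in> borel_measurable borel"
proof (rule borel_measurableI_greater)
  fix a
  show "{x \<in> space borel. a < f x} \<in> sets borel"
    using monoD[OF assms] by (intro borel_upset) (auto intro: less_le_trans)
qed

lemma borel_measurable_antimono_ennreal:
  fixes f :: "real \<Rightarrow> ennreal"
  assumes "antimono f" shows "f \<in> borel_measurable borel"
proof -
  have "mono (\<lambda>x. f (- x))" using antimonoD[OF assms] by (intro monoI) auto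
  then have "(\<lambda>x. f (- x)) \<in> borel_measurable borel" by (rule borel_measurable_mono_ennreal)
  then have "(\<lambda>x. f (- (- x))) \<in> borel_measurable borel" by (rule measurable_compose[rotated]) auto
  then show ?thesis by simp
qed

text \<open>The final segment generated by T may be open, closed or the whole line, and T may be
  uncountable. If T is nonempty, the segment is an increasing union of half-lines
  \<open>{s n..}\<close>, each starting at or to the right of some element of T, so the bound passes
  to it by continuity from below. Superlevel sets of monotone functions have this form.\<close>

lemma emeasure_upset_le:
  fixes y :: "'i \<Rightarrow> real"
  assumes [measurable]: "y \<in> borel_measurable M"
    and le: "\<And>t. t \<in> T \<Longrightarrow> emeasure M {i \<in> space M. t \<le> y i} \<le> K"
  shows "emeasure M {i \<in> space M. \<exists>t\<in>T. t \<le> y i} \<le> K"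
proof -
  have *: ?thesis
    if s: "antimono s" "\<And>n::nat. \<exists>t\<in>T. t \<le> s n" and eq: "\<And>x. (\<exists>t\<in>T. t \<le> x) \<longleftrightarrow> (\<exists>n. s n \<le> x)" for s
  proof -
    have "{i \<in> space M. \<exists>t\<in>T. t \<le> y i} = (\<Union>n. {i \<in> space M. s n \<le> y i})" using eq by auto
    also have "emeasure M \<dots> = (SUP n. emeasure M {i \<in> space M. s n \<le> y i})"
      using s(1) by (intro SUP_emeasure_incseq[symmetric])
        (auto simp: incseq_def antimono_def intro: order_trans)
    also have "\<dots> \<le> K"
    proof (rule SUP_least)
      fix n
      obtain t where t: "t \<in> T" "t \<le> s n" using s(2) by blast
      have "emeasure M {i \<in> space M. s n \<le> y i} \<le> emeasure M {i \<in> space M. t \<le> y i}"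
        using t by (intro emeasure_mono) auto
      also have "\<dots> \<le> K" using le t by auto
      finally show "emeasure M {i \<in> space M. s n \<le> y i} \<le> K" .
    qed
    finally show ?thesis .
  qed
  consider "T = {}" | "T \<noteq> {}" "\<not> bdd_below T" | "T \<noteq> {}" "bdd_below T" "Inf T \<in> T"
    | "T \<noteq> {}" "bdd_below T" "Inf T \<notin> T" by metis
  then show ?thesis
  proof cases
    case 2
    have low: "\<exists>t\<in>T. t \<le> x" for x
    proof (rule ccontr)
      assume "\<not> (\<exists>t\<in>T. t \<le> x)"
      then have "bdd_below T" by (intro bdd_belowI[of _ x]) force
      then show False using 2 by simp
    qed
    show ?thesis
    proof (rule *[of "\<lambda>n. - real n"])
      show "(\<exists>t\<in>T. t \<le> x) \<longleftrightarrow> (\<exists>n. - real n \<le> x)" for x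
      proof -
        obtain n where "- x \<le> real n" using real_arch_simple by blast
        then have "- real n \<le> x" by simp
        then show ?thesis using low by blast
      qed
    qed (use low in \<open>auto simp: antimono_def\<close>)
  next
    case 3
    then show ?thesis
      using cInf_lower[OF _ 3(2)] by (intro *[of "\<lambda>n. Inf T"]) (auto simp: antimono_def intro: order_trans)
  next
    case 4
    have lt: "Inf T < t" if "t \<in> T" for t using cInf_lower[OF that 4(2)] that 4(3) by (cases "t = Inf T") auto
    show ?thesis
    proof (rule *[of "\<lambda>n. Inf T + 1 / real (Suc n)"])
      show "antimono (\<lambda>n. Inf T + 1 / real (Suc n))" by (auto simp: antimono_def frac_le)
      show ex: "\<exists>t\<in>T. t \<le> Inf T + 1 / real (Suc n)" for n
        using cInf_lessD[OF 4(1), of "Inf T + 1 / real (Suc n)"] by (auto intro: less_imp_le)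
      show "(\<exists>t\<in>T. t \<le> x) \<longleftrightarrow> (\<exists>n. Inf T + 1 / real (Suc n) \<le> x)" for x
      proof
        assume "\<exists>t\<in>T. t \<le> x"
        then have "0 < x - Inf T" using lt by force
        then obtain n where "1 / real (Suc n) < x - Inf T" using reals_Archimedean[of "x - Inf T"] by (auto simp: inverse_eq_divide)
        then show "\<exists>n. Inf T + 1 / real (Suc n) \<le> x" by (intro exI[of _ n]) simp
      qed (use ex in \<open>meson order_trans\<close>)
    qed
  qed auto
qed

lemma sets_upset_vimage [measurable]:
  fixes y :: "'i \<Rightarrow> real"
  assumes [measurable]: "y \<in> borel_measurable M"
  shows "{i \<in> space M. \<exists>t\<in>T. t \<le> y i} \<in> sets M"
proof -
  have "{x. \<exists>t\<in>T. t \<le> x} \<in> sets borel" by (intro borel_upset) (auto intro: order_trans)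
  then have "y -` {x. \<exists>t\<in>T. t \<le> x} \<inter> space M \<in> sets M" by (rule measurable_sets[OF assms])
  then show ?thesis by (auto simp: vimage_def Int_def conj_commute)
qed

section \<open>Embeddings of cones of monotone functions\<close>

text \<open>The factor \<open>2 powe q\<close> pays for passing from a q-th power to its levels, the
  power of \<open>clev p\<close> for returning from the levels to a p-th power.\<close>

definition cB1 :: "real \<Rightarrow> real \<Rightarrow> ennreal" where
  "cB1 p q = 2 powe q * clev p powe (q / p)"

lemma cB1_finite [simp]: "0 < p \<Longrightarrow> 0 < q \<Longrightarrow> cB1 p q < top"
  by (auto simp: cB1_def ennreal_mult_less_top)

lemma level_upset:
  assumes "mono (f :: real \<Rightarrow> ennreal)"
  shows "{i \<in> A. l < f (y i)} = {i \<in> A. \<exists>t\<in>{t. l < f t}. t \<le> y i}"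
  using monoD[OF assms] by (auto intro: less_le_trans)

text \<open>Let a m be \<open>lev m powe p\<close> times the \<nu>-measure of the m-th superlevel
  set. The hypothesis bounds the m-th term on the \<sigma>-side by
  \<open>K * a m powe (q / p)\<close>, and since q / p >= 1 the sum over m can be moved inside the
  power. Final segments of infinite \<nu>-measure are left out of the hypothesis because quotients
  by them are 0; finiteness of the norm of f ensures that they do not occur among the superlevel
  sets.\<close>

lemma monotone_embedding_le:
  fixes y :: "'i \<Rightarrow> real" and f :: "real \<Rightarrow> ennreal"
  assumes f: "mono f" and p: "0 < p" "p \<le> q"
    and y [measurable]: "y \<in> borel_measurable \<sigma>"
    and nu [measurable]: "(\<lambda>x. x) \<in> borel_measurable \<nu>" "space \<nu> = UNIV"
    and le: "\<And>t. emeasure \<nu> {t..} < top \<Longrightarrow>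
       emeasure \<sigma> {i \<in> space \<sigma>. t \<le> y i} \<le> K * emeasure \<nu> {t..} powe (q / p)"
    and fin: "(\<integral>\<^sup>+x. f x powe p \<partial>\<nu>) < top"
  shows "(\<integral>\<^sup>+i. f (y i) powe q \<partial>\<sigma>) \<le> cB1 p q * (K * (\<integral>\<^sup>+x. f x powe p \<partial>\<nu>) powe (q / p))"
proof -
  note [measurable] = borel_measurable_mono_ennreal[OF f]
  have q: "0 < q" using p by simp
  have [measurable]: "f \<in> borel_measurable \<nu>"
    using measurable_compose[OF nu(1) borel_measurable_mono_ennreal[OF f]] by simp
  have [measurable]: "(\<lambda>i. f (y i)) \<in> borel_measurable \<sigma>" by measurable
  let ?X = "\<integral>\<^sup>+x. f x powe p \<partial>\<nu>"
  define a where "a m = lev m powe p * emeasure \<nu> {x \<in> space \<nu>. lev m < f x}" for m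
  have suma: "(\<integral>\<^sup>+m. a m \<partial>count_space UNIV) \<le> clev p * ?X"
    unfolding a_def by (rule levels_le_nn_integral_epowr) (use p in auto)
  also have "\<dots> < top" using fin by (simp add: ennreal_mult_less_top)
  finally have fina: "(\<integral>\<^sup>+m. a m \<partial>count_space UNIV) < top" .
  have term_le: "lev m powe q * emeasure \<sigma> {i \<in> space \<sigma>. lev m < f (y i)} \<le> K * a m powe (q / p)" for m
  proof -
    have "a m \<le> (\<integral>\<^sup>+m. a m \<partial>count_space UNIV)" by (rule nn_integral_ge_point) auto
    then have am: "a m < top" using fina by simp
    have numf: "emeasure \<nu> {x \<in> space \<nu>. lev m < f x} < top"
      using am p by (auto simp: a_def ennreal_mult_less_top epowr_eq_0_iff)
    have "emeasure \<sigma> {i \<in> space \<sigma>. \<exists>t\<in>{t. lev m < f t}. t \<le> y i}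
        \<le> K * emeasure \<nu> {x \<in> space \<nu>. lev m < f x} powe (q / p)"
    proof (rule emeasure_upset_le[OF y])
      fix t assume "t \<in> {t. lev m < f t}"
      then have sub: "{t..} \<subseteq> {x \<in> space \<nu>. lev m < f x}"
        using monoD[OF f] nu(2) by (auto intro: less_le_trans)
      then have le1: "emeasure \<nu> {t..} \<le> emeasure \<nu> {x \<in> space \<nu>. lev m < f x}"
        by (rule emeasure_mono) measurable
      then have "emeasure \<sigma> {i \<in> space \<sigma>. t \<le> y i} \<le> K * emeasure \<nu> {t..} powe (q / p)"
        using numf by (intro le) (auto intro: le_less_trans)
      also have "\<dots> \<le> K * emeasure \<nu> {x \<in> space \<nu>. lev m < f x} powe (q / p)"
        using p by (intro mult_left_mono epowr_mono le1) auto
      finally show "emeasure \<sigma> {i \<in> space \<sigma>. t \<le> y i} \<le> K * emeasure \<nu> {x \<in> space \<nu>. lev m < f x} powe (q / p)" .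
    qed
    then have *: "emeasure \<sigma> {i \<in> space \<sigma>. lev m < f (y i)} \<le> K * emeasure \<nu> {x \<in> space \<nu>. lev m < f x} powe (q / p)"
      by (simp add: level_upset[OF f])
    have "lev m powe q * emeasure \<sigma> {i \<in> space \<sigma>. lev m < f (y i)}
       \<le> lev m powe q * (K * emeasure \<nu> {x \<in> space \<nu>. lev m < f x} powe (q / p))"
      by (intro mult_left_mono *) auto
    also have "\<dots> = K * a m powe (q / p)"
      using p by (simp add: a_def epowr_mult epowr_epowr mult_ac)
    finally show ?thesis .
  qed
  have "(\<integral>\<^sup>+i. f (y i) powe q \<partial>\<sigma>) \<le> 2 powe q *
     (\<integral>\<^sup>+m. lev m powe q * emeasure \<sigma> {i \<in> space \<sigma>. lev m < f (y i)} \<partial>count_space UNIV)"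
    by (rule nn_integral_epowr_le_levels) (use q in auto)
  also have "\<dots> \<le> 2 powe q * (\<integral>\<^sup>+m. K * a m powe (q / p) \<partial>count_space UNIV)"
    by (intro mult_left_mono nn_integral_mono term_le) auto
  also have "\<dots> = 2 powe q * (K * (\<integral>\<^sup>+m. a m powe (q / p) \<partial>count_space UNIV))"
    by (simp add: nn_integral_cmult)
  also have "\<dots> \<le> 2 powe q * (K * (\<integral>\<^sup>+m. a m \<partial>count_space UNIV) powe (q / p))"
    using p by (intro mult_left_mono nn_integral_epowr_le) (auto intro: nn_integral_ge_point)
  also have "\<dots> \<le> 2 powe q * (K * (clev p * ?X) powe (q / p))"
    using p suma by (intro mult_left_mono epowr_mono) auto
  also have "\<dots> = cB1 p q * (K * ?X powe (q / p))"
    using p by (simp add: cB1_def epowr_mult mult_ac)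
  finally show ?thesis .
qed

definition cW :: "real \<Rightarrow> ennreal" where
  "cW r = 2 powe (1 + r) * clev r"

lemma cW_finite [simp]: "0 < r \<Longrightarrow> cW r < top"
  by (auto simp: cW_def ennreal_mult_less_top)

text \<open>Multiplying the inequality at level m by \<open>lev m powe r\<close> and summing over m
  gives integrals whose exponents differ by 1.\<close>

lemma weak_type_imp_strong:
  assumes [measurable]: "g \<in> borel_measurable \<nu>" "G \<in> borel_measurable \<sigma>" and r: "0 < r"
    and le: "\<And>m. lev m * emeasure \<nu> {x \<in> space \<nu>. lev m < g x} \<le> L * emeasure \<sigma> {i \<in> space \<sigma>. lev m < G i}"
  shows "(\<integral>\<^sup>+x. g x powe (1 + r) \<partial>\<nu>) \<le> cW r * (L * (\<integral>\<^sup>+i. G i powe r \<partial>\<sigma>))"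
proof -
  have "(\<integral>\<^sup>+x. g x powe (1 + r) \<partial>\<nu>) \<le> 2 powe (1 + r) *
     (\<integral>\<^sup>+m. lev m powe (1 + r) * emeasure \<nu> {x \<in> space \<nu>. lev m < g x} \<partial>count_space UNIV)"
    by (rule nn_integral_epowr_le_levels) (use r in auto)
  also have "\<dots> \<le> 2 powe (1 + r) *
     (\<integral>\<^sup>+m. L * (lev m powe r * emeasure \<sigma> {i \<in> space \<sigma>. lev m < G i}) \<partial>count_space UNIV)"
  proof (intro mult_left_mono nn_integral_mono)
    fix m
    have "lev m powe (1 + r) * emeasure \<nu> {x \<in> space \<nu>. lev m < g x}
       = lev m powe r * (lev m * emeasure \<nu> {x \<in> space \<nu>. lev m < g x})"
      using r by (simp add: epowr_add mult_ac)
    also have "\<dots> \<le> lev m powe r * (L * emeasure \<sigma> {i \<in> space \<sigma>. lev m < G i})"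
      by (intro mult_left_mono le) auto
    finally show "lev m powe (1 + r) * emeasure \<nu> {x \<in> space \<nu>. lev m < g x}
      \<le> L * (lev m powe r * emeasure \<sigma> {i \<in> space \<sigma>. lev m < G i})" by (simp add: mult_ac)
  qed auto
  also have "\<dots> = 2 powe (1 + r) *
     (L * (\<integral>\<^sup>+m. lev m powe r * emeasure \<sigma> {i \<in> space \<sigma>. lev m < G i} \<partial>count_space UNIV))"
    by (simp add: nn_integral_cmult)
  also have "\<dots> \<le> 2 powe (1 + r) * (L * (clev r * (\<integral>\<^sup>+i. G i powe r \<partial>\<sigma>)))"
    using levels_le_nn_integral_epowr[OF assms(2) r] by (intro mult_left_mono) simp_all
  finally show ?thesis by (simp add: cW_def mult_ac)
qed

lemma mono_SUP_le: "mono (\<lambda>t::real. SUP k\<in>{k \<in> A. \<tau> k \<le> t}. (Q k :: ennreal))"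
  by (intro monoI SUP_subset_mono) auto

lemma less_SUP_le_iff:
  "(l::ennreal) < (SUP k\<in>{k \<in> A. \<tau> k \<le> (x::real)}. Q k) \<longleftrightarrow> (\<exists>t\<in>\<tau> ` {k \<in> A. l < Q k}. t \<le> x)"
  by (auto simp: less_SUP_iff)

text \<open>If Q k exceeds a level, so does g on all of \<open>{\<tau> k..}\<close>. The hypothesis
  therefore bounds the level times the \<nu>-measure of the superlevel set of g by the
  \<sigma>-measure of the points that y maps into it. This controls the norm of test functions that
  are powers of g.\<close>

lemma maximal_le:
  fixes y :: "'i \<Rightarrow> real" and \<tau> :: "'k \<Rightarrow> real" and Q :: "'k \<Rightarrow> ennreal" and A :: "'k set"
  defines "g \<equiv> \<lambda>t. SUP k\<in>{k \<in> A. \<tau> k \<le> t}. Q k"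
  assumes r: "0 < r"
    and y [measurable]: "y \<in> borel_measurable \<sigma>"
    and nu [measurable]: "(\<lambda>x. x) \<in> borel_measurable \<nu>" "space \<nu> = UNIV"
    and le: "\<And>k. k \<in> A \<Longrightarrow> Q k * emeasure \<nu> {\<tau> k..} \<le> emeasure \<sigma> {i \<in> space \<sigma>. \<tau> k \<le> y i}"
  shows "(\<integral>\<^sup>+x. g x powe (1 + r) \<partial>\<nu>) \<le> cW r * (\<integral>\<^sup>+i. g (y i) powe r \<partial>\<sigma>)"
proof -
  have g: "mono g" unfolding g_def by (rule mono_SUP_le)
  note [measurable] = borel_measurable_mono_ennreal[OF g]
  have [measurable]: "g \<in> borel_measurable \<nu>"
    using measurable_compose[OF nu(1) borel_measurable_mono_ennreal[OF g]] by simp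
  have meas: "{i \<in> space \<sigma>. lev m < g (y i)} \<in> sets \<sigma>" for m by measurable
  have "(\<integral>\<^sup>+x. g x powe (1 + r) \<partial>\<nu>) \<le> cW r * (1 * (\<integral>\<^sup>+i. g (y i) powe r \<partial>\<sigma>))"
  proof (rule weak_type_imp_strong)
    fix m
    have "emeasure \<nu> {x \<in> space \<nu>. \<exists>t\<in>\<tau> ` {k \<in> A. lev m < Q k}. t \<le> x}
       \<le> lev (- m) * emeasure \<sigma> {i \<in> space \<sigma>. lev m < g (y i)}"
    proof (rule emeasure_upset_le[OF nu(1)])
      fix t assume "t \<in> \<tau> ` {k \<in> A. lev m < Q k}"
      then obtain k where k: "k \<in> A" "lev m < Q k" "t = \<tau> k" by auto
      have "lev m * emeasure \<nu> {\<tau> k..} \<le> Q k * emeasure \<nu> {\<tau> k..}"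
        using k by (intro mult_right_mono) auto
      also have "\<dots> \<le> emeasure \<sigma> {i \<in> space \<sigma>. \<tau> k \<le> y i}" using le k by auto
      also have "\<dots> \<le> emeasure \<sigma> {i \<in> space \<sigma>. lev m < g (y i)}"
        using k by (intro emeasure_mono[OF _ meas]) (auto simp: g_def less_SUP_iff)
      finally show "emeasure \<nu> {x \<in> space \<nu>. t \<le> x} \<le> lev (- m) * emeasure \<sigma> {i \<in> space \<sigma>. lev m < g (y i)}"
        by (simp add: lev_mult_le k nu(2) atLeast_def)
    qed
    then show "lev m * emeasure \<nu> {x \<in> space \<nu>. lev m < g x} \<le> 1 * emeasure \<sigma> {i \<in> space \<sigma>. lev m < g (y i)}"
      by (simp add: lev_mult_le g_def less_SUP_le_iff)
  qed (use r in auto)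
  then show ?thesis by simp
qed

text \<open>Collects the passage to levels and back, the 2 of Hoelder's inequality, and the factors
  2 and \<open>2 powe r\<close> with r = q / (p - q) lost in the half-measure argument.\<close>

definition cB2 :: "real \<Rightarrow> real \<Rightarrow> ennreal" where
  "cB2 p q = 2 powe q * clev q * 2 * (cW (q / (p - q)) * 2 * 2 powe (q / (p - q))) powe (1 - q / p)"

lemma cB2_finite [simp]: "0 < q \<Longrightarrow> q < p \<Longrightarrow> cB2 p q < top"
  by (auto simp: cB2_def ennreal_mult_less_top)

lemma ennreal_le_double:
  assumes "ennreal a \<le> e + ennreal (a / 2)" "0 \<le> a"
  shows "ennreal a \<le> 2 * e"
proof (cases e)
  case (real r)
  then have "ennreal a \<le> ennreal (r + a / 2)" using assms by (simp add: ennreal_plus)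
  then have "a \<le> r + a / 2" using real assms(2) by (subst (asm) ennreal_le_iff) auto
  then have "a \<le> 2 * r" by simp
  then have "ennreal a \<le> ennreal (2 * r)" by (rule ennreal_leI)
  then show ?thesis using real by (simp add: ennreal_mult)
qed (simp add: ennreal_mult_top)

text \<open>The points at which S has dropped below half of S t form a final segment, whose measure
  is at most S t / 2 by \<open>emeasure_upset_le\<close>. The rest of the tail at t carries the
  other half; the half is absorbed using finiteness of S t.\<close>

lemma half_measure_upper_part:
  fixes \<sigma> :: "'i measure" and y :: "'i \<Rightarrow> real"
  defines "S \<equiv> \<lambda>t. emeasure \<sigma> {i \<in> space \<sigma>. t \<le> y i}"
  assumes y [measurable]: "y \<in> borel_measurable \<sigma>" and fin: "S t < top"
  shows "S t \<le> 2 * emeasure \<sigma> {i \<in> space \<sigma>. t \<le> y i \<and> S t \<le> 2 * S (y i)}"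
proof -
  have "antimono S" unfolding S_def by (intro antimonoI emeasure_mono) auto
  note [measurable] = borel_measurable_antimono_ennreal[OF this]
  let ?E = "{i \<in> space \<sigma>. t \<le> y i \<and> S t \<le> 2 * S (y i)}"
  let ?E' = "{i \<in> space \<sigma>. \<exists>s\<in>{s. 2 * S s < S t}. s \<le> y i}"
  have E': "?E' \<in> sets \<sigma>" by (rule sets_upset_vimage[OF y])
  have E: "?E \<in> sets \<sigma>" by measurable
  obtain a where a: "S t = ennreal a" "0 \<le> a" using fin by (cases "S t") auto
  have "emeasure \<sigma> ?E' \<le> ennreal (a / 2)"
  proof (rule emeasure_upset_le[OF y])
    fix s assume "s \<in> {s. 2 * S s < S t}"
    then have "S s + S s < ennreal a" using a by (simp add: mult_2)
    then have "S s \<le> ennreal (a / 2)"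
      by (cases "S s") (auto simp: ennreal_plus[symmetric] ennreal_less_iff simp del: ennreal_plus)
    then show "emeasure \<sigma> {i \<in> space \<sigma>. s \<le> y i} \<le> ennreal (a / 2)" by (simp add: S_def)
  qed
  moreover have "S t \<le> emeasure \<sigma> (?E \<union> ?E')"
  proof -
    have "{i \<in> space \<sigma>. t \<le> y i} \<subseteq> ?E \<union> ?E'" by (auto simp: not_le)
    then have "emeasure \<sigma> {i \<in> space \<sigma>. t \<le> y i} \<le> emeasure \<sigma> (?E \<union> ?E')"
      by (rule emeasure_mono[OF _ sets.Un[OF E E']])
    then show ?thesis by (simp add: S_def)
  qed
  moreover have "emeasure \<sigma> (?E \<union> ?E') \<le> emeasure \<sigma> ?E + emeasure \<sigma> ?E'"
    by (rule emeasure_subadditive[OF _ E']) measurable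
  ultimately have "ennreal a \<le> emeasure \<sigma> ?E + ennreal (a / 2)"
    unfolding a(1) by (meson add_left_mono order_trans)
  then have "ennreal a \<le> 2 * emeasure \<sigma> ?E" using a(2) by (rule ennreal_le_double)
  then show ?thesis by (simp add: a(1))
qed

text \<open>The maximal function g of the quotients Q makes g d\<nu> dominate \<sigma> on the
  superlevel sets of f, because S (y k) = Q k * V (y k) and g >= Q k to the right of y k. So f^q may
  be integrated against g d\<nu>, and Hoelder's inequality with exponents p / q and 1 + r applies.
  The integral of g^(1 + r) is controlled by that of Q^r: on the upper part of the tail at y k the
  function S has lost at most a factor 2 and V has not grown, so Q k <= 2 Q i there.\<close>

lemma monotone_embedding_gt:
  fixes \<sigma> :: "'i measure" and y :: "'i \<Rightarrow> real" and f :: "real \<Rightarrow> ennreal"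
  defines "S \<equiv> \<lambda>t. emeasure \<sigma> {i \<in> space \<sigma>. t \<le> y i}"
  assumes f: "mono f" and q: "0 < q" "q < p"
    and y [measurable]: "y \<in> borel_measurable \<sigma>"
    and nu [measurable]: "(\<lambda>x. x) \<in> borel_measurable \<nu>" "space \<nu> = UNIV"
    and finS: "\<And>i. i \<in> space \<sigma> \<Longrightarrow> S (y i) < top"
    and V0: "\<And>i. i \<in> space \<sigma> \<Longrightarrow> emeasure \<nu> {y i..} = 0 \<Longrightarrow> S (y i) = 0"
    and fin: "(\<integral>\<^sup>+x. f x powe p \<partial>\<nu>) < top"
  shows "(\<integral>\<^sup>+i. f (y i) powe q \<partial>\<sigma>) \<le> cB2 p q * ((\<integral>\<^sup>+x. f x powe p \<partial>\<nu>) powe (q / p) *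
    (\<integral>\<^sup>+i. (S (y i) * emeasure \<nu> {y i..} powe (- 1)) powe (q / (p - q)) \<partial>\<sigma>) powe (1 - q / p))"
proof -
  have p: "0 < p" using q by simp
  define r where "r = q / (p - q)"
  have r: "0 < r" using q by (simp add: r_def)
  \<comment> \<open>1 + r is conjugate to p / q, so the outer exponent of Hoelder's inequality
    undoes the power of g.\<close>
  have r1: "(1 + r) * (1 - q / p) = 1" using q p by (simp add: r_def field_simps)
  define V where "V t = emeasure \<nu> {t..}" for t
  define Q where "Q i = S (y i) * V (y i) powe (- 1)" for i
  define g where "g = (\<lambda>t. SUP k\<in>{k \<in> space \<sigma>. y k \<le> t}. Q k)"
  have Ici [measurable]: "{t..} \<in> sets \<nu>" for t :: real
    using measurable_sets[OF nu(1), of "{t..}"] nu(2) by simp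
  have antiS: "antimono S" unfolding S_def by (intro antimonoI emeasure_mono) auto
  have antiV: "antimono V" unfolding V_def by (intro antimonoI emeasure_mono) auto
  note [measurable] = borel_measurable_antimono_ennreal[OF antiS] borel_measurable_antimono_ennreal[OF antiV]
    borel_measurable_mono_ennreal[OF f]
  have [measurable]: "Q \<in> borel_measurable \<sigma>" unfolding Q_def by measurable
  have g: "mono g" unfolding g_def by (rule mono_SUP_le)
  note [measurable] = borel_measurable_mono_ennreal[OF g]
  have [measurable]: "f \<in> borel_measurable \<nu>" "g \<in> borel_measurable \<nu>"
    using measurable_compose[OF nu(1) borel_measurable_mono_ennreal[OF f]]
      measurable_compose[OF nu(1) borel_measurable_mono_ennreal[OF g]] by simp_all
  let ?X = "\<integral>\<^sup>+x. f x powe p \<partial>\<nu>"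

  have m1: "g \<in> borel_measurable \<nu>" and m2: "(\<lambda>i. 2 * Q i) \<in> borel_measurable \<sigma>"
    by measurable
  have strong: "(\<integral>\<^sup>+x. g x powe (1 + r) \<partial>\<nu>) \<le> cW r * (2 * (\<integral>\<^sup>+i. (2 * Q i) powe r \<partial>\<sigma>))"
  proof (rule weak_type_imp_strong[OF m1 m2 r])
    fix m
    have "emeasure \<nu> {x \<in> space \<nu>. \<exists>t\<in>y ` {k \<in> space \<sigma>. lev m < Q k}. t \<le> x}
       \<le> lev (- m) * (2 * emeasure \<sigma> {i \<in> space \<sigma>. lev m < 2 * Q i})"
    proof (rule emeasure_upset_le[OF nu(1)])
      fix t assume "t \<in> y ` {k \<in> space \<sigma>. lev m < Q k}"
      then obtain k where k: "k \<in> space \<sigma>" "lev m < Q k" "t = y k" by auto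
      have "lev m * V (y k) \<le> Q k * V (y k)" using k by (intro mult_right_mono) auto
      also have "\<dots> \<le> S (y k)"
      proof (cases "V (y k)" rule: ennreal_cases3)
        case (3 a)
        then show ?thesis by (simp add: Q_def mult.assoc epowr_ennreal ennreal_mult[symmetric] powr_minus)
      qed (use q in \<open>auto simp: Q_def\<close>)
      also have "\<dots> \<le> 2 * emeasure \<sigma> {i \<in> space \<sigma>. y k \<le> y i \<and> S (y k) \<le> 2 * S (y i)}"
        unfolding S_def by (rule half_measure_upper_part) (use finS[OF k(1)] in \<open>auto simp: S_def\<close>)
      also have "\<dots> \<le> 2 * emeasure \<sigma> {i \<in> space \<sigma>. lev m < 2 * Q i}"
      proof (intro mult_left_mono emeasure_mono subsetI)
        fix i assume i: "i \<in> {i \<in> space \<sigma>. y k \<le> y i \<and> S (y k) \<le> 2 * S (y i)}"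
        have "lev m < S (y k) * V (y k) powe (- 1)" using k by (simp add: Q_def)
        also have "\<dots> \<le> 2 * S (y i) * V (y i) powe (- 1)"
          using i antimonoD[OF antiV, of "y k" "y i"] by (intro mult_mono epowr_antimono) auto
        finally show "i \<in> {i \<in> space \<sigma>. lev m < 2 * Q i}" using i by (simp add: Q_def mult.assoc)
      qed auto
      finally show "emeasure \<nu> {x \<in> space \<nu>. t \<le> x} \<le> lev (- m) * (2 * emeasure \<sigma> {i \<in> space \<sigma>. lev m < 2 * Q i})"
        by (simp add: lev_mult_le k nu(2) atLeast_def V_def)
    qed
    then show "lev m * emeasure \<nu> {x \<in> space \<nu>. lev m < g x} \<le> 2 * emeasure \<sigma> {i \<in> space \<sigma>. lev m < 2 * Q i}"
      by (simp add: lev_mult_le g_def less_SUP_le_iff)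
  qed

  have term_le: "lev m powe q * emeasure \<sigma> {i \<in> space \<sigma>. lev m < f (y i)} \<le>
     lev m powe q * emeasure (density \<nu> g) {x \<in> space (density \<nu> g). lev m < f x}" for m
  proof (intro mult_left_mono)
    have "lev m powe p * emeasure \<nu> {x \<in> space \<nu>. lev m < f x} \<le>
       (\<integral>\<^sup>+m. lev m powe p * emeasure \<nu> {x \<in> space \<nu>. lev m < f x} \<partial>count_space UNIV)"
      by (rule nn_integral_ge_point) auto
    also have "\<dots> \<le> clev p * ?X"
      by (rule levels_le_nn_integral_epowr) (use p in auto)
    also have "\<dots> < top" using fin by (simp add: ennreal_mult_less_top)
    finally have numf: "emeasure \<nu> {x \<in> space \<nu>. lev m < f x} < top"
      using p by (auto simp: ennreal_mult_less_top epowr_eq_0_iff)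
    have eq: "{i \<in> space \<sigma>. lev m < f (y i)} = {i \<in> space \<sigma>. \<exists>t\<in>y ` {k \<in> space \<sigma>. lev m < f (y k)}. t \<le> y i}"
      using monoD[OF f] by (auto intro: less_le_trans)
    have "emeasure \<sigma> {i \<in> space \<sigma>. \<exists>t\<in>y ` {k \<in> space \<sigma>. lev m < f (y k)}. t \<le> y i}
      \<le> emeasure (density \<nu> g) {x \<in> space (density \<nu> g). lev m < f x}"
    proof (rule emeasure_upset_le[OF y])
      fix t assume "t \<in> y ` {k \<in> space \<sigma>. lev m < f (y k)}"
      then obtain k where k: "k \<in> space \<sigma>" "lev m < f (y k)" "t = y k" by auto
      have sub: "{y k..} \<subseteq> {x \<in> space \<nu>. lev m < f x}"
        using k monoD[OF f] nu(2) by (auto intro: less_le_trans)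
      then have "V (y k) \<le> emeasure \<nu> {x \<in> space \<nu>. lev m < f x}"
        unfolding V_def by (rule emeasure_mono) measurable
      then have "V (y k) < top" using numf by (rule le_less_trans)
      then have "S (y k) \<le> Q k * V (y k)"
      proof (cases "V (y k)" rule: ennreal_cases3)
        \<comment> \<open>Here \<open>Q k * V (y k)\<close> is 0 whatever Q k is, so S (y k) has to
          vanish too.\<close>
        case 1
        then show ?thesis using V0[OF k(1)] by (simp add: V_def)
      next
        case (3 a)
        then show ?thesis by (simp add: Q_def mult.assoc epowr_ennreal ennreal_mult[symmetric] powr_minus)
      qed auto
      also have "\<dots> = (\<integral>\<^sup>+x. Q k * indicator {y k..} x \<partial>\<nu>)" by (simp add: V_def nn_integral_cmult_indicator)
      also have "\<dots> \<le> (\<integral>\<^sup>+x. g x * indicator {x \<in> space \<nu>. lev m < f x} x \<partial>\<nu>)"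
        using k sub by (intro nn_integral_mono) (auto simp: g_def split: split_indicator intro: SUP_upper)
      also have "\<dots> = emeasure (density \<nu> g) {x \<in> space (density \<nu> g). lev m < f x}"
        by (subst emeasure_density) auto
      finally show "emeasure \<sigma> {i \<in> space \<sigma>. t \<le> y i}
        \<le> emeasure (density \<nu> g) {x \<in> space (density \<nu> g). lev m < f x}"
        using k by (simp add: S_def)
    qed
    then show "emeasure \<sigma> {i \<in> space \<sigma>. lev m < f (y i)}
      \<le> emeasure (density \<nu> g) {x \<in> space (density \<nu> g). lev m < f x}"
      by (subst eq)
  qed auto
  have "(\<integral>\<^sup>+i. f (y i) powe q \<partial>\<sigma>) \<le> 2 powe q *
     (\<integral>\<^sup>+m. lev m powe q * emeasure \<sigma> {i \<in> space \<sigma>. lev m < f (y i)} \<partial>count_space UNIV)"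
    by (rule nn_integral_epowr_le_levels) (use q in auto)
  also have "\<dots> \<le> 2 powe q *
     (\<integral>\<^sup>+m. lev m powe q * emeasure (density \<nu> g) {x \<in> space (density \<nu> g). lev m < f x} \<partial>count_space UNIV)"
    by (intro mult_left_mono nn_integral_mono term_le) auto
  also have "\<dots> \<le> 2 powe q * (clev q * (\<integral>\<^sup>+x. f x powe q \<partial>density \<nu> g))"
    by (intro mult_left_mono levels_le_nn_integral_epowr) (use q in auto)
  also have "(\<integral>\<^sup>+x. f x powe q \<partial>density \<nu> g) = (\<integral>\<^sup>+x. (f x powe p) powe (q / p) * (g x powe (1 + r)) powe (1 - q / p) \<partial>\<nu>)"
    using p by (subst nn_integral_density) (auto simp: epowr_epowr r1 mult.commute)
  also have "\<dots> \<le> 2 * (?X powe (q / p) * (\<integral>\<^sup>+x. g x powe (1 + r) \<partial>\<nu>) powe (1 - q / p))"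
    by (rule nn_integral_Holder) (use q in auto)
  also have "\<dots> \<le> 2 * (?X powe (q / p) * (cW r * (2 * (\<integral>\<^sup>+i. (2 * Q i) powe r \<partial>\<sigma>))) powe (1 - q / p))"
    using q p by (intro mult_left_mono epowr_mono strong) auto
  also have "(\<integral>\<^sup>+i. (2 * Q i) powe r \<partial>\<sigma>) = 2 powe r * (\<integral>\<^sup>+i. Q i powe r \<partial>\<sigma>)"
    using r by (simp add: epowr_mult nn_integral_cmult)
  finally have "(\<integral>\<^sup>+i. f (y i) powe q \<partial>\<sigma>) \<le> 2 powe q * (clev q * (2 * (?X powe (q / p) *
    (cW r * (2 * (2 powe r * (\<integral>\<^sup>+i. Q i powe r \<partial>\<sigma>)))) powe (1 - q / p))))"
    by (simp add: mult_left_mono)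
  also have "\<dots> = cB2 p q * (?X powe (q / p) * (\<integral>\<^sup>+i. Q i powe r \<partial>\<sigma>) powe (1 - q / p))"
    using q p by (simp add: cB2_def r_def[symmetric] epowr_mult mult_ac)
  finally show ?thesis by (simp add: Q_def V_def r_def)
qed

section \<open>Discretization of the weight\<close>

definition seg :: "(real \<Rightarrow> ennreal) \<Rightarrow> real \<Rightarrow> real \<Rightarrow> ennreal" where
  "seg u t x = (\<integral>\<^sup>+s. u s * indicator {t<..<x} s \<partial>lebesgue)"

definition tail :: "(real \<Rightarrow> ennreal) \<Rightarrow> real \<Rightarrow> ennreal" where
  "tail v t = (\<integral>\<^sup>+s. v s * indicator {t<..} s \<partial>lebesgue)"

definition hardy_op :: "(real \<Rightarrow> ennreal) \<Rightarrow> (real \<Rightarrow> ennreal) \<Rightarrow> real \<Rightarrow> ennreal" where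
  "hardy_op f u x = (\<integral>\<^sup>+s. f s * u s * indicator {..<x} s \<partial>lebesgue)"

abbreviation wint :: "real \<Rightarrow> (real \<Rightarrow> ennreal) \<Rightarrow> (real \<Rightarrow> ennreal) \<Rightarrow> ennreal" where
  "wint p v f \<equiv> \<integral>\<^sup>+x. f x powe p * v x \<partial>lebesgue"

text \<open>The inner integral of \<open>C\<^sub>1\<close> and \<open>C\<^sub>3\<close>. It is also
  the q-th power of the left-hand side of the Hardy inequality for the indicator of
  \<open>{x<..}\<close>.\<close>

definition kernel_tail :: "real \<Rightarrow> (real \<Rightarrow> ennreal) \<Rightarrow> (real \<Rightarrow> ennreal) \<Rightarrow> real \<Rightarrow> ennreal" where
  "kernel_tail q u w x = (\<integral>\<^sup>+s. w s * seg u x s powe q * indicator {x<..} s \<partial>lebesgue)"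

lemma seg_mono: "t' \<le> t \<Longrightarrow> x \<le> x' \<Longrightarrow> seg u t x \<le> seg u t' x'"
  unfolding seg_def by (intro nn_integral_mono) (auto split: split_indicator)

lemma seg_empty [simp]: "x \<le> t \<Longrightarrow> seg u t x = 0"
  by (simp add: seg_def)

lemma tail_antimono: "t \<le> x \<Longrightarrow> tail v x \<le> tail v t"
  unfolding tail_def by (intro nn_integral_mono) (auto split: split_indicator)

lemma hardy_op_mono: "x \<le> x' \<Longrightarrow> hardy_op f u x \<le> hardy_op f u x'"
  unfolding hardy_op_def by (intro nn_integral_mono) (auto split: split_indicator)

lemma kernel_tail_antimono:
  assumes "0 < q" "x \<le> x'" shows "kernel_tail q u w x' \<le> kernel_tail q u w x"
  unfolding kernel_tail_def
proof (intro nn_integral_mono)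
  fix s
  have "seg u x' s powe q \<le> seg u x s powe q" using assms by (intro epowr_mono seg_mono) auto
  then show "w s * seg u x' s powe q * indicator {x'<..} s \<le> w s * seg u x s powe q * indicator {x<..} s"
    using assms by (auto split: split_indicator intro: mult_left_mono)
qed

section \<open>Integrals split at a point, and points where a tail takes a given value\<close>

lemma AE_lebesgue_neq: "AE s in lebesgue. s \<noteq> (x::real)"
  by (rule AE_I'[of "{x}"]) (auto simp: null_sets_completionI)

lemma measurable_lebesgue_ident [measurable]: "(\<lambda>x::real. x) \<in> borel_measurable lebesgue"
  by (rule measurable_completion) simp

lemma seg_split:
  assumes [measurable]: "u \<in> borel_measurable lebesgue" and "t \<le> y" "y \<le> x"
  shows "seg u t x = seg u t y + seg u y x"
proof -
  have "seg u t x = (\<integral>\<^sup>+s. u s * indicator {t<..<y} s + u s * indicator {y<..<x} s \<partial>lebesgue)"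
    unfolding seg_def using AE_lebesgue_neq[of y] assms(2,3)
    by (intro nn_integral_cong_AE) (auto elim!: eventually_mono split: split_indicator)
  also have "\<dots> = seg u t y + seg u y x" unfolding seg_def by (rule nn_integral_add) measurable
  finally show ?thesis .
qed

lemma hardy_op_split:
  assumes [measurable]: "u \<in> borel_measurable lebesgue" "f \<in> borel_measurable lebesgue" and "x \<le> x'"
  shows "hardy_op f u x' = hardy_op f u x + (\<integral>\<^sup>+s. f s * u s * indicator {x<..<x'} s \<partial>lebesgue)"
proof -
  have "hardy_op f u x' = (\<integral>\<^sup>+s. f s * u s * indicator {..<x} s + f s * u s * indicator {x<..<x'} s \<partial>lebesgue)"
    unfolding hardy_op_def using AE_lebesgue_neq[of x] assms(3)
    by (intro nn_integral_cong_AE) (auto elim!: eventually_mono split: split_indicator)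
  also have "\<dots> = hardy_op f u x + (\<integral>\<^sup>+s. f s * u s * indicator {x<..<x'} s \<partial>lebesgue)"
    unfolding hardy_op_def by (rule nn_integral_add) measurable
  finally show ?thesis .
qed

lemma tail_split:
  assumes [measurable]: "w \<in> borel_measurable lebesgue" and "t \<le> x"
  shows "tail w t = (\<integral>\<^sup>+s. w s * indicator {t<..x} s \<partial>lebesgue) + tail w x"
proof -
  have "tail w t = (\<integral>\<^sup>+s. w s * indicator {t<..x} s + w s * indicator {x<..} s \<partial>lebesgue)"
    unfolding tail_def using assms(2) by (intro nn_integral_cong) (auto split: split_indicator)
  also have "\<dots> = (\<integral>\<^sup>+s. w s * indicator {t<..x} s \<partial>lebesgue) + tail w x"
    unfolding tail_def by (rule nn_integral_add) measurable
  finally show ?thesis .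
qed

lemma emeasure_density_Ici:
  assumes [measurable]: "v \<in> borel_measurable lebesgue"
  shows "emeasure (density lebesgue v) {t::real..} = tail v t"
proof -
  have "emeasure (density lebesgue v) {t..} = (\<integral>\<^sup>+s. v s * indicator {t..} s \<partial>lebesgue)"
    by (rule emeasure_density) auto
  also have "\<dots> = tail v t" unfolding tail_def
    using AE_lebesgue_neq[of t] by (auto intro!: nn_integral_cong_AE elim!: eventually_mono split: split_indicator)
  finally show ?thesis .
qed

lemma borel_measurable_mono_lebesgue [intro]:
  "mono (f :: real \<Rightarrow> ennreal) \<Longrightarrow> f \<in> borel_measurable lebesgue"
  by (rule measurable_completion) (simp add: borel_measurable_mono_ennreal)

lemma borel_measurable_antimono_lebesgue [intro]:
  "antimono (f :: real \<Rightarrow> ennreal) \<Longrightarrow> f \<in> borel_measurable lebesgue"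
  by (rule measurable_completion) (simp add: borel_measurable_antimono_ennreal)

text \<open>The finite measure w(s) ds on \<open>{\<alpha><..}\<close> has no atoms, so its
  distribution function is continuous and takes the value \<omega> - c by the intermediate value
  theorem.\<close>

lemma tail_level_points:
  assumes [measurable]: "w \<in> borel_measurable lebesgue"
    and tot: "tail w \<alpha> = ennreal \<omega>" "0 < \<omega>" and c: "0 < c" "c \<le> \<omega>"
  obtains t where "\<alpha> \<le> t" "tail w t = ennreal c"
proof -
  define M where "M = distr (density lebesgue (\<lambda>x. w x * indicator {\<alpha><..} x)) borel (\<lambda>x. x)"
  have emM: "emeasure M A = (\<integral>\<^sup>+s. w s * indicator {\<alpha><..} s * indicator A s \<partial>lebesgue)"
    if [measurable]: "A \<in> sets borel" for A
    unfolding M_def by (subst emeasure_distr) (auto simp: emeasure_density)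
  have spM: "space M = UNIV" by (simp add: M_def)
  have totM: "emeasure M UNIV = ennreal \<omega>" using tot by (subst emM) (auto simp: tail_def)
  interpret finite_measure M by (rule finite_measureI) (simp add: spM totM)
  interpret finite_borel_measure M by standard (simp add: M_def)
  have "emeasure M {x} = 0" for x
  proof -
    have "emeasure M {x} = (\<integral>\<^sup>+s. 0 \<partial>(lebesgue :: real measure))"
      unfolding emM[OF borel_singleton[OF sets.empty_sets]]
    proof (rule nn_integral_cong_AE, use AE_lebesgue_neq[of x] in eventually_elim)
      fix s assume "s \<noteq> x"
      then show "w s * indicator {\<alpha><..} s * indicator {x} s = 0" by simp
    qed
    then show ?thesis by simp
  qed
  then have cont: "isCont (cdf M) x" for x unfolding isCont_cdf by (simp add: measure_def)
  have cdf: "tail w t = ennreal (\<omega> - cdf M t)" if "\<alpha> \<le> t" for t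
  proof -
    have "tail w t = emeasure M {t<..}"
      unfolding tail_def using that by (subst emM) (auto intro!: nn_integral_cong split: split_indicator)
    also have "\<dots> = ennreal (measure M {t<..})" by (rule emeasure_eq_measure)
    also have "measure M {t<..} = measure M (space M - {..t})"
      by (intro arg_cong[where f="measure M"]) (auto simp: spM)
    also have "\<dots> = \<omega> - cdf M t"
      using tot(2) totM by (subst finite_measure_compl) (auto simp: cdf_def spM measure_def)
    finally show ?thesis .
  qed
  have "measure M (space M) = \<omega>" using tot(2) totM by (simp add: measure_def spM)
  then have "(cdf M \<longlongrightarrow> \<omega>) at_top" using cdf_lim_at_top by simp
  then have "eventually (\<lambda>t. \<omega> - c < cdf M t) at_top" using c by (intro order_tendstoD) auto
  then obtain t1 where t1: "\<And>t. t1 \<le> t \<Longrightarrow> \<omega> - c < cdf M t" by (auto simp: eventually_at_top_linorder)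
  have "ennreal \<omega> = ennreal (\<omega> - cdf M \<alpha>)" using cdf[of \<alpha>] tot by simp
  then have "cdf M \<alpha> \<le> 0"
  proof -
    have "\<omega> = \<omega> - cdf M \<alpha>" using \<open>ennreal \<omega> = ennreal (\<omega> - cdf M \<alpha>)\<close> tot(2)
      by (metis ennreal_eq_0_iff ennreal_inj less_imp_le linorder_not_le)
    then show ?thesis by simp
  qed
  then have "\<exists>t\<ge>\<alpha>. t \<le> max t1 \<alpha> \<and> cdf M t = \<omega> - c"
    using t1[of "max t1 \<alpha>"] c cont by (intro IVT) auto
  then obtain t where "\<alpha> \<le> t" "cdf M t = \<omega> - c" by auto
  then show ?thesis using cdf[of t] by (intro that[of t]) auto
qed

text \<open>Chosen so that \<open>th q * 2 powr q = 1 / 2\<close>: one step to the next block gains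
  more than the factor 2 powr q lost in splitting the q-th power of a sum.\<close>

definition th :: "real \<Rightarrow> real" where "th q = 2 powr - (q + 1)"

lemma th_pos: "0 < th q" by (simp add: th_def)

lemma th_less_1: "0 < q \<Longrightarrow> th q < 1"
  using powr_less_mono[of "- (q + 1)" 0 2] by (simp add: th_def)

lemma th_eq: "th q * 2 powr q = 1 / 2"
  by (simp add: th_def powr_add[symmetric] powr_minus_divide flip: powr_diff)

text \<open>A block carries the share 1 - th q of the tail at its left end, and shifting by one
  block costs 1 / th q.\<close>

definition cL :: "real \<Rightarrow> ennreal" where "cL q = ennreal (1 / (th q * (1 - th q)))"

lemma cL_finite [simp]: "cL q < top" "cL q \<noteq> top"
  by (simp_all add: cL_def)

text \<open>A discrete Hardy inequality for every q > 0. The partial sums D n of the left side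
  satisfy D (n + 1) <= D n / 2 + 2^q A, where A is the series on the right, and 2 * 2^q A is the
  fixed point of this recursion. Induction on n avoids subtracting possibly infinite sums.\<close>

lemma geometric_sum_powers:
  fixes a :: "nat \<Rightarrow> ennreal"
  assumes q: "0 < q"
  shows "(\<Sum>k. ennreal (th q ^ k) * (\<Sum>j\<le>k. a j) powe q) \<le> 2 * 2 powe q * (\<Sum>k. ennreal (th q ^ k) * a k powe q)"
    (is "_ \<le> 2 * _ * ?A")
proof -
  define h where "h k = (\<Sum>j\<le>k. a j) powe q" for k
  have hS: "h (Suc k) \<le> 2 powe q * (h k + a (Suc k) powe q)" for k
    unfolding h_def using q by (simp add: epowr_add_le)
  have tw: "1 \<le> (2::ennreal) powe q" using epowr_mono[of 1 2 q] q by simp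
  have partial: "(\<Sum>k<n. ennreal (th q ^ k) * h k) \<le> 2 * 2 powe q * ?A" for n
  proof (induction n)
    case (Suc n)
    have "ennreal (th q) * 2 powe q = ennreal (th q * 2 powr q)"
      using th_pos[of q] epowr_ennreal[of 2 q] by (simp add: ennreal_mult)
    then have th2: "ennreal (th q) * 2 powe q = ennreal (1 / 2)" by (simp only: th_eq)
    have "(\<Sum>k<Suc n. ennreal (th q ^ k) * h k) = h 0 + (\<Sum>k<n. ennreal (th q ^ Suc k) * h (Suc k))"
      by (subst sum.lessThan_Suc_shift) simp
    also have "\<dots> \<le> h 0 + (\<Sum>k<n. ennreal (th q ^ Suc k) * (2 powe q * (h k + a (Suc k) powe q)))"
      by (intro add_left_mono sum_mono mult_left_mono hS) auto
    also have "(\<Sum>k<n. ennreal (th q ^ Suc k) * (2 powe q * (h k + a (Suc k) powe q)))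
      = (\<Sum>k<n. (ennreal (th q) * 2 powe q) * (ennreal (th q ^ k) * h k)) + 2 powe q * (\<Sum>k<n. ennreal (th q ^ Suc k) * a (Suc k) powe q)"
      unfolding sum_distrib_left sum.distrib[symmetric]
      using th_pos[of q] by (intro sum.cong refl) (simp add: ennreal_mult algebra_simps)
    also have "(\<Sum>k<n. (ennreal (th q) * 2 powe q) * (ennreal (th q ^ k) * h k)) = ennreal (1 / 2) * (\<Sum>k<n. ennreal (th q ^ k) * h k)"
      unfolding th2 sum_distrib_left ..
    also have "h 0 + (ennreal (1 / 2) * (\<Sum>k<n. ennreal (th q ^ k) * h k) + 2 powe q * (\<Sum>k<n. ennreal (th q ^ Suc k) * a (Suc k) powe q))
       \<le> 2 powe q * a 0 powe q + (ennreal (1 / 2) * (2 * 2 powe q * ?A) + 2 powe q * (\<Sum>k<n. ennreal (th q ^ Suc k) * a (Suc k) powe q))"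
      using mult_right_mono[OF tw, of "a 0 powe q"] by (intro add_mono mult_left_mono Suc.IH) (auto simp: h_def)
    also have "\<dots> = ennreal (1 / 2) * (2 * 2 powe q * ?A) + 2 powe q * (\<Sum>k<Suc n. ennreal (th q ^ k) * a k powe q)"
      by (subst sum.lessThan_Suc_shift) (simp add: algebra_simps)
    also have "\<dots> \<le> ennreal (1 / 2) * (2 * 2 powe q * ?A) + 2 powe q * ?A"
      by (intro add_left_mono mult_left_mono sum_le_suminf) auto
    also have "ennreal (1 / 2) * (2 * 2 powe q * ?A) = (ennreal (1/2) * 2) * (2 powe q * ?A)" by (simp add: mult_ac)
    also have "ennreal (1/2) * 2 = 1" using ennreal_mult[of "1/2" 2] by simp
    finally show ?case by (simp add: mult_2 distrib_right mult.assoc)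
  qed simp
  then show ?thesis
    unfolding h_def[symmetric] by (intro suminf_le_const) auto
qed

section \<open>Blocks between points at which the tail of w decreases geometrically\<close>

locale weight_blocks =
  fixes w :: "real \<Rightarrow> ennreal" and y :: "nat \<Rightarrow> real" and q \<omega> :: real
  assumes w [measurable]: "w \<in> borel_measurable lebesgue"
    and q: "0 < q" and omega: "0 < \<omega>" and mono_y: "strict_mono y"
    and tail_y: "tail w (y k) = ennreal (\<omega> * th q ^ k)"
begin

definition om :: "nat \<Rightarrow> ennreal" where "om k = ennreal (\<omega> * th q ^ k)"

abbreviation block :: "nat \<Rightarrow> real set" where "block k \<equiv> {y k<..y (Suc k)}"

lemma y_le: "i \<le> j \<Longrightarrow> y i \<le> y j"
  using strict_mono_less_eq[OF mono_y] by simp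

lemma om_finite [simp]: "om k < top" "om k \<noteq> top" by (simp_all add: om_def)

lemma om_pos: "0 < om k" using omega th_pos[of q] by (simp add: om_def)

lemma om_Suc: "om (Suc k) = ennreal (th q) * om k"
  using th_pos[of q] omega by (simp add: om_def ennreal_mult[symmetric] mult_ac)

lemma om_add: "om (j + k) = ennreal (th q ^ k) * om j"
  using th_pos[of q] omega by (simp add: om_def ennreal_mult[symmetric] mult_ac power_add)

lemma om_le: "om k \<le> ennreal (1 / th q) * om (Suc k)"
  using th_pos[of q] omega by (simp add: om_def ennreal_mult[symmetric])

text \<open>Discarding the first k points leaves a sequence of the same kind, so estimates over all
  blocks also serve for the part beyond y k.\<close>

lemma shift: "weight_blocks w (\<lambda>j. y (k + j)) q (\<omega> * th q ^ k)"
proof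
  show "strict_mono (\<lambda>j. y (k + j))" using mono_y by (auto simp: strict_mono_def)
  show "tail w (y (k + j)) = ennreal (\<omega> * th q ^ k * th q ^ j)" for j
    by (simp add: tail_y power_add mult.assoc)
qed (use q omega th_pos[of q] in auto)

lemma om_shift: "weight_blocks.om q (\<omega> * th q ^ k) j = om (k + j)"
  unfolding weight_blocks.om_def[OF shift] om_def by (simp add: power_add mult.assoc)

lemma block_integral: "(\<integral>\<^sup>+s. w s * indicator (block k) s \<partial>lebesgue) = ennreal (1 - th q) * om k"
proof -
  let ?I = "\<integral>\<^sup>+s. w s * indicator (block k) s \<partial>lebesgue"
  have "om k = ?I + om (Suc k)"
    using tail_split[OF w y_le[of k "Suc k"]] by (simp add: tail_y om_def)
  moreover have "om k = ennreal (1 - th q) * om k + om (Suc k)"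
    using th_pos[of q] th_less_1[OF q] omega
    by (simp add: om_def ennreal_mult[symmetric] ennreal_plus[symmetric] algebra_simps mult_le_cancel_left2 del: ennreal_plus)
  ultimately have "om (Suc k) + ?I = om (Suc k) + ennreal (1 - th q) * om k"
    by (metis add.commute)
  then show ?thesis by simp
qed

lemma disjoint_block: "disjoint_family block"
  unfolding disjoint_family_on_def
proof (intro ballI impI)
  fix i j :: nat assume "i \<noteq> j"
  then show "block i \<inter> block j = {}"
    using y_le[of "Suc i" j] y_le[of "Suc j" i] by (cases i j rule: linorder_cases) auto
qed

lemma in_block: "y 0 < x \<Longrightarrow> x \<le> y n \<Longrightarrow> \<exists>k. x \<in> block k"
proof (induction n)
  case (Suc n)
  show ?case
  proof (cases "x \<le> y n")
    case False
    with Suc.prems have "x \<in> block n" by simp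
    then show ?thesis ..
  qed (use Suc in simp)
qed simp

text \<open>The points need not tend to infinity. What lies beyond all of them has w-mass at most om
  k for every k, hence none.\<close>

lemma AE_beyond: "AE x in lebesgue. (\<forall>k. y k < x) \<longrightarrow> w x = 0"
proof -
  let ?Z = "{x. \<forall>k. y k < x}"
  have [measurable]: "?Z \<in> sets borel" by (intro borel_upset) (auto intro: less_le_trans)
  have le: "(\<integral>\<^sup>+x. w x * indicator ?Z x \<partial>lebesgue) \<le> om k" for k
  proof -
    have "(\<integral>\<^sup>+x. w x * indicator ?Z x \<partial>lebesgue) \<le> tail w (y k)"
      unfolding tail_def by (intro nn_integral_mono) (auto split: split_indicator)
    then show ?thesis by (simp add: tail_y om_def)
  qed
  have "om \<longlonglongrightarrow> ennreal (\<omega> * 0)"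
    unfolding om_def[abs_def] using th_pos[of q] th_less_1[OF q]
    by (intro tendsto_ennrealI tendsto_mult tendsto_const LIMSEQ_realpow_zero) auto
  then have "(\<integral>\<^sup>+x. w x * indicator ?Z x \<partial>lebesgue) \<le> 0"
    using le by (intro LIMSEQ_le_const[of om]) auto
  then have "AE x in lebesgue. w x * indicator ?Z x = 0"
    by (subst (asm) le_zero_eq, subst (asm) nn_integral_0_iff_AE) auto
  then show ?thesis by eventually_elim (auto split: split_indicator_asm)
qed

lemma blocks_upper:
  assumes le: "\<And>k x. x \<in> block k \<Longrightarrow> g x \<le> c k"
  shows "(\<integral>\<^sup>+x. g x * w x * indicator {y 0<..} x \<partial>lebesgue) \<le> (\<Sum>k. om k * c k)"
proof -
  have "(\<integral>\<^sup>+x. g x * w x * indicator {y 0<..} x \<partial>lebesgue) \<le> (\<integral>\<^sup>+x. (\<Sum>k. c k * (w x * indicator (block k) x)) \<partial>lebesgue)"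
  proof (rule nn_integral_mono_AE, use AE_beyond in eventually_elim)
    fix x assume beyond: "(\<forall>k. y k < x) \<longrightarrow> w x = 0"
    show "g x * w x * indicator {y 0<..} x \<le> (\<Sum>k. c k * (w x * indicator (block k) x))"
    proof (cases "y 0 < x \<and> (\<exists>n. x \<le> y n)")
      case True
      then obtain k where k: "x \<in> block k" using in_block by blast
      have "g x * w x * indicator {y 0<..} x \<le> c k * (w x * indicator (block k) x)"
        using True k le by (auto intro: mult_right_mono)
      also have "\<dots> \<le> (\<Sum>k. c k * (w x * indicator (block k) x))"
        using sum_le_suminf[of "\<lambda>k. c k * (w x * indicator (block k) x)" "{k}"] by simp
      finally show ?thesis .
    next
      case False
      then have "w x = 0 \<or> x \<le> y 0" using beyond by (auto simp: not_le)
      then show ?thesis by auto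
    qed
  qed
  also have "\<dots> = (\<Sum>k. c k * (\<integral>\<^sup>+x. w x * indicator (block k) x \<partial>lebesgue))"
    by (subst nn_integral_suminf) (auto simp: nn_integral_cmult)
  also have "\<dots> \<le> (\<Sum>k. om k * c k)"
  proof (intro suminf_le)
    fix k
    have "ennreal (1 - th q) * om k \<le> 1 * om k"
      using th_pos[of q] by (intro mult_right_mono) auto
    then have "c k * (ennreal (1 - th q) * om k) \<le> c k * om k" by (intro mult_left_mono) auto
    then show "c k * (\<integral>\<^sup>+x. w x * indicator (block k) x \<partial>lebesgue) \<le> om k * c k"
      unfolding block_integral by (simp add: mult.commute)
  qed auto
  finally show ?thesis .
qed

lemma blocks_lower:
  assumes le: "\<And>k x. x \<in> block k \<Longrightarrow> c k \<le> g x"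
  shows "(\<Sum>k. om k * c k) \<le> ennreal (1 / (1 - th q)) * (\<integral>\<^sup>+x. g x * w x * indicator {y 0<..} x \<partial>lebesgue)"
proof -
  have "ennreal (1 / (1 - th q)) * (\<Sum>k. c k * (\<integral>\<^sup>+x. w x * indicator (block k) x \<partial>lebesgue))
     \<le> ennreal (1 / (1 - th q)) * (\<integral>\<^sup>+x. g x * w x * indicator {y 0<..} x \<partial>lebesgue)"
  proof (rule mult_left_mono)
    have "(\<Sum>k. c k * (\<integral>\<^sup>+x. w x * indicator (block k) x \<partial>lebesgue))
      = (\<integral>\<^sup>+x. (\<Sum>k. (c k * w x) * indicator (block k) x) \<partial>lebesgue)"
      by (subst nn_integral_suminf) (auto simp: nn_integral_cmult mult.assoc)
    also have "\<dots> \<le> (\<integral>\<^sup>+x. g x * w x * indicator {y 0<..} x \<partial>lebesgue)"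
    proof (intro nn_integral_mono)
      fix x
      show "(\<Sum>k. (c k * w x) * indicator (block k) x) \<le> g x * w x * indicator {y 0<..} x"
      proof (cases "\<exists>k. x \<in> block k")
        case True
        then obtain k where k: "x \<in> block k" by blast
        then have "y 0 < x" using y_le[of 0 k] by auto
        then show ?thesis
          using le[OF k] by (simp add: suminf_cmult_indicator[OF disjoint_block k] mult_right_mono)
      next
        case False
        then show ?thesis by simp
      qed
    qed
    finally show "(\<Sum>k. c k * (\<integral>\<^sup>+x. w x * indicator (block k) x \<partial>lebesgue))
      \<le> (\<integral>\<^sup>+x. g x * w x * indicator {y 0<..} x \<partial>lebesgue)" .
  qed auto
  moreover have "ennreal (1 / (1 - th q)) * (\<Sum>k. c k * (\<integral>\<^sup>+x. w x * indicator (block k) x \<partial>lebesgue)) = (\<Sum>k. om k * c k)"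
  proof -
    have "ennreal (1 / (1 - th q)) * ennreal (1 - th q) = 1"
      using th_less_1[OF q] by (simp add: ennreal_mult[symmetric])
    then have "ennreal (1 / (1 - th q)) * (c k * (ennreal (1 - th q) * om k)) = om k * c k" for k
      by (metis mult.assoc mult.commute mult.right_neutral)
    then show ?thesis unfolding block_integral ennreal_suminf_cmult[symmetric] by simp
  qed
  ultimately show ?thesis by simp
qed

lemma blocks_lower_cL:
  assumes le: "\<And>k x. x \<in> block k \<Longrightarrow> c k \<le> g x"
  shows "(\<Sum>k. om k * c k) \<le> cL q * (\<integral>\<^sup>+x. g x * w x * indicator {y 0<..} x \<partial>lebesgue)"
proof -
  have "1 / (1 - th q) \<le> 1 / (th q * (1 - th q))"
    using th_pos[of q] th_less_1[OF q] by (intro divide_left_mono) (auto intro: mult_left_le_one_le)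
  then have "ennreal (1 / (1 - th q)) \<le> cL q" unfolding cL_def by (rule ennreal_leI)
  then have "ennreal (1 / (1 - th q)) * (\<integral>\<^sup>+x. g x * w x * indicator {y 0<..} x \<partial>lebesgue)
    \<le> cL q * (\<integral>\<^sup>+x. g x * w x * indicator {y 0<..} x \<partial>lebesgue)" by (rule mult_right_mono) simp
  with blocks_lower[OF le] show ?thesis by (rule order_trans)
qed

text \<open>A nondecreasing function is bounded below by its value at y (k + 1) only on the
  following block, whose mass is smaller by the factor th q.\<close>

lemma blocks_lower_Suc:
  assumes le: "\<And>k x. x \<in> block (Suc k) \<Longrightarrow> c k \<le> g x"
  shows "(\<Sum>k. om k * c k) \<le> cL q * (\<integral>\<^sup>+x. g x * w x * indicator {y 0<..} x \<partial>lebesgue)"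
proof -
  interpret s: weight_blocks w "\<lambda>j. y (1 + j)" q "\<omega> * th q ^ 1" by (rule shift)
  have "(\<Sum>k. om k * c k) = ennreal (1 / th q) * (\<Sum>k. om (Suc k) * c k)"
    unfolding om_Suc ennreal_suminf_cmult[symmetric]
    using th_pos[of q] by (simp add: mult.assoc[symmetric] ennreal_mult[symmetric])
  also have "(\<Sum>k. om (Suc k) * c k) = (\<Sum>k. s.om k * c k)" unfolding om_shift by simp
  also have "\<dots> \<le> ennreal (1 / (1 - th q)) * (\<integral>\<^sup>+x. g x * w x * indicator {y (1 + 0)<..} x \<partial>lebesgue)"
    using le by (intro s.blocks_lower) auto
  also have "\<dots> \<le> ennreal (1 / (1 - th q)) * (\<integral>\<^sup>+x. g x * w x * indicator {y 0<..} x \<partial>lebesgue)"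
    using y_le[of 0 1] by (intro mult_left_mono nn_integral_mono) (auto split: split_indicator)
  also have "ennreal (1 / th q) * (ennreal (1 / (1 - th q)) * (\<integral>\<^sup>+x. g x * w x * indicator {y 0<..} x \<partial>lebesgue))
     = cL q * (\<integral>\<^sup>+x. g x * w x * indicator {y 0<..} x \<partial>lebesgue)"
    using th_pos[of q] th_less_1[OF q] by (simp add: cL_def mult.assoc[symmetric] ennreal_mult[symmetric])
  finally show ?thesis by (simp add: mult_left_mono)
qed

end

lemma weight_blocks_exist:
  assumes [measurable]: "w \<in> borel_measurable lebesgue" and q: "0 < q"
    and tot: "tail w \<alpha> = ennreal \<omega>" "0 < \<omega>"
  obtains y where "weight_blocks w y q \<omega>" "y 0 = \<alpha>"
proof -
  have "\<exists>t. \<alpha> \<le> t \<and> tail w t = ennreal (\<omega> * th q ^ k)" for k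
  proof -
    have "th q ^ k \<le> 1" using th_pos[of q] th_less_1[OF q] by (simp add: power_le_one)
    then have "\<omega> * th q ^ k \<le> \<omega>" using tot(2) by (simp add: mult_left_le)
    moreover have "0 < \<omega> * th q ^ k" using th_pos[of q] tot by simp
    ultimately show ?thesis using tail_level_points[OF assms(1) tot] by metis
  qed
  then obtain y' where y': "\<alpha> \<le> y' k" "tail w (y' k) = ennreal (\<omega> * th q ^ k)" for k by metis
  \<comment> \<open>The point found for k = 0 has the right tail but may differ from \<alpha>;
    overriding it makes the blocks start exactly at \<alpha>.\<close>
  define y where "y k = (if k = 0 then \<alpha> else y' k)" for k
  have y: "tail w (y k) = ennreal (\<omega> * th q ^ k)" for k using y' tot by (simp add: y_def)
  have "y k < y (Suc k)" for k
  proof (rule ccontr)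
    assume "\<not> y k < y (Suc k)"
    then have "tail w (y k) \<le> tail w (y (Suc k))" by (intro tail_antimono) simp
    moreover have "\<omega> * th q ^ Suc k < \<omega> * th q ^ k" using th_pos[of q] th_less_1[OF q] tot by simp
    moreover have "0 \<le> \<omega> * th q ^ Suc k" using th_pos[of q] tot by simp
    ultimately show False unfolding y by (subst (asm) ennreal_le_iff) linarith+
  qed
  then have "strict_mono y" by (rule strict_mono_Suc_iff[THEN iffD2, rule_format])
  then have "weight_blocks w y q \<omega>" using y q tot by unfold_locales auto
  then show ?thesis by (rule that) (simp add: y_def)
qed

section \<open>Sufficiency of the conditions\<close>

lemma mono_epowr: "mono (f :: real \<Rightarrow> ennreal) \<Longrightarrow> 0 \<le> r \<Longrightarrow> mono (\<lambda>x. f x powe r)"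
  by (intro monoI epowr_mono) (auto dest: monoD)

lemma suminf_shift_count_space:
  fixes f :: "nat \<Rightarrow> ennreal"
  shows "(\<integral>\<^sup>+j. f j * indicator {k..} j \<partial>count_space UNIV) = (\<Sum>j. f (k + j))"
proof -
  have "(\<integral>\<^sup>+j. f j * indicator {k..} j \<partial>count_space UNIV) = (\<integral>\<^sup>+j. f j \<partial>count_space {k..})"
    by (simp add: nn_integral_count_space_indicator)
  also have "\<dots> = (\<integral>\<^sup>+j. f (k + j) \<partial>count_space UNIV)"
    by (rule nn_integral_bij_count_space[symmetric])
       (rule bij_betwI[where g = "\<lambda>j. j - k"], auto)
  finally show ?thesis by (simp add: nn_integral_count_space_nat)
qed

text \<open>The first factors come from \<open>geometric_sum_powers\<close>, the bracket from
  splitting f on a block and then the q-th power of the two resulting terms.\<close>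

definition cH :: "real \<Rightarrow> real \<Rightarrow> ennreal" where
  "cH q p = 2 * 2 powe q * (2 powe q * 2 powe (q / p))"

definition cS1 :: "real \<Rightarrow> real \<Rightarrow> ennreal" where
  "cS1 q p = cH q p * (cB1 p q * cL q + ennreal (1 / th q))"

definition cD :: "real \<Rightarrow> real \<Rightarrow> ennreal" where
  "cD q r = ennreal (1 / th q * (1 / th q)) powe r * cL q"

definition cQ :: "real \<Rightarrow> real \<Rightarrow> ennreal" where
  "cQ q r = 4 powe r * (3 * cD q r + cL q powe r * cL q)"

definition cS2 :: "real \<Rightarrow> real \<Rightarrow> ennreal" where
  "cS2 q p = cH q p * (cB2 p q * cQ q (q / (p - q)) powe (1 - q / p) + 2 * cD q (q / (p - q)) powe (1 - q / p))"

lemma cH_finite [simp]: "0 < p \<Longrightarrow> 0 < q \<Longrightarrow> cH q p < top"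
  by (auto simp: cH_def ennreal_mult_less_top)

lemma cS1_finite [simp]: "0 < p \<Longrightarrow> 0 < q \<Longrightarrow> cS1 q p < top"
  by (auto simp: cS1_def ennreal_mult_less_top)

lemma cD_finite [simp]: "0 \<le> r \<Longrightarrow> cD q r < top"
  by (auto simp: cD_def ennreal_mult_less_top)

lemma cQ_finite [simp]: "0 \<le> r \<Longrightarrow> cQ q r < top"
  by (auto simp: cQ_def ennreal_mult_less_top)

lemma cS2_finite [simp]: "0 < q \<Longrightarrow> q < p \<Longrightarrow> cS2 q p < top"
  by (auto simp: cS2_def ennreal_mult_less_top)

text \<open>The differences telescope as long as F stays below z and vanish once F has passed
  it.\<close>

lemma truncations_telescope:
  fixes F :: "nat \<Rightarrow> ennreal"
  assumes "\<And>k. F k \<le> F (Suc k)"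
  shows "(\<Sum>k<n. min z (F (Suc k)) - F k) \<le> min z (F n)"
proof (induction n)
  case (Suc n)
  have "(\<Sum>k<Suc n. min z (F (Suc k)) - F k) \<le> min z (F n) + (min z (F (Suc n)) - F n)"
    using Suc by (simp add: add_right_mono)
  also have "\<dots> \<le> min z (F (Suc n))"
  proof (cases "F n \<le> z")
    case True
    then show ?thesis using assms[of n] by (simp add: min_absorb2 add_diff_inverse_ennreal)
  next
    case False
    then have "z < top" by (auto simp: not_le intro: less_le_trans)
    then have "min z (F (Suc n)) < top" by (rule le_less_trans[rotated]) simp
    then have "min z (F (Suc n)) - F n = 0" using False
      by (intro diff_eq_0_ennreal) (auto simp: not_le min_le_iff_disj)
    then show ?thesis using assms[of n] by (auto simp: min_def)
  qed
  finally show ?case .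
qed simp

section \<open>The Hardy operator on blocks: discrete measure, decomposition and upper
  bounds\<close>

locale hardy_blocks = weight_blocks +
  fixes u :: "real \<Rightarrow> ennreal"
  assumes u [measurable]: "u \<in> borel_measurable lebesgue"
begin

definition Uk :: "nat \<Rightarrow> ennreal" where "Uk k = seg u (y k) (y (Suc k))"
definition sg :: "nat \<Rightarrow> ennreal" where "sg k = om k * Uk k powe q"
definition Sk :: "nat \<Rightarrow> ennreal" where "Sk k = (\<Sum>j. sg (k + j))"

text \<open>Its atoms are thought of as sitting at the points y k. Integrating the q-th power of f
  against it gives the share of the Hardy inequality due to the values f (y k).\<close>

abbreviation sigma :: "nat measure" where "sigma \<equiv> density (count_space UNIV) sg"

lemma seg_sum: "seg u (y k) (y (k + Suc j)) = (\<Sum>i\<le>j. Uk (k + i))"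
proof (induction j)
  case (Suc j)
  have "seg u (y k) (y (k + Suc (Suc j))) = seg u (y k) (y (k + Suc j)) + seg u (y (k + Suc j)) (y (k + Suc (Suc j)))"
    by (rule seg_split[OF u]) (auto intro: y_le)
  then show ?case unfolding Suc by (simp add: Uk_def)
qed (simp add: Uk_def)

lemma Sk_Suc: "Sk k = sg k + Sk (Suc k)"
proof -
  have "(\<integral>\<^sup>+j. sg j * indicator {k..} j \<partial>count_space UNIV)
    = (\<integral>\<^sup>+j. sg j * indicator {k} j + sg j * indicator {Suc k..} j \<partial>count_space UNIV)"
    by (intro nn_integral_cong) (auto split: split_indicator)
  also have "\<dots> = sg k + (\<integral>\<^sup>+j. sg j * indicator {Suc k..} j \<partial>count_space UNIV)"
    by (subst nn_integral_add) auto
  finally show ?thesis unfolding Sk_def suminf_shift_count_space .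
qed

lemma emeasure_sigma: "emeasure sigma {j. y k \<le> y j} = Sk k"
proof -
  have "{j. y k \<le> y j} = {k..}" using strict_mono_less_eq[OF mono_y] by auto
  then show ?thesis by (simp add: emeasure_density suminf_shift_count_space Sk_def)
qed

lemma nn_integral_sigma: "(\<integral>\<^sup>+j. h j \<partial>sigma) = (\<Sum>j. sg j * h j)"
  by (subst nn_integral_density) (auto simp: nn_integral_count_space_nat)

text \<open>On a block, \<open>seg u (y k)\<close> is at most a partial sum of the Uk, and the
  discrete Hardy inequality replaces partial sums by their last terms.\<close>

lemma kernel_tail_le_Sk: "kernel_tail q u w (y k) \<le> 2 * 2 powe q * Sk k"
proof -
  interpret s: weight_blocks w "\<lambda>j. y (k + j)" q "\<omega> * th q ^ k" by (rule shift)
  have "kernel_tail q u w (y k) = (\<integral>\<^sup>+x. seg u (y k) x powe q * w x * indicator {y (k + 0)<..} x \<partial>lebesgue)"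
    unfolding kernel_tail_def by (simp add: mult.commute)
  also have "\<dots> \<le> (\<Sum>j. s.om j * (\<Sum>i\<le>j. Uk (k + i)) powe q)"
    unfolding seg_sum[symmetric] using q by (intro s.blocks_upper epowr_mono seg_mono) auto
  also have "\<dots> = om k * (\<Sum>j. ennreal (th q ^ j) * (\<Sum>i\<le>j. Uk (k + i)) powe q)"
    unfolding ennreal_suminf_cmult[symmetric] om_shift om_add by (simp add: mult_ac)
  also have "\<dots> \<le> om k * (2 * 2 powe q * (\<Sum>j. ennreal (th q ^ j) * Uk (k + j) powe q))"
    by (intro mult_left_mono geometric_sum_powers q) auto
  also have "\<dots> = 2 * 2 powe q * Sk k"
    unfolding Sk_def sg_def om_add ennreal_suminf_cmult[symmetric] by (simp add: mult_ac)
  finally show ?thesis .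
qed

lemma Sk_le_kernel_tail: "Sk k \<le> cL q * kernel_tail q u w (y k)"
proof -
  interpret s: weight_blocks w "\<lambda>j. y (k + j)" q "\<omega> * th q ^ k" by (rule shift)
  have "Sk k = (\<Sum>j. s.om j * Uk (k + j) powe q)" by (simp add: Sk_def sg_def om_shift)
  also have "\<dots> \<le> cL q * (\<integral>\<^sup>+x. seg u (y k) x powe q * w x * indicator {y (k + 0)<..} x \<partial>lebesgue)"
    unfolding Uk_def using q
    by (intro s.blocks_lower_Suc epowr_mono seg_mono) (auto intro: y_le less_imp_le)
  also have "\<dots> = cL q * kernel_tail q u w (y k)"
    unfolding kernel_tail_def by (simp add: mult.commute)
  finally show ?thesis .
qed

text \<open>The decomposition \<open>f \<le> 2\<^sup>1\<^sup>/\<^sup>p (f (y k) + g k)\<close> on the \<open>k\<close>-th block uses the increments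
  \<open>g k\<^sup>p = min (f\<^sup>p) (f\<^sup>p (y (k+1))) - f\<^sup>p (y k)\<close>, which are again nondecreasing and sum up to at most \<open>f\<^sup>p\<close>.\<close>

lemma hardy_op_decomposition:
  assumes p: "0 < p" and f: "mono f" "f (y 0) = 0"
    and [measurable]: "v \<in> borel_measurable lebesgue"
    and fin: "wint p v f < top"
    and A: "\<And>x g. mono g \<Longrightarrow> wint p v g < top \<Longrightarrow>
       hardy_op g u x \<le> A x * wint p v g powe (1 / p)"
  obtains B where "(\<Sum>k. B k) \<le> wint p v f"
    "wint q w (hardy_op f u) \<le> cH q p *
       ((\<Sum>k. sg k * f (y k) powe q) + (\<Sum>k. om k * (A (y (Suc k)) * B k powe (1 / p)) powe q))"
proof -
  define F where "F x = f x powe p" for x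
  have F: "mono F" unfolding F_def using f p by (intro mono_epowr) auto
  define G where "G k x = min (F x) (F (y (Suc k))) - F (y k)" for k x
  define g where "g k x = G k x powe (1 / p)" for k x
  have G: "mono (G k)" for k
    unfolding G_def using monoD[OF F] by (intro monoI ennreal_minus_mono) (auto simp: min_le_iff_disj)
  have g: "mono (g k)" for k unfolding g_def using G p by (intro mono_epowr) auto
  have gG: "g k x powe p = G k x" for k x using p by (simp add: g_def epowr_epowr)
  note [measurable] = borel_measurable_mono_lebesgue[OF f(1)] borel_measurable_mono_lebesgue[OF G]
    borel_measurable_mono_lebesgue[OF g]
  define B where "B k = (\<integral>\<^sup>+x. G k x * v x \<partial>lebesgue)" for k
  have "(\<Sum>k. B k) = (\<integral>\<^sup>+x. (\<Sum>k. G k x) * v x \<partial>lebesgue)"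
    unfolding B_def by (subst nn_integral_suminf[symmetric]) (auto simp: ennreal_suminf_multc)
  also have "\<dots> \<le> (\<integral>\<^sup>+x. F x * v x \<partial>lebesgue)"
  proof (intro nn_integral_mono mult_right_mono)
    fix x
    have "(\<Sum>k<n. G k x) \<le> F x" for n
    proof -
      have "(\<Sum>k<n. G k x) \<le> min (F x) (F (y n))"
        unfolding G_def by (intro truncations_telescope monoD[OF F] y_le) simp
      then show ?thesis by simp
    qed
    then show "(\<Sum>k. G k x) \<le> F x" by (intro suminf_le_const) auto
  qed auto
  finally have sumB: "(\<Sum>k. B k) \<le> wint p v f" by (simp add: F_def)
  have finB: "B k < top" for k
  proof -
    have "B k \<le> (\<Sum>k. B k)" using sum_le_suminf[of B "{k}"] by simp
    also have "\<dots> < top" using sumB fin by (rule le_less_trans)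
    finally show ?thesis .
  qed
  define a where "a k = (\<integral>\<^sup>+s. f s * u s * indicator {y k<..<y (Suc k)} s \<partial>lebesgue)" for k
  \<comment> \<open>The partial sums of a account only for what lies to the right of y 0, so nothing
    may be contributed from its left.\<close>
  have f0: "f x = 0" if "x \<le> y 0" for x using monoD[OF f(1) that] f(2) by simp
  have "hardy_op f u (y 0) = (\<integral>\<^sup>+s. 0 \<partial>(lebesgue :: real measure))"
    unfolding hardy_op_def by (intro nn_integral_cong) (auto simp: f0 split: split_indicator)
  then have H0: "hardy_op f u (y 0) = 0" by simp
  have H: "hardy_op f u (y (Suc k)) = (\<Sum>j\<le>k. a j)" for k
  proof (induction k)
    case 0
    show ?case using hardy_op_split[OF u borel_measurable_mono_lebesgue[OF f(1)], of "y 0" "y 1"] H0 y_le[of 0 1]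
      by (simp add: a_def)
  next
    case (Suc k)
    show ?case using hardy_op_split[OF u borel_measurable_mono_lebesgue[OF f(1)], of "y (Suc k)" "y (Suc (Suc k))"]
        Suc y_le[of "Suc k" "Suc (Suc k)"]
      by (simp add: a_def)
  qed
  have ak: "a k \<le> 2 powe (1 / p) * (f (y k) * Uk k + A (y (Suc k)) * B k powe (1 / p))" for k
  proof -
    have "a k \<le> (\<integral>\<^sup>+s. 2 powe (1 / p) * (f (y k) * (u s * indicator {y k<..<y (Suc k)} s) +
        g k s * u s * indicator {..<y (Suc k)} s) \<partial>lebesgue)"
      unfolding a_def
    proof (intro nn_integral_mono)
      fix s
      show "f s * u s * indicator {y k<..<y (Suc k)} s \<le>
         2 powe (1 / p) * (f (y k) * (u s * indicator {y k<..<y (Suc k)} s) + g k s * u s * indicator {..<y (Suc k)} s)"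
      proof (cases "s \<in> {y k<..<y (Suc k)}")
        case True
        then have "F (y k) \<le> F s" "F s \<le> F (y (Suc k))" using monoD[OF F] by auto
        \<comment> \<open>Inside the block the truncation at F (y (k+1)) is inactive, and the
          subtraction does not clip because F (y k) <= F s.\<close>
        then have "F (y k) + G k s = F s" unfolding G_def by (simp add: min_absorb1 add_diff_inverse_ennreal)
        then have "f s = (F (y k) + G k s) powe (1 / p)" using p by (simp add: F_def epowr_epowr)
        also have "\<dots> \<le> 2 powe (1 / p) * (F (y k) powe (1 / p) + g k s)"
          unfolding g_def using p by (intro epowr_add_le) auto
        also have "F (y k) powe (1 / p) = f (y k)" using p by (simp add: F_def epowr_epowr)
        finally have "f s * u s \<le> 2 powe (1 / p) * (f (y k) + g k s) * u s" by (rule mult_right_mono) simp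
        then show ?thesis using True by (simp add: algebra_simps)
      qed auto
    qed
    also have "\<dots> = 2 powe (1 / p) * (f (y k) * Uk k + hardy_op (g k) u (y (Suc k)))"
    proof -
      have "(\<integral>\<^sup>+s. 2 powe (1 / p) * (f (y k) * (u s * indicator {y k<..<y (Suc k)} s) +
        g k s * u s * indicator {..<y (Suc k)} s) \<partial>lebesgue)
        = 2 powe (1 / p) * (\<integral>\<^sup>+s. f (y k) * (u s * indicator {y k<..<y (Suc k)} s) +
        g k s * u s * indicator {..<y (Suc k)} s \<partial>lebesgue)"
        by (rule nn_integral_cmult) measurable
      also have "(\<integral>\<^sup>+s. f (y k) * (u s * indicator {y k<..<y (Suc k)} s) +
        g k s * u s * indicator {..<y (Suc k)} s \<partial>lebesgue)
        = (\<integral>\<^sup>+s. f (y k) * (u s * indicator {y k<..<y (Suc k)} s) \<partial>lebesgue) + hardy_op (g k) u (y (Suc k))"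
        unfolding hardy_op_def by (rule nn_integral_add) measurable
      also have "(\<integral>\<^sup>+s. f (y k) * (u s * indicator {y k<..<y (Suc k)} s) \<partial>lebesgue) = f (y k) * Uk k"
        unfolding Uk_def seg_def by (rule nn_integral_cmult) measurable
      finally show ?thesis .
    qed
    \<comment> \<open>Each g k is nondecreasing on the whole line, so the norm bound at the right
      end of the block applies to it and uses up only the share B k of the norm of f.\<close>
    also have "\<dots> \<le> 2 powe (1 / p) * (f (y k) * Uk k + A (y (Suc k)) * B k powe (1 / p))"
      using A[OF g, of k "y (Suc k)"] finB[of k]
      by (intro mult_left_mono add_left_mono) (auto simp: gG B_def)
    finally show ?thesis .
  qed
  have akq: "om k * a k powe q \<le> (2 powe q * 2 powe (q / p)) *
      (sg k * f (y k) powe q + om k * (A (y (Suc k)) * B k powe (1 / p)) powe q)" for k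
  proof -
    have "a k powe q \<le> (2 powe (1 / p) * (f (y k) * Uk k + A (y (Suc k)) * B k powe (1 / p))) powe q"
      using q by (intro epowr_mono ak) auto
    also have "\<dots> = 2 powe (q / p) * (f (y k) * Uk k + A (y (Suc k)) * B k powe (1 / p)) powe q"
      using q p by (simp add: epowr_mult epowr_epowr)
    also have "\<dots> \<le> 2 powe (q / p) * (2 powe q * ((f (y k) * Uk k) powe q + (A (y (Suc k)) * B k powe (1 / p)) powe q))"
      using q by (intro mult_left_mono epowr_add_le) auto
    finally have "om k * a k powe q \<le> om k * (2 powe (q / p) * (2 powe q *
      ((f (y k) * Uk k) powe q + (A (y (Suc k)) * B k powe (1 / p)) powe q)))"
      by (rule mult_left_mono) simp
    also have "\<dots> = (2 powe q * 2 powe (q / p)) *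
      (sg k * f (y k) powe q + om k * (A (y (Suc k)) * B k powe (1 / p)) powe q)"
      unfolding sg_def epowr_mult[OF less_imp_le[OF q], of "f (y k)" "Uk k"] by (simp add: algebra_simps)
    finally show ?thesis .
  qed
  have "wint q w (hardy_op f u)
     = (\<integral>\<^sup>+x. hardy_op f u x powe q * w x * indicator {y 0<..} x \<partial>lebesgue)"
  proof (intro nn_integral_cong)
    fix x
    have "hardy_op f u x = 0" if "x \<le> y 0" using hardy_op_mono[OF that, of f u] H0 by simp
    then show "hardy_op f u x powe q * w x = hardy_op f u x powe q * w x * indicator {y 0<..} x"
      using q by (auto split: split_indicator)
  qed
  also have "\<dots> \<le> (\<Sum>k. om k * (\<Sum>j\<le>k. a j) powe q)"
    unfolding H[symmetric] using q by (intro blocks_upper epowr_mono hardy_op_mono) auto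
  also have "\<dots> = ennreal \<omega> * (\<Sum>k. ennreal (th q ^ k) * (\<Sum>j\<le>k. a j) powe q)"
    unfolding ennreal_suminf_cmult[symmetric] om_def using omega th_pos[of q] by (simp add: ennreal_mult mult_ac)
  also have "\<dots> \<le> ennreal \<omega> * (2 * 2 powe q * (\<Sum>k. ennreal (th q ^ k) * a k powe q))"
    by (intro mult_left_mono geometric_sum_powers q) auto
  also have "\<dots> = 2 * 2 powe q * (\<Sum>k. om k * a k powe q)"
    unfolding ennreal_suminf_cmult[symmetric] om_def using omega th_pos[of q] by (simp add: ennreal_mult mult_ac)
  also have "\<dots> \<le> 2 * 2 powe q * (\<Sum>k. (2 powe q * 2 powe (q / p)) *
      (sg k * f (y k) powe q + om k * (A (y (Suc k)) * B k powe (1 / p)) powe q))"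
    by (intro mult_left_mono suminf_le akq) auto
  also have "\<dots> = cH q p * ((\<Sum>k. sg k * f (y k) powe q) + (\<Sum>k. om k * (A (y (Suc k)) * B k powe (1 / p)) powe q))"
    unfolding ennreal_suminf_cmult cH_def by (subst suminf_add) (auto simp: mult.assoc)
  finally show ?thesis using sumB that by blast
qed


lemma emeasure_sigma_cases:
  obtains "{j. t \<le> y j} = {}" | k where "t \<le> y k" "emeasure sigma {j. t \<le> y j} = Sk k"
proof (cases "\<exists>j. t \<le> y j")
  case True
  define k where "k = (LEAST j. t \<le> y j)"
  have "t \<le> y k" unfolding k_def using True by (rule LeastI_ex)
  moreover have "{j. t \<le> y j} = {j. y k \<le> y j}"
    using \<open>t \<le> y k\<close> Least_le[of "\<lambda>j. t \<le> y j", folded k_def] y_le by auto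
  ultimately show ?thesis using that(2) emeasure_sigma by metis
qed (use that(1) in auto)

text \<open>The terms with f (y k) form an integral against \<open>sigma\<close>, whose tails are
  controlled by K1, so the embedding applies. In the terms with B k the bound K2 removes the
  weights, and q / p >= 1 allows the sum of powers to be bounded by the power of the sum.\<close>

lemma hardy_bound_le:
  assumes p: "0 < p" "p \<le> q" and f: "mono f" "f (y 0) = 0"
    and v [measurable]: "v \<in> borel_measurable lebesgue"
    and fin: "wint p v f < top"
    and A: "\<And>x g. mono g \<Longrightarrow> wint p v g < top \<Longrightarrow>
       hardy_op g u x \<le> A x * wint p v g powe (1 / p)"
    and K1: "\<And>k. tail v (y k) < top \<Longrightarrow> kernel_tail q u w (y k) \<le> K1 * tail v (y k) powe (q / p)"
    and K2: "\<And>k. tail w (y (Suc k)) * A (y (Suc k)) powe q \<le> K2"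
  shows "wint q w (hardy_op f u)
    \<le> cS1 q p * ((K1 + K2) * wint p v f powe (q / p))"
proof -
  let ?X = "wint p v f"
  note [measurable] = borel_measurable_mono_lebesgue[OF f(1)]
  obtain B where B: "(\<Sum>k. B k) \<le> ?X" and main: "wint q w (hardy_op f u) \<le> cH q p *
       ((\<Sum>k. sg k * f (y k) powe q) + (\<Sum>k. om k * (A (y (Suc k)) * B k powe (1 / p)) powe q))"
    using hardy_op_decomposition[OF p(1) f v fin A] by blast
  have X: "(\<integral>\<^sup>+x. f x powe p \<partial>density lebesgue v) = ?X"
    by (subst nn_integral_density) (auto simp: mult.commute)
  have "(\<Sum>k. sg k * f (y k) powe q) = (\<integral>\<^sup>+k. f (y k) powe q \<partial>sigma)" by (simp add: nn_integral_sigma)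
  also have "\<dots> \<le> cB1 p q * ((cL q * K1) * (\<integral>\<^sup>+x. f x powe p \<partial>density lebesgue v) powe (q / p))"
  proof (rule monotone_embedding_le[OF f(1) p])
    fix t assume fint: "emeasure (density lebesgue v) {t..} < top"
    show "emeasure sigma {i \<in> space sigma. t \<le> y i} \<le> cL q * K1 * emeasure (density lebesgue v) {t..} powe (q / p)"
    proof (cases rule: emeasure_sigma_cases[of t])
      case (2 k)
      have le: "tail v (y k) \<le> tail v t" by (rule tail_antimono) (rule 2)
      have "emeasure sigma {i \<in> space sigma. t \<le> y i} = Sk k" using 2 by simp
      also have "\<dots> \<le> cL q * kernel_tail q u w (y k)" by (rule Sk_le_kernel_tail)
      also have "\<dots> \<le> cL q * (K1 * tail v (y k) powe (q / p))"
        using le fint by (intro mult_left_mono K1) (auto simp: emeasure_density_Ici intro: le_less_trans)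
      also have "\<dots> \<le> cL q * (K1 * tail v t powe (q / p))"
        using p le by (intro mult_left_mono epowr_mono) auto
      finally show ?thesis by (simp add: emeasure_density_Ici mult.assoc)
    qed simp
  qed (use fin X in auto)
  finally have 1: "(\<Sum>k. sg k * f (y k) powe q) \<le> cB1 p q * cL q * (K1 * ?X powe (q / p))"
    by (simp add: X mult.assoc)
  have "(\<Sum>k. om k * (A (y (Suc k)) * B k powe (1 / p)) powe q) \<le> (\<Sum>k. ennreal (1 / th q) * K2 * B k powe (q / p))"
  proof (intro suminf_le)
    fix k
    have "om k * (A (y (Suc k)) * B k powe (1 / p)) powe q = om k * A (y (Suc k)) powe q * B k powe (q / p)"
      using q by (simp add: epowr_mult epowr_epowr mult.assoc)
    also have "\<dots> \<le> ennreal (1 / th q) * (tail w (y (Suc k)) * A (y (Suc k)) powe q) * B k powe (q / p)"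
      using mult_right_mono[OF om_le[of k], of "A (y (Suc k)) powe q"]
      by (intro mult_right_mono) (auto simp: tail_y om_def mult.assoc simp del: power_Suc)
    also have "\<dots> \<le> ennreal (1 / th q) * K2 * B k powe (q / p)"
      by (intro mult_right_mono mult_left_mono K2) auto
    finally show "om k * (A (y (Suc k)) * B k powe (1 / p)) powe q \<le> ennreal (1 / th q) * K2 * B k powe (q / p)" .
  qed auto
  also have "\<dots> = ennreal (1 / th q) * K2 * (\<Sum>k. B k powe (q / p))" by (rule ennreal_suminf_cmult)
  also have "\<dots> \<le> ennreal (1 / th q) * K2 * (\<Sum>k. B k) powe (q / p)"
    using p by (intro mult_left_mono suminf_epowr_le) auto
  also have "\<dots> \<le> ennreal (1 / th q) * K2 * ?X powe (q / p)"
    using p by (intro mult_left_mono epowr_mono B) auto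
  finally have 2: "(\<Sum>k. om k * (A (y (Suc k)) * B k powe (1 / p)) powe q) \<le> ennreal (1 / th q) * (K2 * ?X powe (q / p))"
    by (simp add: mult.assoc)
  have "wint q w (hardy_op f u) \<le>
     cH q p * (cB1 p q * cL q * (K1 * ?X powe (q / p)) + ennreal (1 / th q) * (K2 * ?X powe (q / p)))"
    by (rule order_trans[OF main]) (intro mult_left_mono add_mono 1 2, auto)
  also have "\<dots> \<le> cH q p * ((cB1 p q * cL q + ennreal (1 / th q)) * ((K1 + K2) * ?X powe (q / p)))"
    by (intro mult_left_mono) (auto simp: distrib_left distrib_right add_increasing add_increasing2 add.assoc intro: add_mono)
  finally show ?thesis by (simp add: cS1_def mult.assoc)
qed

lemma om_epowr_le:
  assumes "0 \<le> r" shows "om k powe r \<le> ennreal (1 / th q * (1 / th q)) powe r * om (Suc (Suc k)) powe r"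
proof -
  have "om k \<le> ennreal (1 / th q * (1 / th q)) * om (Suc (Suc k))"
  proof -
    have "om k \<le> ennreal (1 / th q) * (ennreal (1 / th q) * om (Suc (Suc k)))"
      by (rule order_trans[OF om_le mult_left_mono[OF om_le]]) simp
    also have "\<dots> = ennreal (1 / th q * (1 / th q)) * om (Suc (Suc k))"
      using th_pos[of q] by (subst ennreal_mult) (simp_all add: mult.assoc)
    finally show ?thesis .
  qed
  then have "om k powe r \<le> (ennreal (1 / th q * (1 / th q)) * om (Suc (Suc k))) powe r"
    using assms by (rule epowr_mono)
  then show ?thesis using assms by (simp add: epowr_mult)
qed

text \<open>The sum is compared with an integral over the block that follows y (k + 1). There h is
  at least h (y (k + 1)) while the tail of w may be as small as om (k + 2), whence the double shift
  hidden in \<open>cD\<close>.\<close>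

lemma sum_om_epowr_le:
  assumes r: "0 \<le> r" and h: "mono h"
  shows "(\<Sum>k. om k powe (1 + r) * h (y (Suc k))) \<le> cD q r * (\<integral>\<^sup>+x. tail w x powe r * h x * w x \<partial>lebesgue)"
proof -
  let ?c = "ennreal (1 / th q * (1 / th q)) powe r"
  have "(\<Sum>k. om k powe (1 + r) * h (y (Suc k))) \<le> (\<Sum>k. ?c * (om k * (om (Suc (Suc k)) powe r * h (y (Suc k)))))"
  proof (intro suminf_le)
    fix k
    have "om k powe (1 + r) * h (y (Suc k)) = om k * (om k powe r * h (y (Suc k)))"
      using r by (simp add: epowr_add mult.assoc)
    also have "\<dots> \<le> om k * (?c * om (Suc (Suc k)) powe r * h (y (Suc k)))"
      using om_epowr_le[OF r] by (intro mult_left_mono mult_right_mono) auto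
    finally show "om k powe (1 + r) * h (y (Suc k)) \<le> ?c * (om k * (om (Suc (Suc k)) powe r * h (y (Suc k))))"
      by (simp add: mult_ac)
  qed auto
  also have "\<dots> = ?c * (\<Sum>k. om k * (om (Suc (Suc k)) powe r * h (y (Suc k))))" by (rule ennreal_suminf_cmult)
  also have "\<dots> \<le> ?c * (cL q * (\<integral>\<^sup>+x. (tail w x powe r * h x) * w x * indicator {y 0<..} x \<partial>lebesgue))"
  proof (intro mult_left_mono blocks_lower_Suc)
    fix k x assume "x \<in> block (Suc k)"
    then have "tail w (y (Suc (Suc k))) \<le> tail w x" "h (y (Suc k)) \<le> h x"
      using monoD[OF h] by (auto intro: tail_antimono)
    then show "om (Suc (Suc k)) powe r * h (y (Suc k)) \<le> tail w x powe r * h x"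
      using r by (intro mult_mono epowr_mono) (auto simp: tail_y om_def)
  qed auto
  also have "\<dots> \<le> ?c * (cL q * (\<integral>\<^sup>+x. tail w x powe r * h x * w x \<partial>lebesgue))"
    by (intro mult_left_mono nn_integral_mono) (auto split: split_indicator)
  finally show ?thesis by (simp add: cD_def mult.assoc)
qed

lemma epowr_mult_le_add:
  assumes "0 < r" shows "a * b powe r \<le> a powe (1 + r) + b powe (1 + r)"
proof -
  have "a * b powe r \<le> max a b powe 1 * max a b powe r"
    using assms by (intro mult_mono) (auto intro: epowr_mono)
  also have "\<dots> = max (a powe (1 + r)) (b powe (1 + r))"
    using epowr_add[of 1 r "max a b"] epowr_max[of "1 + r" a b] assms by simp
  also have "\<dots> \<le> a powe (1 + r) + b powe (1 + r)" by simp
  finally show ?thesis .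
qed

text \<open>On a block, \<open>kernel_tail\<close> is smallest at the right end and \<Psi> at the
  left end. Comparison with the block after y (k + 1) thus needs Sk (k + 2) next to \<Psi> (y (k +
  1)), and Sk k is split as sg k + sg (k + 1) + Sk (k + 2). The two detached terms are local; they
  lead to T, which is controlled by A.\<close>

lemma sum_Sk_quotient_le:
  assumes p: "q < p" and r_def: "r = q / (p - q)"
    and A: "\<And>k. tail v (y k) < top \<Longrightarrow> Uk k \<le> A (y (Suc k)) * tail v (y k) powe (1 / p)" "mono A"
    and \<Psi>: "\<And>t x. y 0 \<le> t \<Longrightarrow> t < x \<Longrightarrow> seg u t x powe q * tail v t powe (- r) \<le> \<Psi> x" "mono \<Psi>"
    and V0: "\<And>t x. tail v t = 0 \<Longrightarrow> seg u t x = 0"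
  shows "(\<Sum>k. sg k * (Sk k * tail v (y k) powe (- 1)) powe r) \<le> cQ q r *
    ((\<integral>\<^sup>+x. tail w x powe r * A x powe (p * r) * w x \<partial>lebesgue) +
     (\<integral>\<^sup>+x. kernel_tail q u w x powe r * \<Psi> x * w x \<partial>lebesgue))" (is "?L \<le> cQ q r * (?D + ?E)")
proof -
  have r: "0 < r" using p q by (simp add: r_def)
  have pr: "q * (1 + r) = p * r" using p by (simp add: r_def field_simps)
  define T where "T k = sg k powe (1 + r) * tail v (y k) powe (- r)" for k
  have T: "T k \<le> om k powe (1 + r) * A (y (Suc k)) powe (p * r)" for k
  proof (cases "tail v (y k)" rule: ennreal_cases3)
    case 1
    then have "sg k = 0" using V0[of "y k" "y (Suc k)"] q by (simp add: sg_def Uk_def)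
    then show ?thesis using r by (simp add: T_def)
  next
    case 2
    then show ?thesis using r by (simp add: T_def)
  next
    case (3 a)
    \<comment> \<open>As q * (1 + r) = p * r, inserting the bound on Uk k produces
      \<open>tail v (y k) powe r\<close>, which cancels the negative power.\<close>
    have "T k = om k powe (1 + r) * (Uk k powe (p * r) * tail v (y k) powe (- r))"
      using r by (simp add: T_def sg_def epowr_mult epowr_epowr pr mult.assoc)
    also have "\<dots> \<le> om k powe (1 + r) * ((A (y (Suc k)) * tail v (y k) powe (1 / p)) powe (p * r) * tail v (y k) powe (- r))"
      using r p q 3 by (intro mult_left_mono mult_right_mono epowr_mono A) auto
    also have "(A (y (Suc k)) * tail v (y k) powe (1 / p)) powe (p * r) = A (y (Suc k)) powe (p * r) * tail v (y k) powe r"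
      using r p q by (simp add: epowr_mult epowr_epowr)
    also have "\<dots> * tail v (y k) powe (- r) = A (y (Suc k)) powe (p * r) * tail v (y k) powe (r + - r)"
      using 3 by (subst epowr_add_finite) (auto simp: mult.assoc)
    finally show ?thesis by simp
  qed
  have sumT: "(\<Sum>k. T k) \<le> cD q r * ?D"
  proof -
    have "(\<Sum>k. T k) \<le> (\<Sum>k. om k powe (1 + r) * A (y (Suc k)) powe (p * r))"
      by (intro suminf_le T) auto
    also have "\<dots> \<le> cD q r * ?D"
      using r p q A(2) by (intro sum_om_epowr_le mono_epowr) auto
    finally show ?thesis .
  qed
  have term_le: "sg k * (Sk k * tail v (y k) powe (- 1)) powe r \<le>
    4 powe r * ((T k + (T k + T (Suc k))) + cL q powe r * (om k * (kernel_tail q u w (y (Suc (Suc k))) powe r * \<Psi> (y (Suc k)))))" for k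
  proof -
    let ?V = "tail v (y k) powe (- r)"
    have Sk: "Sk k = sg k + sg (Suc k) + Sk (Suc (Suc k))" by (subst Sk_Suc, subst Sk_Suc) (simp add: add.assoc)
    have "sg k * (Sk k * tail v (y k) powe (- 1)) powe r = sg k * (sg k + sg (Suc k) + Sk (Suc (Suc k))) powe r * ?V"
      unfolding Sk[symmetric] using r by (simp add: epowr_mult epowr_epowr mult.assoc)
    also have "\<dots> \<le>
      sg k * (4 powe r * (sg k powe r + sg (Suc k) powe r + Sk (Suc (Suc k)) powe r)) * ?V"
      using r by (intro mult_left_mono mult_right_mono epowr_add3_le) auto
    also have "\<dots> = 4 powe r * ((sg k * sg k powe r * ?V + sg k * sg (Suc k) powe r * ?V) + sg k * Sk (Suc (Suc k)) powe r * ?V)"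
      by (simp add: algebra_simps)
    also have "\<dots> \<le> 4 powe r * ((T k + (T k + T (Suc k))) + cL q powe r * (om k * (kernel_tail q u w (y (Suc (Suc k))) powe r * \<Psi> (y (Suc k)))))"
    proof (intro mult_left_mono add_mono)
      show "sg k * sg k powe r * ?V \<le> T k" using r by (simp add: T_def epowr_add)
      have "sg k * sg (Suc k) powe r * ?V \<le> (sg k powe (1 + r) + sg (Suc k) powe (1 + r)) * ?V"
        by (intro mult_right_mono epowr_mult_le_add r) auto
      also have "\<dots> \<le> T k + T (Suc k)"
        unfolding T_def distrib_right using r
        by (intro add_left_mono mult_left_mono epowr_antimono tail_antimono) (auto intro: y_le)
      finally show "sg k * sg (Suc k) powe r * ?V \<le> T k + T (Suc k)" .
      have "sg k * Sk (Suc (Suc k)) powe r * ?V = Sk (Suc (Suc k)) powe r * (om k * (Uk k powe q * ?V))"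
        by (simp add: sg_def mult_ac)
      also have "\<dots> \<le> (cL q * kernel_tail q u w (y (Suc (Suc k)))) powe r * (om k * \<Psi> (y (Suc k)))"
        unfolding Uk_def using r mono_y
        by (intro mult_mono mult_left_mono epowr_mono Sk_le_kernel_tail \<Psi>) (auto simp: strict_mono_def intro: y_le)
      also have "\<dots> = cL q powe r * (om k * (kernel_tail q u w (y (Suc (Suc k))) powe r * \<Psi> (y (Suc k))))"
        using r by (simp add: epowr_mult mult_ac)
      finally show "sg k * Sk (Suc (Suc k)) powe r * ?V \<le> cL q powe r * (om k * (kernel_tail q u w (y (Suc (Suc k))) powe r * \<Psi> (y (Suc k))))" .
    qed auto
    finally show ?thesis .
  qed
  have E: "(\<Sum>k. om k * (kernel_tail q u w (y (Suc (Suc k))) powe r * \<Psi> (y (Suc k)))) \<le> cL q * ?E"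
  proof -
    have "(\<Sum>k. om k * (kernel_tail q u w (y (Suc (Suc k))) powe r * \<Psi> (y (Suc k))))
      \<le> cL q * (\<integral>\<^sup>+x. (kernel_tail q u w x powe r * \<Psi> x) * w x * indicator {y 0<..} x \<partial>lebesgue)"
    proof (rule blocks_lower_Suc)
      fix k x assume "x \<in> block (Suc k)"
      then show "kernel_tail q u w (y (Suc (Suc k))) powe r * \<Psi> (y (Suc k)) \<le> kernel_tail q u w x powe r * \<Psi> x"
        using r q by (intro mult_mono epowr_mono kernel_tail_antimono monoD[OF \<Psi>(2)]) auto
    qed
    also have "\<dots> \<le> cL q * ?E"
      by (intro mult_left_mono nn_integral_mono) (auto split: split_indicator)
    finally show ?thesis .
  qed
  have "?L \<le> (\<Sum>k. 4 powe r * ((T k + (T k + T (Suc k))) + cL q powe r * (om k * (kernel_tail q u w (y (Suc (Suc k))) powe r * \<Psi> (y (Suc k))))))"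
    by (intro suminf_le term_le) auto
  also have "\<dots> = 4 powe r * (((\<Sum>k. T k) + ((\<Sum>k. T k) + (\<Sum>k. T (Suc k)))) +
      cL q powe r * (\<Sum>k. om k * (kernel_tail q u w (y (Suc (Suc k))) powe r * \<Psi> (y (Suc k)))))"
    by (simp add: ennreal_suminf_cmult suminf_add[symmetric])
  also have "\<dots> \<le> 4 powe r * ((cD q r * ?D + (cD q r * ?D + cD q r * ?D)) + cL q powe r * (cL q * ?E))"
  proof -
    have "(\<Sum>k. T (Suc k)) = (\<integral>\<^sup>+j. T j * indicator {1..} j \<partial>count_space UNIV)"
      by (subst suminf_shift_count_space) simp
    also have "\<dots> \<le> (\<integral>\<^sup>+j. T j \<partial>count_space UNIV)"
      by (intro nn_integral_mono) (auto split: split_indicator)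
    also have "\<dots> = (\<Sum>k. T k)" by (rule nn_integral_count_space_nat)
    finally have "(\<Sum>k. T (Suc k)) \<le> cD q r * ?D" using sumT by (rule order_trans)
    then show ?thesis by (intro mult_left_mono add_mono sumT E) auto
  qed
  also have "\<dots> = 4 powe r * (3 * cD q r * ?D + cL q powe r * cL q * ?E)"
  proof -
    have "(3::ennreal) = 1 + (1 + 1)" by simp
    then show ?thesis by (simp only: distrib_right mult_1 mult.assoc)
  qed
  also have "\<dots> \<le> 4 powe r * ((3 * cD q r + cL q powe r * cL q) * (?D + ?E))"
    by (intro mult_left_mono) (auto simp: distrib_left distrib_right add_increasing add_increasing2 add.assoc intro: add_mono)
  finally show ?thesis by (simp add: cQ_def mult.assoc)
qed

text \<open>The first sum is treated by the embedding with quotients, the second by Hoelder's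
  inequality with exponents p / q and 1 + r. Finiteness of \<open>kernel_tail\<close> at y 0 makes
  all tails of \<open>sigma\<close> finite, as the half-measure argument demands.\<close>

lemma hardy_bound_gt:
  assumes p: "q < p" and r_def: "r = q / (p - q)" and f: "mono f" "f (y 0) = 0"
    and v [measurable]: "v \<in> borel_measurable lebesgue"
    and fin: "wint p v f < top"
    and A: "\<And>x g. mono g \<Longrightarrow> wint p v g < top \<Longrightarrow>
       hardy_op g u x \<le> A x * wint p v g powe (1 / p)"
    and A_mono: "mono A"
    and \<Psi>: "\<And>t x. y 0 \<le> t \<Longrightarrow> t < x \<Longrightarrow> seg u t x powe q * tail v t powe (- r) \<le> \<Psi> x" "mono \<Psi>"
    and V0: "\<And>t x. tail v t = 0 \<Longrightarrow> seg u t x = 0"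
    and finN: "kernel_tail q u w (y 0) < top"
  shows "wint q w (hardy_op f u)
    \<le> cS2 q p * (((\<integral>\<^sup>+x. tail w x powe r * A x powe (p * r) * w x \<partial>lebesgue) +
     (\<integral>\<^sup>+x. kernel_tail q u w x powe r * \<Psi> x * w x \<partial>lebesgue)) powe (1 - q / p) *
      wint p v f powe (q / p))"
    (is "_ \<le> cS2 q p * ((?D + ?E) powe _ * ?X powe _)")
proof -
  have p0: "0 < p" using p q by simp
  have r: "0 < r" using p q by (simp add: r_def)
  have r1: "(1 + r) * (1 - q / p) = 1" using p q by (simp add: r_def field_simps)
  have pr1: "p * r * (1 - q / p) = q" using p q by (simp add: r_def field_simps)
  have s: "0 < 1 - q / p" "0 < q / p" "q / p < 1" using p q by (simp_all add: field_simps)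
  note [measurable] = borel_measurable_mono_lebesgue[OF f(1)]
  obtain B where B: "(\<Sum>k. B k) \<le> ?X" and main: "wint q w (hardy_op f u) \<le> cH q p *
       ((\<Sum>k. sg k * f (y k) powe q) + (\<Sum>k. om k * (A (y (Suc k)) * B k powe (1 / p)) powe q))"
    using hardy_op_decomposition[OF p0 f v fin A] by blast
  have X: "(\<integral>\<^sup>+x. f x powe p \<partial>density lebesgue v) = ?X"
    by (subst nn_integral_density) (auto simp: mult.commute)
  \<comment> \<open>A bounds the functional on all nondecreasing functions of finite norm, in
    particular on the indicator of \<open>{y k<..}\<close>.\<close>
  have UkA: "Uk k \<le> A (y (Suc k)) * tail v (y k) powe (1 / p)" if "tail v (y k) < top" for k
  proof -
    let ?g = "indicator {y k<..} :: real \<Rightarrow> ennreal"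
    have g: "mono ?g" by (intro monoI) (auto split: split_indicator)
    have gX: "wint p v ?g = tail v (y k)"
      unfolding tail_def using p0 by (intro nn_integral_cong) (auto split: split_indicator)
    have "Uk k = hardy_op ?g u (y (Suc k))"
      unfolding Uk_def seg_def hardy_op_def by (intro nn_integral_cong) (auto split: split_indicator)
    also have "\<dots> \<le> A (y (Suc k)) * tail v (y k) powe (1 / p)"
      using A[OF g, of "y (Suc k)"] that unfolding gX by blast
    finally show ?thesis .
  qed
  have Sk0: "Sk k = 0" if "tail v (y k) = 0" for k
  proof -
    have "sg (k + j) = 0" for j
    proof -
      have "Uk (k + j) \<le> seg u (y k) (y (Suc (k + j)))" unfolding Uk_def by (intro seg_mono) (auto intro: y_le)
      then show ?thesis using V0[OF that] q by (simp add: sg_def)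
    qed
    then show ?thesis by (simp add: Sk_def)
  qed
  have "(\<Sum>k. sg k * f (y k) powe q) = (\<integral>\<^sup>+k. f (y k) powe q \<partial>sigma)" by (simp add: nn_integral_sigma)
  also have "\<dots> \<le> cB2 p q * ((\<integral>\<^sup>+x. f x powe p \<partial>density lebesgue v) powe (q / p) *
    (\<integral>\<^sup>+i. (emeasure sigma {j \<in> space sigma. y i \<le> y j} * emeasure (density lebesgue v) {y i..} powe (- 1)) powe (q / (p - q)) \<partial>sigma) powe (1 - q / p))"
  proof (rule monotone_embedding_gt[OF f(1) q p])
    fix i
    have "Sk i \<le> cL q * kernel_tail q u w (y i)" by (rule Sk_le_kernel_tail)
    also have "\<dots> \<le> cL q * kernel_tail q u w (y 0)"
      using q by (intro mult_left_mono kernel_tail_antimono y_le) auto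
    also have "\<dots> < top" using finN by (simp add: ennreal_mult_less_top)
    finally show "emeasure sigma {j \<in> space sigma. y i \<le> y j} < top" by (simp add: emeasure_sigma)
    show "emeasure sigma {j \<in> space sigma. y i \<le> y j} = 0" if "emeasure (density lebesgue v) {y i..} = 0"
      using that Sk0 by (simp add: emeasure_sigma emeasure_density_Ici)
  qed (use fin X in auto)
  also have "\<dots> = cB2 p q * (?X powe (q / p) * (\<Sum>k. sg k * (Sk k * tail v (y k) powe (- 1)) powe r) powe (1 - q / p))"
    unfolding X nn_integral_sigma by (simp add: emeasure_sigma emeasure_density_Ici r_def)
  also have "\<dots> \<le> cB2 p q * (?X powe (q / p) * (cQ q r * (?D + ?E)) powe (1 - q / p))"
    using s by (intro mult_left_mono epowr_mono sum_Sk_quotient_le[OF p r_def UkA A_mono \<Psi> V0]) auto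
  also have "\<dots> = cB2 p q * cQ q r powe (1 - q / p) * ((?D + ?E) powe (1 - q / p) * ?X powe (q / p))"
    using s by (simp add: epowr_mult mult_ac)
  finally have 1: "(\<Sum>k. sg k * f (y k) powe q) \<le>
    cB2 p q * cQ q r powe (1 - q / p) * ((?D + ?E) powe (1 - q / p) * ?X powe (q / p))" .
  have "(\<Sum>k. om k * (A (y (Suc k)) * B k powe (1 / p)) powe q) =
     (\<Sum>k. B k powe (q / p) * (om k powe (1 + r) * A (y (Suc k)) powe (p * r)) powe (1 - q / p))"
  proof (intro suminf_cong)
    fix k
    have "(om k powe (1 + r) * A (y (Suc k)) powe (p * r)) powe (1 - q / p) = om k * A (y (Suc k)) powe q"
      using s by (simp add: epowr_mult epowr_epowr r1 pr1)
    then show "om k * (A (y (Suc k)) * B k powe (1 / p)) powe q =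
      B k powe (q / p) * (om k powe (1 + r) * A (y (Suc k)) powe (p * r)) powe (1 - q / p)"
      using q by (simp add: epowr_mult epowr_epowr mult_ac)
  qed
  also have "\<dots> \<le> 2 * ((\<Sum>k. B k) powe (q / p) * (\<Sum>k. om k powe (1 + r) * A (y (Suc k)) powe (p * r)) powe (1 - q / p))"
    by (rule suminf_Holder) (use s in auto)
  also have "\<dots> \<le> 2 * (?X powe (q / p) * (cD q r * (?D + ?E)) powe (1 - q / p))"
  proof (intro mult_left_mono mult_mono epowr_mono B)
    have "(\<Sum>k. om k powe (1 + r) * A (y (Suc k)) powe (p * r)) \<le> cD q r * ?D"
      using r p0 A_mono by (intro sum_om_epowr_le mono_epowr) auto
    also have "\<dots> \<le> cD q r * (?D + ?E)" by (intro mult_left_mono) auto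
    finally show "(\<Sum>k. om k powe (1 + r) * A (y (Suc k)) powe (p * r)) \<le> cD q r * (?D + ?E)" .
  qed (use s in auto)
  also have "\<dots> = 2 * cD q r powe (1 - q / p) * ((?D + ?E) powe (1 - q / p) * ?X powe (q / p))"
    using s by (simp add: epowr_mult mult_ac)
  finally have 2: "(\<Sum>k. om k * (A (y (Suc k)) * B k powe (1 / p)) powe q) \<le>
    2 * cD q r powe (1 - q / p) * ((?D + ?E) powe (1 - q / p) * ?X powe (q / p))" .
  have "wint q w (hardy_op f u) \<le> cH q p *
    (cB2 p q * cQ q r powe (1 - q / p) * ((?D + ?E) powe (1 - q / p) * ?X powe (q / p)) +
     2 * cD q r powe (1 - q / p) * ((?D + ?E) powe (1 - q / p) * ?X powe (q / p)))"
    by (rule order_trans[OF main]) (intro mult_left_mono add_mono 1 2, auto)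
  also have "\<dots> = cS2 q p * ((?D + ?E) powe (1 - q / p) * ?X powe (q / p))"
    unfolding cS2_def r_def[symmetric] by (simp add: distrib_right mult.assoc)
  finally show ?thesis .
qed

end

section \<open>Duality for monotone functions\<close>

lemma hardy_op_ge:
  assumes "mono f" and [measurable]: "u \<in> borel_measurable lebesgue"
  shows "f t * seg u t x \<le> hardy_op f u x"
proof -
  have "f t * seg u t x = (\<integral>\<^sup>+s. f t * (u s * indicator {t<..<x} s) \<partial>lebesgue)"
    unfolding seg_def by (rule nn_integral_cmult[symmetric]) measurable
  also have "\<dots> \<le> hardy_op f u x"
    unfolding hardy_op_def using monoD[OF assms(1)]
    by (intro nn_integral_mono) (auto split: split_indicator intro!: mult_right_mono)
  finally show ?thesis .
qed

lemma hardy_op_mono_fun: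
  assumes "\<And>s. g s \<le> f s" shows "hardy_op g u x \<le> hardy_op f u x"
  unfolding hardy_op_def using assms by (intro nn_integral_mono mult_right_mono) auto

lemma hardy_op_cmult:
  assumes [measurable]: "f \<in> borel_measurable lebesgue" "u \<in> borel_measurable lebesgue"
  shows "hardy_op (\<lambda>s. c * f s) u x = c * hardy_op f u x"
  unfolding hardy_op_def by (subst nn_integral_cmult[symmetric]) (auto simp: mult.assoc)

lemma hardy_op_density:
  assumes [measurable]: "f \<in> borel_measurable lebesgue" "u \<in> borel_measurable lebesgue"
  shows "(\<integral>\<^sup>+s. f s \<partial>density lebesgue (\<lambda>s. u s * indicator {..<x} s)) = hardy_op f u x"
  unfolding hardy_op_def by (subst nn_integral_density) (auto simp: mult_ac)

lemma emeasure_density_seg: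
  assumes [measurable]: "u \<in> borel_measurable lebesgue"
  shows "emeasure (density lebesgue (\<lambda>s. u s * indicator {..<x} s)) {s. t \<le> s} = seg u t x"
proof -
  have "emeasure (density lebesgue (\<lambda>s. u s * indicator {..<x} s)) {s. t \<le> s} =
     (\<integral>\<^sup>+s. u s * indicator {..<x} s * indicator {s. t \<le> s} s \<partial>lebesgue)"
    by (rule emeasure_density) auto
  also have "\<dots> = seg u t x" unfolding seg_def
  proof (rule nn_integral_cong_AE, use AE_lebesgue_neq[of t] in eventually_elim)
    fix s assume "s \<noteq> t"
    then show "u s * indicator {..<x} s * indicator {s. t \<le> s} s = u s * indicator {t<..<x} s"
      by (auto split: split_indicator)
  qed
  finally show ?thesis .
qed

text \<open>The functional is integration against u ds to the left of x. With target exponent 1 >= p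
  the embedding asks only for a bound on the quotients of tails.\<close>

lemma hardy_op_le_sup_quotient:
  assumes p: "0 < p" "p \<le> 1" and g: "mono g"
    and [measurable]: "u \<in> borel_measurable lebesgue" "v \<in> borel_measurable lebesgue"
    and fin: "wint p v g < top"
    and A: "\<And>t. tail v t < top \<Longrightarrow> seg u t x \<le> A * tail v t powe (1 / p)"
  shows "hardy_op g u x \<le> cB1 p 1 * (A * wint p v g powe (1 / p))"
proof -
  note [measurable] = borel_measurable_mono_lebesgue[OF g]
  have X: "(\<integral>\<^sup>+x. g x powe p \<partial>density lebesgue v) = wint p v g"
    by (subst nn_integral_density) (auto simp: mult.commute)
  have "(\<integral>\<^sup>+s. g s powe 1 \<partial>density lebesgue (\<lambda>s. u s * indicator {..<x} s)) \<le>
      cB1 p 1 * (A * (\<integral>\<^sup>+x. g x powe p \<partial>density lebesgue v) powe (1 / p))"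
    by (rule monotone_embedding_le[OF g p])
       (use A fin X in \<open>auto simp: emeasure_density_seg emeasure_density_Ici\<close>)
  then show ?thesis by (simp add: hardy_op_density X)
qed

text \<open>The same measure with target exponent 1 < p. The exponent q / (p - q) of the quotients
  becomes 1 / (p - 1), which is where Sawyer's integral comes from.\<close>

lemma hardy_op_le_integral_quotient:
  assumes p: "1 < p" and g: "mono g"
    and [measurable]: "u \<in> borel_measurable lebesgue" "v \<in> borel_measurable lebesgue"
    and fin: "wint p v g < top"
    and finU: "\<And>t. seg u t x < top" and V0: "\<And>t. tail v t = 0 \<Longrightarrow> seg u t x = 0"
  shows "hardy_op g u x \<le> cB2 p 1 * ((\<integral>\<^sup>+t. seg u t x powe (1 / (p - 1)) * u t * tail v t powe (- (1 / (p - 1))) * indicator {..<x} t \<partial>lebesgue) powe (1 - 1 / p)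
     * wint p v g powe (1 / p))"
proof -
  note [measurable] = borel_measurable_mono_lebesgue[OF g]
  have [measurable]: "(\<lambda>t. seg u t x) \<in> borel_measurable lebesgue" "(\<lambda>t. tail v t) \<in> borel_measurable lebesgue"
    by (intro borel_measurable_antimono_lebesgue antimonoI seg_mono tail_antimono; simp)+
  have X: "(\<integral>\<^sup>+x. g x powe p \<partial>density lebesgue v) = wint p v g"
    by (subst nn_integral_density) (auto simp: mult.commute)
  have Q: "(\<integral>\<^sup>+t. (seg u t x * tail v t powe (- 1)) powe (1 / (p - 1)) \<partial>density lebesgue (\<lambda>s. u s * indicator {..<x} s))
    = (\<integral>\<^sup>+t. seg u t x powe (1 / (p - 1)) * u t * tail v t powe (- (1 / (p - 1))) * indicator {..<x} t \<partial>lebesgue)"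
    using p by (subst nn_integral_density) (auto simp: epowr_mult epowr_epowr mult_ac intro!: nn_integral_cong)
  have "(\<integral>\<^sup>+s. g s powe 1 \<partial>density lebesgue (\<lambda>s. u s * indicator {..<x} s)) \<le>
      cB2 p 1 * ((\<integral>\<^sup>+x. g x powe p \<partial>density lebesgue v) powe (1 / p) *
    (\<integral>\<^sup>+i. (emeasure (density lebesgue (\<lambda>s. u s * indicator {..<x} s)) {j \<in> space (density lebesgue (\<lambda>s. u s * indicator {..<x} s)). i \<le> j}
      * emeasure (density lebesgue v) {i..} powe (- 1)) powe (1 / (p - 1)) \<partial>density lebesgue (\<lambda>s. u s * indicator {..<x} s)) powe (1 - 1 / p))"
    by (rule monotone_embedding_gt[OF g])
       (use p fin X finU V0 in \<open>auto simp: emeasure_density_seg emeasure_density_Ici\<close>)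
  then show ?thesis by (simp add: hardy_op_density X emeasure_density_seg emeasure_density_Ici Q mult.commute)
qed

text \<open>The exact norm of the functional. For q < p, and for Sawyer's integral in general,
  necessity goes through this norm, where test functions can be chosen freely; the explicit
  expressions are then bounded by it pointwise.\<close>

definition dual_norm :: "real \<Rightarrow> (real \<Rightarrow> ennreal) \<Rightarrow> (real \<Rightarrow> ennreal) \<Rightarrow> real \<Rightarrow> ennreal" where
  "dual_norm p u v x = (SUP g\<in>{g. mono g \<and> wint p v g \<le> 1}. hardy_op g u x)"

lemma mono_dual_norm: "mono (dual_norm p u v)"
  unfolding dual_norm_def by (intro monoI SUP_mono') (rule hardy_op_mono)

lemma zero_in_dual_ball: "0 < p \<Longrightarrow> (\<lambda>_. 0) \<in> {g. mono g \<and> wint p v g \<le> (1::ennreal)}"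
  by (auto intro!: monoI)

text \<open>Homogeneity. X is any positive finite bound rather than the integral itself, so that
  functions of norm 0 are covered as well.\<close>

lemma hardy_op_le_dual_norm:
  assumes p: "0 < p" and f: "mono f"
    and [measurable]: "u \<in> borel_measurable lebesgue" "v \<in> borel_measurable lebesgue"
    and le: "wint p v f \<le> X" and X: "0 < X" "X < top"
  shows "hardy_op f u x \<le> dual_norm p u v x * X powe (1 / p)"
proof -
  note [measurable] = borel_measurable_mono_lebesgue[OF f]
  define c where "c = X powe (- (1 / p))"
  let ?g = "\<lambda>s. c * f s"
  have g: "mono ?g" using monoD[OF f] by (intro monoI mult_left_mono) auto
  have cp: "c powe p = X powe (- 1)" using p by (simp add: c_def epowr_epowr)
  have "wint p v ?g = X powe (- 1) * wint p v f"
    using p by (subst nn_integral_cmult[symmetric]) (auto simp: epowr_mult cp mult.assoc)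
  also have "\<dots> \<le> X powe (- 1) * X powe 1" using le by (intro mult_left_mono) auto
  also have "\<dots> = 1" using X by (simp del: epowr_1 flip: epowr_add_finite)
  finally have "hardy_op ?g u x \<le> dual_norm p u v x"
    unfolding dual_norm_def using g by (intro SUP_upper) auto
  then have "c * hardy_op f u x \<le> dual_norm p u v x" by (simp add: hardy_op_cmult)
  then have "(c * hardy_op f u x) * X powe (1 / p) \<le> dual_norm p u v x * X powe (1 / p)"
    by (rule mult_right_mono) simp
  moreover have "(c * hardy_op f u x) * X powe (1 / p) = hardy_op f u x * (X powe (- (1 / p)) * X powe (1 / p))"
    by (simp add: c_def mult_ac)
  moreover have "X powe (- (1 / p)) * X powe (1 / p) = 1" using X by (simp flip: epowr_add_finite)
  ultimately show ?thesis by simp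
qed

lemma seg_le_dual_norm:
  assumes p: "0 < p" and [measurable]: "u \<in> borel_measurable lebesgue" "v \<in> borel_measurable lebesgue"
    and V0: "tail v t = 0 \<Longrightarrow> seg u t x = 0"
  shows "seg u t x * tail v t powe (- (1 / p)) \<le> dual_norm p u v x"
proof (cases "tail v t = 0 \<or> tail v t = top")
  case True
  then show ?thesis using V0 p by auto
next
  case False
  then have X: "0 < tail v t" "tail v t < top" by (auto simp: less_top zero_less_iff_neq_zero)
  let ?g = "indicator {t<..} :: real \<Rightarrow> ennreal"
  have g: "mono ?g" by (intro monoI) (auto split: split_indicator)
  have gX: "wint p v ?g = tail v t"
    unfolding tail_def using p by (intro nn_integral_cong) (auto split: split_indicator)
  have "seg u t x = hardy_op ?g u x"
    unfolding seg_def hardy_op_def by (intro nn_integral_cong) (auto split: split_indicator)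
  also have "\<dots> \<le> dual_norm p u v x * tail v t powe (1 / p)"
    by (rule hardy_op_le_dual_norm[OF p g assms(2,3)]) (use gX X in auto)
  finally have "seg u t x * tail v t powe (- (1 / p)) \<le> dual_norm p u v x * tail v t powe (1 / p) * tail v t powe (- (1 / p))"
    by (rule mult_right_mono) simp
  also have "\<dots> = dual_norm p u v x * (tail v t powe (1 / p + - (1 / p)))"
    using X by (subst epowr_add_finite) (auto simp: mult.assoc)
  finally show ?thesis by simp
qed

lemma mult_inverse_epowr_le: "(a::ennreal) * z powe (- 1) * z \<le> a"
proof (cases z rule: ennreal_cases3)
  case (3 b)
  then show ?thesis by (simp add: mult.assoc epowr_ennreal ennreal_mult[symmetric] powr_minus)
qed auto

text \<open>The added 1 makes positivity immediate, which \<open>hardy_op_le_dual_norm\<close> asks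
  of the bound \<open>cW1 r * Y\<close>.\<close>

definition cW1 :: "real \<Rightarrow> ennreal" where "cW1 r = cW r + 1"

text \<open>The test function is f = g^r with r = 1 / (p - 1) and g the maximal function of the
  quotients Q. Then f^p = g^(1 + r), so \<open>maximal_le\<close> bounds the norm of f by a multiple
  of Y, the value of the functional at f. Inserting this in the definition of the norm gives Y <=
  const * Y^(1 / p), which is absorbed; and Y is at least Sawyer's integral, since g >= Q.\<close>

lemma integral_quotient_le_dual_norm:
  assumes p: "1 < p" and [measurable]: "u \<in> borel_measurable lebesgue" "v \<in> borel_measurable lebesgue"
    and finU: "(\<integral>\<^sup>+s. u s \<partial>lebesgue) < top"
    and low: "0 < \<delta>" "\<And>t. tail v t < \<delta> \<Longrightarrow> seg u t x = 0"
  shows "(\<integral>\<^sup>+t. seg u t x powe (1 / (p - 1)) * u t * tail v t powe (- (1 / (p - 1))) * indicator {..<x} t \<partial>lebesgue) powe (1 - 1 / p)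
    \<le> cW1 (1 / (p - 1)) powe (1 / p) * dual_norm p u v x"
    (is "?Y0 powe _ \<le> _")
proof -
  define r where "r = 1 / (p - 1)"
  have r: "0 < r" using p by (simp add: r_def)
  have rp: "r * p = 1 + r" "p * r = 1 + r" using p by (simp_all add: r_def field_simps)
  have anti: "antimono (\<lambda>t. seg u t x)" "antimono (\<lambda>t. tail v t)"
    by (intro antimonoI seg_mono tail_antimono; simp)+
  note [measurable] = borel_measurable_antimono_lebesgue[OF anti(1)] borel_measurable_antimono_lebesgue[OF anti(2)]
  define Q where "Q t = seg u t x * tail v t powe (- 1)" for t
  define g where "g = (\<lambda>t. SUP k\<in>{k \<in> UNIV. k \<le> t}. Q k)"
  let ?\<sigma> = "density lebesgue (\<lambda>s. u s * indicator {..<x} s)"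
  have g: "mono g" unfolding g_def by (rule mono_SUP_le)
  define f where "f t = g t powe r" for t
  have f: "mono f" unfolding f_def[abs_def] using g r by (intro mono_epowr) auto
  note [measurable] = borel_measurable_mono_lebesgue[OF g] borel_measurable_mono_lebesgue[OF f]
  define Y where "Y = hardy_op f u x"
  have "(\<integral>\<^sup>+x. g x powe (1 + r) \<partial>density lebesgue v) \<le> cW r * (\<integral>\<^sup>+i. g i powe r \<partial>?\<sigma>)"
    unfolding g_def
  proof (rule maximal_le[OF r])
    fix k
    have "Q k * emeasure (density lebesgue v) {k..} \<le> seg u k x"
      unfolding emeasure_density_Ici[OF assms(3)] Q_def by (rule mult_inverse_epowr_le)
    then show "Q k * emeasure (density lebesgue v) {k..} \<le> emeasure ?\<sigma> {i \<in> space ?\<sigma>. k \<le> i}"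
      by (simp add: emeasure_density_seg)
  qed auto
  then have "wint p v f \<le> cW r * Y"
    by (subst (asm) nn_integral_density)
       (auto simp: Y_def f_def epowr_epowr rp mult.commute hardy_op_density[symmetric])
  also have "\<dots> \<le> cW1 r * Y" unfolding cW1_def by (intro mult_right_mono) auto
  finally have X: "wint p v f \<le> cW1 r * Y" .
  have segU: "seg u t x \<le> (\<integral>\<^sup>+s. u s \<partial>lebesgue)" for t
    unfolding seg_def by (intro nn_integral_mono) (auto split: split_indicator)
  \<comment> \<open>A uniform bound on the quotients: \<open>seg\<close> is at most the total
    integral of u, and where it is nonzero the tail of v is at least \<delta>. It makes Y finite, as
    the absorption requires.\<close>
  define C where "C = (\<integral>\<^sup>+s. u s \<partial>lebesgue) * \<delta> powe (- 1)"
  have C: "C < top" unfolding C_def using finU epowr_neg_less_top[OF low(1), of "- 1"]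
    by (simp add: ennreal_mult_less_top)
  have "Q t \<le> C" for t
  proof (cases "tail v t < \<delta>")
    case False
    then show ?thesis unfolding Q_def C_def by (intro mult_mono segU epowr_antimono) auto
  qed (use low(2) in \<open>simp add: Q_def\<close>)
  then have gC: "g t \<le> C" for t unfolding g_def by (intro SUP_least) auto
  have "Y \<le> (\<integral>\<^sup>+s. C powe r * u s \<partial>lebesgue)"
    unfolding Y_def hardy_op_def f_def using gC r
    by (intro nn_integral_mono) (auto split: split_indicator intro!: mult_right_mono epowr_mono)
  also have "\<dots> = C powe r * (\<integral>\<^sup>+s. u s \<partial>lebesgue)" by (rule nn_integral_cmult) measurable
  also have "\<dots> < top" using C finU r by (simp add: ennreal_mult_less_top)
  finally have Yfin: "Y < top" .
  have "?Y0 \<le> Y"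
    unfolding Y_def hardy_op_def r_def[symmetric]
  proof (intro nn_integral_mono)
    fix t
    have "Q t \<le> g t" unfolding g_def by (intro SUP_upper) auto
    then have "Q t powe r \<le> f t" unfolding f_def using r by (intro epowr_mono) auto
    moreover have "Q t powe r = seg u t x powe r * tail v t powe (- r)"
      using r by (simp add: Q_def epowr_mult epowr_epowr)
    ultimately show "seg u t x powe r * u t * tail v t powe - r * indicator {..<x} t \<le> f t * u t * indicator {..<x} t"
      using mult_right_mono[of "seg u t x powe r * tail v t powe (- r)" "f t" "u t * indicator {..<x} t"]
      by (simp add: mult_ac)
  qed
  moreover have "Y powe (1 - 1 / p) \<le> cW1 r powe (1 / p) * dual_norm p u v x"
  proof (cases "Y = 0")
    case False
    have cW1: "0 < cW1 r" "cW1 r < top" using r by (auto simp: cW1_def zero_less_iff_neq_zero)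
    have "Y \<le> dual_norm p u v x * (cW1 r * Y) powe (1 / p)"
      unfolding Y_def
      by (rule hardy_op_le_dual_norm)
         (use p f X False cW1 Yfin in \<open>auto simp: Y_def[symmetric] ennreal_zero_less_mult_iff zero_less_iff_neq_zero ennreal_mult_less_top\<close>)
    also have "\<dots> = (cW1 r powe (1 / p) * dual_norm p u v x) * Y powe (1 / p)"
      using p by (simp add: epowr_mult mult_ac)
    finally have "Y \<le> (cW1 r powe (1 / p) * dual_norm p u v x) powe (1 / (1 - 1 / p))"
      using p Yfin by (intro epowr_absorb[where s = "1 / p"]) auto
    then show ?thesis using p by (simp add: epowr_le_iff)
  qed (use p in simp)
  ultimately show ?thesis
    using p epowr_mono[of ?Y0 Y "1 - 1 / p"] by (auto simp: r_def intro: order_trans)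
qed

text \<open>The choices for different k are independent, so suprema and finite sums commute. The
  induction moves one chosen term at a time into z; near-maximisers, which would need finite
  suprema, are avoided.\<close>

lemma sum_SUP_le:
  fixes h :: "nat \<Rightarrow> 'b \<Rightarrow> ennreal"
  assumes S: "S \<noteq> {}" and le: "\<And>\<phi>. (\<And>k. \<phi> k \<in> S) \<Longrightarrow> (\<Sum>k<n. h k (\<phi> k)) \<le> C"
  shows "(\<Sum>k<n. SUP g\<in>S. h k g) \<le> C"
proof -
  have "z + (\<Sum>k<n. SUP g\<in>S. h k g) \<le> C"
    if "\<And>\<phi>. (\<And>k. \<phi> k \<in> S) \<Longrightarrow> z + (\<Sum>k<n. h k (\<phi> k)) \<le> C" for z n
    using that
  proof (induction n arbitrary: z)
    case 0
    obtain s where "s \<in> S" using S by auto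
    then show ?case using "0"[of "\<lambda>_. s"] by simp
  next
    case (Suc n)
    have "z + (\<Sum>k<Suc n. SUP g\<in>S. h k g) = (SUP g\<in>S. (z + (\<Sum>k<n. SUP g\<in>S. h k g)) + h n g)"
      by (simp add: ennreal_SUP_add_right[OF S] add.assoc)
    also have "\<dots> \<le> C"
    proof (rule SUP_least)
      fix g assume g: "g \<in> S"
      have "(z + h n g) + (\<Sum>k<n. SUP g\<in>S. h k g) \<le> C"
      proof (rule Suc.IH)
        fix \<phi> :: "nat \<Rightarrow> 'b" assume \<phi>: "\<And>k. \<phi> k \<in> S"
        have "z + (\<Sum>k<Suc n. h k ((\<phi>(n := g)) k)) \<le> C"
          using \<phi> g by (intro Suc.prems) auto
        then show "(z + h n g) + (\<Sum>k<n. h k (\<phi> k)) \<le> C" by (simp add: add_ac)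
      qed
      then show "(z + (\<Sum>k<n. SUP g\<in>S. h k g)) + h n g \<le> C" by (simp add: add_ac)
    qed
    finally show ?case .
  qed
  from this[of 0] show ?thesis using le by simp
qed

section \<open>Necessity of the conditions\<close>

lemma tail_mult_hardy_op_le:
  assumes q: "0 < q" and [measurable]: "w \<in> borel_measurable lebesgue"
  shows "tail w x * hardy_op g u x powe q \<le> wint q w (hardy_op g u)"
proof -
  have "tail w x * hardy_op g u x powe q = (\<integral>\<^sup>+t. w t * indicator {x<..} t * hardy_op g u x powe q \<partial>lebesgue)"
    unfolding tail_def by (rule nn_integral_multc[symmetric]) measurable
  also have "\<dots> \<le> wint q w (hardy_op g u)"
  proof (intro nn_integral_mono)
    fix t
    have "hardy_op g u x powe q \<le> hardy_op g u t powe q" if "x < t"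
      using q that by (intro epowr_mono hardy_op_mono) auto
    then show "w t * indicator {x<..} t * hardy_op g u x powe q \<le> hardy_op g u t powe q * w t"
      by (auto split: split_indicator simp: mult.commute intro!: mult_left_mono)
  qed
  finally show ?thesis .
qed

text \<open>Up to z, \<open>seg u x s\<close> is at most \<open>seg u x z\<close>; beyond z it is
  \<open>seg u x z + seg u z s\<close>.\<close>

lemma kernel_tail_le:
  assumes q: "0 < q" and [measurable]: "u \<in> borel_measurable lebesgue" "w \<in> borel_measurable lebesgue"
    and xz: "x \<le> z"
  shows "kernel_tail q u w x \<le> 2 powe q * (seg u x z powe q * tail w x + kernel_tail q u w z)"
proof -
  have "mono (\<lambda>s. seg u z s)" by (intro monoI seg_mono) auto
  note [measurable] = borel_measurable_mono_lebesgue[OF this]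
  have tw: "1 \<le> (2::ennreal) powe q" using epowr_mono[of 1 2 q] q by simp
  have "kernel_tail q u w x \<le> (\<integral>\<^sup>+s. 2 powe q * (seg u x z powe q * (w s * indicator {x<..} s) +
      w s * seg u z s powe q * indicator {z<..} s) \<partial>lebesgue)"
    unfolding kernel_tail_def
  proof (intro nn_integral_mono)
    fix s
    have *: "seg u x s powe q \<le> 2 powe q * (seg u x z powe q + seg u z s powe q * indicator {z<..} s)" if "x < s"
    proof (cases "s \<le> z")
      case True
      then have "seg u x s powe q \<le> 1 * seg u x z powe q" using q by (simp add: epowr_mono seg_mono)
      also have "\<dots> \<le> 2 powe q * seg u x z powe q" using tw by (rule mult_right_mono) simp
      finally show ?thesis using True by simp
    next
      case False
      have "seg u x s powe q = (seg u x z + seg u z s) powe q"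
        using False xz by (subst seg_split[of u x z s]) auto
      also have "\<dots> \<le> 2 powe q * (seg u x z powe q + seg u z s powe q)" using q by (intro epowr_add_le) auto
      finally show ?thesis using False by simp
    qed
    show "w s * seg u x s powe q * indicator {x<..} s \<le> 2 powe q * (seg u x z powe q * (w s * indicator {x<..} s) +
      w s * seg u z s powe q * indicator {z<..} s)"
    proof (cases "x < s")
      case True
      have "w s * seg u x s powe q \<le> w s * (2 powe q * (seg u x z powe q + seg u z s powe q * indicator {z<..} s))"
        using *[OF True] by (rule mult_left_mono) simp
      then show ?thesis using True by (simp add: algebra_simps)
    qed simp
  qed
  also have "\<dots> = 2 powe q * (seg u x z powe q * tail w x + kernel_tail q u w z)"
    unfolding tail_def kernel_tail_def
    by (simp add: nn_integral_cmult nn_integral_add)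
  finally show ?thesis .
qed

text \<open>The supremum in \<open>C\<^sub>3\<close>, taken over all real t. Points t >= x
  contribute 0.\<close>

definition sup_quotient :: "real \<Rightarrow> real \<Rightarrow> (real \<Rightarrow> ennreal) \<Rightarrow> (real \<Rightarrow> ennreal) \<Rightarrow> real \<Rightarrow> ennreal" where
  "sup_quotient q r u v x = (SUP t. seg u t x powe q * tail v t powe (- r))"

lemma mono_sup_quotient:
  assumes "0 < q" shows "mono (sup_quotient q r u v)"
  unfolding sup_quotient_def using assms
  by (intro monoI SUP_mono' mult_right_mono epowr_mono seg_mono) auto

text \<open>The power 1 + r = 1 / (1 - q / p) is the one produced by
  \<open>epowr_absorb\<close>.\<close>

definition cN1 :: "real \<Rightarrow> real \<Rightarrow> ennreal" where "cN1 q r = cL q powe (1 + r)"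
definition cN2 :: "real \<Rightarrow> real \<Rightarrow> ennreal" where "cN2 q r = cL q * (cW r * cL q) powe r"
definition cN3 :: "real \<Rightarrow> real \<Rightarrow> ennreal" where
  "cN3 q r = (2 powe q * 2) powe r * (cN1 q r + (2 * 2 powe q) powe r * ennreal (1 / th q) * cN2 q r)"

lemma cN_finite [simp]: "0 < r \<Longrightarrow> cN1 q r < top" "0 < r \<Longrightarrow> cN2 q r < top"
  "0 < q \<Longrightarrow> 0 < r \<Longrightarrow> cN3 q r < top"
  by (auto simp: cN1_def cN2_def cN3_def ennreal_mult_less_top)

context hardy_blocks
begin

context
  fixes p r :: real and v :: "real \<Rightarrow> ennreal" and K :: ennreal
  assumes p: "q < p" and r_def: "r = q / (p - q)"
    and v [measurable]: "v \<in> borel_measurable lebesgue" and K: "K < top"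
    and hardy: "\<And>g. mono g \<Longrightarrow> wint p v g < top \<Longrightarrow>
      wint q w (hardy_op g u) \<le> K * wint p v g powe (q / p)"
begin

lemma exponents:
  "0 < p" "0 < r" "q * (1 + r) = p * r" "(1 + r) * (1 - q / p) = 1" "p * r * (1 - q / p) = q"
  "1 / (1 - q / p) = 1 + r" "(1 + r) * (q / p) = r" "1 / (p - q) * p = 1 + r" "1 / (p - q) * q = r"
  "0 < q / p" "q / p < 1"
  using p q by (simp_all add: r_def field_simps)

text \<open>Arbitrary functions g k of norm at most 1 are combined into the single test function f,
  whose p-th power is the sum of d k * (g k)^p. Its norm is controlled by D, and testing at y (k +
  1) with the k-th summand alone recovers d k. This gives D <= const * K * D^(q / p), which is
  absorbed.\<close>

lemma test_sum_le:
  assumes g: "\<And>k. mono (g k) \<and> (\<integral>\<^sup>+x. g k x powe p * v x \<partial>lebesgue) \<le> 1"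
  shows "(\<Sum>k<n. om k powe (1 + r) * hardy_op (g k) u (y (Suc k)) powe (p * r)) \<le> cN1 q r * K powe (1 + r)"
proof -
  note ex = exponents
  define a where "a k = hardy_op (g k) u (y (Suc k))" for k
  \<comment> \<open>The extremal choice for Hoelder's inequality: it satisfies om k * (a k)^q * (d
    k)^(q / p) = d k.\<close>
  define d where "d k = om k powe (1 + r) * a k powe (p * r)" for k
  define D where "D = (\<Sum>k<n. d k)"
  note [measurable] = borel_measurable_mono_lebesgue[OF conjunct1[OF g]]
  \<comment> \<open>Finiteness, needed for the absorption, follows from the assumed inequality
    itself because om is positive.\<close>
  have a: "a k < top" for k
  proof -
    have "om (Suc k) * a k powe q \<le> wint q w (hardy_op (g k) u)"
      using tail_mult_hardy_op_le[OF q w, of "y (Suc k)"] by (simp only: tail_y om_def a_def)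
    also have "\<dots> \<le> K * (\<integral>\<^sup>+x. g k x powe p * v x \<partial>lebesgue) powe (q / p)"
      using g[of k] by (intro hardy) (auto intro: le_less_trans)
    also have "\<dots> \<le> K * 1 powe (q / p)" using g[of k] ex by (intro mult_left_mono epowr_mono) auto
    also have "\<dots> < top" using K by simp
    finally have "a k powe q < top"
      using om_pos[of "Suc k"] by (auto simp: ennreal_mult_less_top)
    then show ?thesis using q by (cases "a k" rule: ennreal_cases3) auto
  qed
  have d: "d k < top" for k using a[of k] ex by (simp add: d_def ennreal_mult_less_top)
  have D: "D < top" unfolding D_def using d by (simp add: less_top[symmetric])
  define f where "f x = (\<Sum>k<n. d k * g k x powe p) powe (1 / p)" for x
  have f: "mono f"
    unfolding f_def[abs_def] using monoD[OF conjunct1[OF g]] ex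
    by (intro mono_epowr monoI sum_mono mult_left_mono epowr_mono) auto
  have "wint p v f = (\<integral>\<^sup>+x. (\<Sum>k<n. d k * (g k x powe p * v x)) \<partial>lebesgue)"
    unfolding f_def using ex by (simp add: epowr_epowr sum_distrib_right mult.assoc)
  also have "\<dots> = (\<Sum>k<n. d k * (\<integral>\<^sup>+x. g k x powe p * v x \<partial>lebesgue))"
    by (simp add: nn_integral_sum nn_integral_cmult)
  also have "\<dots> \<le> (\<Sum>k<n. d k * 1)" using g by (intro sum_mono mult_left_mono) auto
  finally have X: "wint p v f \<le> D" by (simp add: D_def)
  have term_le: "d k \<le> om k * hardy_op f u (y (Suc k)) powe q" if "k < n" for k
  proof -
    have "om k * a k powe q = (om k powe (1 + r) * a k powe (p * r)) powe (1 - q / p)"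
      using ex by (simp add: epowr_mult epowr_epowr)
    then have "om k * a k powe q * d k powe (q / p) = d k powe (1 - q / p + q / p)"
      unfolding d_def[symmetric] using ex by (subst epowr_add) auto
    then have "d k = om k * (d k powe (1 / p) * a k) powe q"
      using q ex by (simp add: epowr_mult epowr_epowr mult_ac)
    also have "d k powe (1 / p) * a k \<le> hardy_op f u (y (Suc k))"
    proof -
      have "d k powe (1 / p) * a k = hardy_op (\<lambda>x. d k powe (1 / p) * g k x) u (y (Suc k))"
        unfolding a_def by (rule hardy_op_cmult[symmetric]) measurable
      also have "\<dots> \<le> hardy_op f u (y (Suc k))"
      proof (rule hardy_op_mono_fun)
        fix x
        have "d k powe (1 / p) * g k x = (d k * g k x powe p) powe (1 / p)"
          using ex by (simp add: epowr_mult epowr_epowr)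
        also have "\<dots> \<le> f x"
          unfolding f_def using that ex by (intro epowr_mono member_le_sum) auto
        finally show "d k powe (1 / p) * g k x \<le> f x" .
      qed
      finally show ?thesis .
    qed
    then have "om k * (d k powe (1 / p) * a k) powe q \<le> om k * hardy_op f u (y (Suc k)) powe q"
      using q by (intro mult_left_mono epowr_mono) auto
    finally show ?thesis .
  qed
  have "D \<le> (\<Sum>k<n. om k * hardy_op f u (y (Suc k)) powe q)"
    unfolding D_def using term_le by (intro sum_mono) auto
  also have "\<dots> \<le> (\<Sum>k. om k * hardy_op f u (y (Suc k)) powe q)" by (intro sum_le_suminf) auto
  also have "\<dots> \<le> cL q * (\<integral>\<^sup>+x. hardy_op f u x powe q * w x * indicator {y 0<..} x \<partial>lebesgue)"
    using q by (intro blocks_lower_Suc epowr_mono hardy_op_mono) auto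
  also have "\<dots> \<le> cL q * wint q w (hardy_op f u)"
    by (intro mult_left_mono nn_integral_mono) (auto split: split_indicator)
  also have "\<dots> \<le> cL q * (K * wint p v f powe (q / p))"
    using X D by (intro mult_left_mono hardy f) (auto intro: le_less_trans)
  also have "\<dots> \<le> cL q * (K * D powe (q / p))"
    using X ex by (intro mult_left_mono epowr_mono) auto
  finally have "D \<le> (cL q * K) powe (1 / (1 - q / p))"
    using D ex by (intro epowr_absorb[where s = "q / p"]) (auto simp: mult.assoc)
  also have "\<dots> = cN1 q r * K powe (1 + r)" using ex by (simp add: cN1_def epowr_mult)
  finally show ?thesis by (simp add: D_def d_def a_def)
qed

lemma sum_dual_norm_le:
  "(\<Sum>k. om k powe (1 + r) * dual_norm p u v (y (Suc k)) powe (p * r)) \<le> cN1 q r * K powe (1 + r)"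
proof (intro suminf_le_const)
  fix n
  let ?S = "{g. mono g \<and> wint p v g \<le> 1}"
  have S: "?S \<noteq> {}" using zero_in_dual_ball[OF exponents(1), of v] by blast
  have "(\<Sum>k<n. om k powe (1 + r) * dual_norm p u v (y (Suc k)) powe (p * r))
    = (\<Sum>k<n. SUP g\<in>?S. om k powe (1 + r) * hardy_op g u (y (Suc k)) powe (p * r))"
    unfolding dual_norm_def using exponents S
    by (subst epowr_SUP) (auto simp: SUP_mult_left_ennreal)
  also have "\<dots> \<le> cN1 q r * K powe (1 + r)"
    by (rule sum_SUP_le[OF S]) (rule test_sum_le, auto)
  finally show "(\<Sum>k<n. om k powe (1 + r) * dual_norm p u v (y (Suc k)) powe (p * r)) \<le> cN1 q r * K powe (1 + r)" .
qed auto

lemma dual_norm_integral_le: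
  "(\<integral>\<^sup>+x. tail w x powe r * dual_norm p u v x powe (p * r) * w x * indicator {y 0<..} x \<partial>lebesgue)
    \<le> cN1 q r * K powe (1 + r)"
proof -
  have "(\<integral>\<^sup>+x. (tail w x powe r * dual_norm p u v x powe (p * r)) * w x * indicator {y 0<..} x \<partial>lebesgue)
    \<le> (\<Sum>k. om k * (om k powe r * dual_norm p u v (y (Suc k)) powe (p * r)))"
  proof (rule blocks_upper)
    fix k x assume "x \<in> block k"
    then show "tail w x powe r * dual_norm p u v x powe (p * r) \<le> om k powe r * dual_norm p u v (y (Suc k)) powe (p * r)"
      unfolding om_def tail_y[symmetric] using exponents
      by (intro mult_mono epowr_mono tail_antimono monoD[OF mono_dual_norm]) auto
  qed
  also have "\<dots> = (\<Sum>k. om k powe (1 + r) * dual_norm p u v (y (Suc k)) powe (p * r))"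
    using exponents by (simp add: epowr_add mult.assoc)
  also have "\<dots> \<le> cN1 q r * K powe (1 + r)" by (rule sum_dual_norm_le)
  finally show ?thesis .
qed

context
  assumes V0: "\<And>t x. tail v t = 0 \<Longrightarrow> seg u t x = 0"
    and finN: "kernel_tail q u w (y 0) < top"
begin

text \<open>The points t k are arbitrary candidates for the suprema in \<open>sup_quotient\<close>.
  The test function is a power of the maximal function g of the quotients Sk k / tail v (t k),
  chosen so that f^p = g^(1 + r) and f^q = g^r. Then \<open>maximal_le\<close> bounds its norm by
  the sum of sg k * f (y k)^q, hence by the left-hand side of the Hardy inequality; absorption
  bounds that norm, and the left-hand side also dominates the sum in question.\<close>

lemma test_maximal_le:
  "(\<Sum>k<n. om k * Sk k powe r * (seg u (t k) (y k) powe q * tail v (t k) powe (- r))) \<le> cN2 q r * K powe (1 + r)"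
proof -
  note ex = exponents
  define Q where "Q k = Sk k * tail v (t k) powe (- 1)" for k
  \<comment> \<open>For t k < y k the tail of \<open>sigma\<close> at t k is at least Sk k, as
    \<open>maximal_le\<close> needs; for the other indices \<open>seg u (t k) (y k)\<close> is
    0.\<close>
  define A where "A = {k. k < n \<and> t k < y k}"
  define g where "g = (\<lambda>x. SUP k\<in>{k \<in> A. t k \<le> x}. Q k)"
  have finA: "finite A" by (auto simp: A_def)
  have g: "mono g" unfolding g_def by (rule mono_SUP_le)
  define f where "f x = g x powe (1 / (p - q))" for x
  have f: "mono f" unfolding f_def[abs_def] using g p by (intro mono_epowr) auto
  note [measurable] = borel_measurable_mono_lebesgue[OF g]
  have fp: "f x powe p = g x powe (1 + r)" and fq: "f x powe q = g x powe r" for x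
    using ex by (simp_all add: f_def epowr_epowr)
  let ?X = "wint p v f"
  let ?L = "wint q w (hardy_op f u)"
  have restrict: "cL q * (\<integral>\<^sup>+x. hardy_op f u x powe q * w x * indicator {y 0<..} x \<partial>lebesgue) \<le> cL q * ?L"
    by (intro mult_left_mono nn_integral_mono) (auto split: split_indicator)
  have "(\<integral>\<^sup>+x. g x powe (1 + r) \<partial>density lebesgue v) \<le> cW r * (\<integral>\<^sup>+i. g (y i) powe r \<partial>sigma)"
    unfolding g_def
  proof (rule maximal_le[OF ex(2)])
    fix k assume k: "k \<in> A"
    have "Q k * emeasure (density lebesgue v) {t k..} \<le> Sk k"
      unfolding emeasure_density_Ici[OF v] Q_def by (rule mult_inverse_epowr_le)
    also have "\<dots> \<le> emeasure sigma {i \<in> space sigma. t k \<le> y i}"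
      unfolding emeasure_sigma[symmetric] using k by (intro emeasure_mono) (auto simp: A_def)
    finally show "Q k * emeasure (density lebesgue v) {t k..} \<le> emeasure sigma {i \<in> space sigma. t k \<le> y i}" .
  qed auto
  moreover have "(\<integral>\<^sup>+x. g x powe (1 + r) \<partial>density lebesgue v) = ?X"
    unfolding fp by (subst nn_integral_density) (auto simp: mult.commute)
  ultimately have X: "?X \<le> cW r * (\<Sum>k. sg k * f (y k) powe q)"
    unfolding nn_integral_sigma fq by simp
  have Sk_fin: "Sk k < top" for k
  proof -
    have "Sk k \<le> cL q * kernel_tail q u w (y k)" by (rule Sk_le_kernel_tail)
    also have "\<dots> \<le> cL q * kernel_tail q u w (y 0)"
      using q by (intro mult_left_mono kernel_tail_antimono y_le) auto
    also have "\<dots> < top" using finN by (simp add: ennreal_mult_less_top)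
    finally show ?thesis .
  qed
  have Xfin: "?X < top"
  proof -
    have Qfin: "Q k < top" if "k \<in> A" for k
    proof (cases "tail v (t k) = 0")
      case True
      have "sg (k + j) = 0" for j
      proof -
        have "Uk (k + j) \<le> seg u (t k) (y (Suc (k + j)))"
          unfolding Uk_def using that y_le[of k "k + j"] by (intro seg_mono) (auto simp: A_def)
        then show ?thesis using V0[OF True] q by (simp add: sg_def)
      qed
      then show ?thesis by (simp add: Q_def Sk_def)
    next
      case False
      then show ?thesis using Sk_fin[of k] epowr_neg_less_top[of "tail v (t k)" "- 1"]
        by (simp add: Q_def ennreal_mult_less_top zero_less_iff_neq_zero)
    qed
    \<comment> \<open>g is bounded by a finite sum of finite quotients, so the norm of f is finite
      before it is absorbed.\<close>
    define M where "M = (\<Sum>k\<in>A. Q k)"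
    have M: "M < top" unfolding M_def using Qfin finA by (simp add: less_top[symmetric])
    have gM: "g x \<le> M" for x
      unfolding g_def M_def using finA by (intro SUP_least member_le_sum) auto
    have "(\<Sum>k. sg k * f (y k) powe q) \<le> (\<Sum>k. sg k * M powe r)"
      unfolding fq using ex gM by (intro suminf_le mult_left_mono epowr_mono) auto
    also have "\<dots> = Sk 0 * M powe r" by (simp add: Sk_def ennreal_suminf_multc)
    also have "\<dots> < top" using M Sk_fin ex by (simp add: ennreal_mult_less_top)
    finally have "cW r * (\<Sum>k. sg k * f (y k) powe q) < top" using ex by (simp add: ennreal_mult_less_top)
    then show ?thesis using X by (rule le_less_trans[rotated])
  qed
  have "(\<Sum>k. sg k * f (y k) powe q) \<le> (\<Sum>k. om k * hardy_op f u (y (Suc k)) powe q)"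
  proof (intro suminf_le)
    fix k
    have "(f (y k) * Uk k) powe q \<le> hardy_op f u (y (Suc k)) powe q"
      unfolding Uk_def using q by (intro epowr_mono hardy_op_ge f u) auto
    then have "om k * (f (y k) * Uk k) powe q \<le> om k * hardy_op f u (y (Suc k)) powe q"
      by (rule mult_left_mono) simp
    then show "sg k * f (y k) powe q \<le> om k * hardy_op f u (y (Suc k)) powe q"
      using q by (simp add: sg_def epowr_mult mult_ac)
  qed auto
  also have "\<dots> \<le> cL q * (\<integral>\<^sup>+x. hardy_op f u x powe q * w x * indicator {y 0<..} x \<partial>lebesgue)"
    using q by (intro blocks_lower_Suc epowr_mono hardy_op_mono) auto
  also note restrict
  finally have Y: "(\<Sum>k. sg k * f (y k) powe q) \<le> cL q * ?L" .
  have L: "?L \<le> K * ?X powe (q / p)" by (intro hardy f Xfin)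
  have "?X \<le> cW r * (cL q * ?L)" using X Y by (meson mult_left_mono order_trans zero_le)
  also have "\<dots> \<le> cW r * (cL q * (K * ?X powe (q / p)))" by (intro mult_left_mono L) auto
  finally have "?X \<le> (cW r * cL q * K) powe (1 / (1 - q / p))"
    using Xfin ex by (intro epowr_absorb[where s = "q / p"]) (auto simp: mult.assoc)
  then have X2: "?X \<le> (cW r * cL q * K) powe (1 + r)" using ex by simp
  have "(\<Sum>k<n. om k * Sk k powe r * (seg u (t k) (y k) powe q * tail v (t k) powe (- r)))
    \<le> (\<Sum>k<n. om k * hardy_op f u (y k) powe q)"
  proof (intro sum_mono)
    fix k assume "k \<in> {..<n}"
    show "om k * Sk k powe r * (seg u (t k) (y k) powe q * tail v (t k) powe (- r)) \<le> om k * hardy_op f u (y k) powe q"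
    proof (cases "t k < y k")
      case True
      then have "k \<in> A" using \<open>k \<in> {..<n}\<close> by (simp add: A_def)
      then have "Q k \<le> g (t k)" unfolding g_def by (intro SUP_upper) auto
      have "om k * Sk k powe r * (seg u (t k) (y k) powe q * tail v (t k) powe (- r)) =
         om k * (Q k powe r * seg u (t k) (y k) powe q)"
        using ex by (simp add: Q_def epowr_mult epowr_epowr mult_ac)
      also have "\<dots> \<le> om k * (f (t k) powe q * seg u (t k) (y k) powe q)"
        unfolding fq using \<open>Q k \<le> g (t k)\<close> ex by (intro mult_left_mono mult_right_mono epowr_mono) auto
      also have "\<dots> = om k * (f (t k) * seg u (t k) (y k)) powe q" using q by (simp add: epowr_mult)
      also have "\<dots> \<le> om k * hardy_op f u (y k) powe q"
        using q by (intro mult_left_mono epowr_mono hardy_op_ge f u) auto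
      finally show ?thesis .
    qed (use q in simp)
  qed
  also have "\<dots> \<le> (\<Sum>k. om k * hardy_op f u (y k) powe q)" by (intro sum_le_suminf) auto
  also have "\<dots> \<le> cL q * (\<integral>\<^sup>+x. hardy_op f u x powe q * w x * indicator {y 0<..} x \<partial>lebesgue)"
    using q by (intro blocks_lower_cL epowr_mono hardy_op_mono) auto
  also note restrict
  also have "cL q * ?L \<le> cL q * (K * ((cW r * cL q * K) powe (1 + r)) powe (q / p))"
    using ex X2 by (intro order_trans[OF mult_left_mono[OF L]] mult_left_mono epowr_mono) auto
  also have "\<dots> = cL q * (K * (cW r * cL q * K) powe r)" using ex by (simp only: epowr_epowr)
  also have "\<dots> = cN2 q r * K powe (1 + r)" using ex by (simp add: cN2_def epowr_mult epowr_add mult_ac)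
  finally show ?thesis .
qed

lemma sum_sup_quotient_le: "(\<Sum>k. om k * Sk k powe r * sup_quotient q r u v (y k)) \<le> cN2 q r * K powe (1 + r)"
proof (intro suminf_le_const)
  fix n
  have "(\<Sum>k<n. om k * Sk k powe r * sup_quotient q r u v (y k)) =
    (\<Sum>k<n. SUP t. om k * Sk k powe r * (seg u t (y k) powe q * tail v t powe (- r)))"
    unfolding sup_quotient_def by (simp add: SUP_mult_left_ennreal)
  also have "\<dots> \<le> cN2 q r * K powe (1 + r)"
    by (rule sum_SUP_le) (auto intro: test_maximal_le)
  finally show "(\<Sum>k<n. om k * Sk k powe r * sup_quotient q r u v (y k)) \<le> cN2 q r * K powe (1 + r)" .
qed auto

text \<open>Within a block, \<open>kernel_tail\<close> is not controlled by its value at the right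
  end z. The excess, which involves \<open>seg u x z\<close>, combines with the supremum of
  quotients into a power of \<open>dual_norm\<close> at z and is covered by
  \<open>sum_dual_norm_le\<close>; what remains is the discrete sum of
  \<open>sum_sup_quotient_le\<close>.\<close>

lemma kernel_integral_le:
  "(\<integral>\<^sup>+x. kernel_tail q u w x powe r * sup_quotient q r u v x * w x * indicator {y 0<..} x \<partial>lebesgue)
    \<le> cN3 q r * K powe (1 + r)"
proof -
  note ex = exponents
  let ?c = "(2 powe q * 2) powe r"
  let ?N = "\<lambda>x. kernel_tail q u w x"
  let ?P = "sup_quotient q r u v"
  define e where "e k = ?c * (om k powe r * dual_norm p u v (y (Suc k)) powe (p * r) + ?N (y (Suc k)) powe r * ?P (y (Suc k)))" for k
  have "(\<integral>\<^sup>+x. (?N x powe r * ?P x) * w x * indicator {y 0<..} x \<partial>lebesgue) \<le> (\<Sum>k. om k * e k)"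
  proof (rule blocks_upper)
    fix k x assume x: "x \<in> block k"
    let ?z = "y (Suc k)"
    \<comment> \<open>For t < x both integrals of u are at most \<open>seg u t z\<close> with z = y
      (k + 1), and the exponents q r and q add up to p r.\<close>
    have PA: "seg u x ?z powe (q * r) * ?P x \<le> dual_norm p u v ?z powe (p * r)"
    proof -
      have "seg u x ?z powe (q * r) * ?P x = (SUP t. seg u x ?z powe (q * r) * (seg u t x powe q * tail v t powe (- r)))"
        unfolding sup_quotient_def by (simp add: SUP_mult_left_ennreal)
      also have "\<dots> \<le> dual_norm p u v ?z powe (p * r)"
      proof (rule SUP_least)
        fix t
        show "seg u x ?z powe (q * r) * (seg u t x powe q * tail v t powe (- r)) \<le> dual_norm p u v ?z powe (p * r)"
        proof (cases "t < x")
          case True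
          have a1: "seg u x ?z powe (q * r) \<le> seg u t ?z powe (q * r)" and a2: "seg u t x powe q \<le> seg u t ?z powe q"
            using True x q mult_nonneg_nonneg[OF less_imp_le[OF q] less_imp_le[OF ex(2)]]
            by (auto intro!: epowr_mono seg_mono)
          have "seg u x ?z powe (q * r) * (seg u t x powe q * tail v t powe (- r))
             \<le> seg u t ?z powe (q * r) * (seg u t ?z powe q * tail v t powe (- r))"
            by (rule mult_mono[OF a1 mult_right_mono[OF a2]]) auto
          also have "\<dots> = seg u t ?z powe (p * r) * tail v t powe (- r)"
          proof -
            have "p * r = q * r + q" using ex(3) by (simp add: algebra_simps)
            then have "seg u t ?z powe (p * r) = seg u t ?z powe (q * r) * seg u t ?z powe q"
              using q ex(2) epowr_add[of "q * r" q "seg u t ?z"] by simp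
            then show ?thesis by (simp add: mult_ac)
          qed
          also have "\<dots> = (seg u t ?z * tail v t powe (- (1 / p))) powe (p * r)"
            using ex by (simp add: epowr_mult epowr_epowr)
          also have "\<dots> \<le> dual_norm p u v ?z powe (p * r)"
            using ex V0 by (intro epowr_mono seg_le_dual_norm) auto
          finally show ?thesis .
        qed (use q in simp)
      qed
      finally show ?thesis .
    qed
    have tw: "tail w x \<le> om k" unfolding om_def tail_y[symmetric] using x by (intro tail_antimono) auto
    have "?N x \<le> 2 powe q * (seg u x ?z powe q * tail w x + ?N ?z)"
      using x by (intro kernel_tail_le q u w) auto
    also have "\<dots> \<le> 2 powe q * (seg u x ?z powe q * om k + ?N ?z)"
      using tw by (intro mult_left_mono add_mono) auto
    finally have "?N x powe r \<le> (2 powe q * (seg u x ?z powe q * om k + ?N ?z)) powe r"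
      using ex by (intro epowr_mono) auto
    also have "\<dots> \<le> (2 powe q) powe r * (2 powe r * ((seg u x ?z powe q * om k) powe r + ?N ?z powe r))"
      using ex by (subst epowr_mult) (auto intro!: mult_left_mono epowr_add_le)
    also have "\<dots> = ?c * (om k powe r * seg u x ?z powe (q * r) + ?N ?z powe r)"
      using ex by (simp add: epowr_mult epowr_epowr mult_ac)
    finally have "?N x powe r * ?P x \<le> ?c * (om k powe r * seg u x ?z powe (q * r) + ?N ?z powe r) * ?P x"
      by (rule mult_right_mono) simp
    also have "\<dots> = ?c * (om k powe r * (seg u x ?z powe (q * r) * ?P x) + ?N ?z powe r * ?P x)"
      by (simp add: algebra_simps)
    also have "\<dots> \<le> e k"
      unfolding e_def using x
      by (intro mult_left_mono add_mono PA monoD[OF mono_sup_quotient[OF q]]) auto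
    finally show "?N x powe r * ?P x \<le> e k" .
  qed
  also have "\<dots> = ?c * ((\<Sum>k. om k powe (1 + r) * dual_norm p u v (y (Suc k)) powe (p * r)) +
      (\<Sum>k. om k * (?N (y (Suc k)) powe r * ?P (y (Suc k)))))"
  proof -
    have "om k * e k = ?c * (om k powe (1 + r) * dual_norm p u v (y (Suc k)) powe (p * r) +
        om k * (?N (y (Suc k)) powe r * ?P (y (Suc k))))" for k
      unfolding e_def using ex by (simp add: epowr_add algebra_simps)
    then show ?thesis by (simp add: ennreal_suminf_cmult suminf_add[symmetric])
  qed
  also have "\<dots> \<le> ?c * (cN1 q r * K powe (1 + r) + (2 * 2 powe q) powe r * ennreal (1 / th q) * (cN2 q r * K powe (1 + r)))"
  proof (intro mult_left_mono add_mono sum_dual_norm_le)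
    have "(\<Sum>k. om k * (?N (y (Suc k)) powe r * ?P (y (Suc k)))) \<le>
      (\<Sum>k. (2 * 2 powe q) powe r * ennreal (1 / th q) * (om (Suc k) * Sk (Suc k) powe r * ?P (y (Suc k))))"
    proof (intro suminf_le)
      fix k
      have "?N (y (Suc k)) powe r \<le> (2 * 2 powe q * Sk (Suc k)) powe r"
        using ex by (intro epowr_mono kernel_tail_le_Sk) auto
      also have "\<dots> = (2 * 2 powe q) powe r * Sk (Suc k) powe r" using ex by (simp add: epowr_mult)
      finally have "om k * (?N (y (Suc k)) powe r * ?P (y (Suc k))) \<le>
        (ennreal (1 / th q) * om (Suc k)) * (((2 * 2 powe q) powe r * Sk (Suc k) powe r) * ?P (y (Suc k)))"
        by (intro mult_mono om_le mult_right_mono) auto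
      then show "om k * (?N (y (Suc k)) powe r * ?P (y (Suc k))) \<le>
        (2 * 2 powe q) powe r * ennreal (1 / th q) * (om (Suc k) * Sk (Suc k) powe r * ?P (y (Suc k)))"
        by (simp add: mult_ac)
    qed auto
    also have "\<dots> = (2 * 2 powe q) powe r * ennreal (1 / th q) * (\<Sum>k. om (Suc k) * Sk (Suc k) powe r * ?P (y (Suc k)))"
      by (rule ennreal_suminf_cmult)
    also have "(\<Sum>k. om (Suc k) * Sk (Suc k) powe r * ?P (y (Suc k))) \<le> (\<Sum>k. om k * Sk k powe r * ?P (y k))"
    proof -
      have "(\<Sum>k. om (Suc k) * Sk (Suc k) powe r * ?P (y (Suc k))) =
        (\<integral>\<^sup>+j. om j * Sk j powe r * ?P (y j) * indicator {1..} j \<partial>count_space UNIV)"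
        by (subst suminf_shift_count_space) simp
      also have "\<dots> \<le> (\<integral>\<^sup>+j. om j * Sk j powe r * ?P (y j) \<partial>count_space UNIV)"
        by (intro nn_integral_mono) (auto split: split_indicator)
      finally show ?thesis by (simp add: nn_integral_count_space_nat)
    qed
    also have "\<dots> \<le> cN2 q r * K powe (1 + r)" by (rule sum_sup_quotient_le)
    finally show "(\<Sum>k. om k * (?N (y (Suc k)) powe r * ?P (y (Suc k)))) \<le>
      (2 * 2 powe q) powe r * ennreal (1 / th q) * (cN2 q r * K powe (1 + r))"
      by (simp add: mult_left_mono)
  qed auto
  also have "\<dots> = cN3 q r * K powe (1 + r)" by (simp add: cN3_def algebra_simps)
  finally show ?thesis .
qed

end

end

end

section \<open>Truncation\<close>

lemma nn_integral_limit:
  fixes F :: "nat \<Rightarrow> 'a \<Rightarrow> ennreal"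
  assumes "\<And>n. F n \<in> borel_measurable M" and "\<And>x. incseq (\<lambda>n. F n x)"
    and "\<And>x. (SUP n. F n x) = G x"
  shows "(SUP n. \<integral>\<^sup>+x. F n x \<partial>M) = (\<integral>\<^sup>+x. G x \<partial>M)"
  using nn_integral_monotone_convergence_SUP[of F M] assms by (simp add: incseq_def le_fun_def)

lemma nn_integral_limit_le:
  fixes F :: "nat \<Rightarrow> 'a \<Rightarrow> ennreal"
  assumes "\<And>n. F n \<in> borel_measurable M" and "\<And>x. incseq (\<lambda>n. F n x)"
    and "\<And>x. (SUP n. F n x) = G x" and "\<And>n. (\<integral>\<^sup>+x. F n x \<partial>M) \<le> C"
  shows "(\<integral>\<^sup>+x. G x \<partial>M) \<le> C"
  unfolding nn_integral_limit[OF assms(1-3), symmetric] by (rule SUP_least) (rule assms(4))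

lemma SUP_mult_incseq:
  fixes f g :: "nat \<Rightarrow> ennreal"
  assumes "incseq f" "incseq g"
  shows "(SUP n. f n * g n) = (SUP n. f n) * (SUP n. g n)"
proof (rule antisym)
  show "(SUP n. f n * g n) \<le> (SUP n. f n) * (SUP n. g n)"
    by (intro SUP_least mult_mono) (auto intro: SUP_upper)
  have "(SUP n. f n) * (SUP n. g n) = (SUP m. SUP n. f n * g m)"
    by (simp add: SUP_mult_left_ennreal SUP_mult_right_ennreal)
  also have "\<dots> \<le> (SUP n. f n * g n)"
  proof (intro SUP_least)
    fix m n
    have "f n * g m \<le> f (max m n) * g (max m n)"
      using assms by (intro mult_mono) (auto simp: incseq_def)
    also have "\<dots> \<le> (SUP n. f n * g n)" by (rule SUP_upper) simp
    finally show "f n * g m \<le> (SUP n. f n * g n)" .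
  qed
  finally show "(SUP n. f n) * (SUP n. g n) \<le> (SUP n. f n * g n)" .
qed

lemma incseq_mult_ennreal: "incseq f \<Longrightarrow> incseq g \<Longrightarrow> incseq (\<lambda>n. f n * g n :: ennreal)"
  unfolding incseq_def by (auto intro: mult_mono)

lemma incseq_epowr: "incseq f \<Longrightarrow> 0 \<le> r \<Longrightarrow> incseq (\<lambda>n. f n powe r)"
  unfolding incseq_def by (auto intro: epowr_mono)

lemma incseq_nn_integral:
  "(\<And>x. incseq (\<lambda>n. F n x)) \<Longrightarrow> incseq (\<lambda>n. \<integral>\<^sup>+x. F n x \<partial>M)"
  unfolding incseq_def by (auto intro: nn_integral_mono)

lemma seg_mono_fun: "(\<And>s. u s \<le> u' s) \<Longrightarrow> seg u t x \<le> seg u' t x"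
  unfolding seg_def by (intro nn_integral_mono mult_right_mono) auto

lemma tail_mono_fun: "(\<And>s. u s \<le> u' s) \<Longrightarrow> tail u t \<le> tail u' t"
  unfolding tail_def by (intro nn_integral_mono mult_right_mono) auto

lemma hardy_op_mono_weight: "(\<And>s. u s \<le> u' s) \<Longrightarrow> hardy_op f u x \<le> hardy_op f u' x"
  unfolding hardy_op_def by (intro nn_integral_mono mult_right_mono mult_left_mono) auto

lemma kernel_tail_mono_fun:
  "0 \<le> q \<Longrightarrow> (\<And>s. u s \<le> u' s) \<Longrightarrow> (\<And>s. w s \<le> w' s) \<Longrightarrow> kernel_tail q u w x \<le> kernel_tail q u' w' x"
  unfolding kernel_tail_def
  by (intro nn_integral_mono mult_right_mono mult_mono epowr_mono seg_mono_fun) auto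

text \<open>The weights are extended by zero outside the interval; \<open>al\<close> and \<open>be\<close> exhaust it from inside.\<close>

locale hardy_setting =
  fixes a b :: ereal and u v w :: "real \<Rightarrow> ennreal" and al be :: "nat \<Rightarrow> real"
  assumes ab: "a < b"
    and exhaust: "einterval a b = (\<Union>n. {al n..be n})" and al_dec: "decseq al" and be_inc: "incseq be"
    and a_al: "\<And>n. a < ereal (al n)" and be_b: "\<And>n. ereal (be n) < b"
    and u [measurable]: "u \<in> borel_measurable lebesgue"
    and v [measurable]: "v \<in> borel_measurable lebesgue"
    and w [measurable]: "w \<in> borel_measurable lebesgue"
    and zero: "\<And>x. x \<notin> einterval a b \<Longrightarrow> u x = 0" "\<And>x. x \<notin> einterval a b \<Longrightarrow> w x = 0"
    and v_pos: "\<And>x. x \<in> einterval a b \<Longrightarrow> 0 < v x"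
    and fin: "\<And>x. u x < top" "\<And>x. w x < top"
begin

text \<open>Makes u and w bounded with compact support inside the interval, hence integrable. It is
  never applied to v, so norms of f on the right-hand side are unaffected.\<close>

definition tr :: "nat \<Rightarrow> (real \<Rightarrow> ennreal) \<Rightarrow> real \<Rightarrow> ennreal" where
  "tr n h x = min (h x) (of_nat n) * indicator {al n..be n} x"

lemma tr_le: "tr n h x \<le> h x"
  unfolding tr_def by (auto split: split_indicator)

lemma tr_measurable [measurable]: "h \<in> borel_measurable lebesgue \<Longrightarrow> tr n h \<in> borel_measurable lebesgue"
proof -
  assume [measurable]: "h \<in> borel_measurable lebesgue"
  have [measurable]: "{al n..be n} \<in> sets lebesgue" by simp
  show ?thesis unfolding tr_def[abs_def] by measurable
qed

lemma tr_incseq: "incseq (\<lambda>n. tr n h x)"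
proof (rule incseq_SucI)
  fix n
  have "{al n..be n} \<subseteq> {al (Suc n)..be (Suc n)}"
    using decseqD[OF al_dec, of n "Suc n"] incseqD[OF be_inc, of n "Suc n"] by auto
  then show "tr n h x \<le> tr (Suc n) h x"
    unfolding tr_def by (intro mult_mono min.mono) (auto split: split_indicator)
qed

text \<open>The exhaustion only gives al n <= x. Applying it to a point s of the interval to the
  left of x makes the inequality strict, as the open half-lines in \<open>cut\<close>
  require.\<close>

lemma above_al:
  assumes "x \<in> einterval a b" shows "\<exists>n. \<forall>m\<ge>n. al m < x \<and> x \<le> be m"
proof -
  obtain s where s: "a < ereal s" "s < x"
    using assms ereal_dense2[of a "ereal x"] by (auto simp: einterval_iff)
  then have "ereal s < b" using assms by (auto simp: einterval_iff intro: less_trans[of "ereal s" "ereal x"])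
  then have "s \<in> einterval a b" using s by (simp add: einterval_iff)
  then obtain i where i: "al i \<le> s" using exhaust by auto
  obtain j where j: "x \<le> be j" using assms exhaust by auto
  show ?thesis
  proof (intro exI[of _ "max i j"] allI impI)
    fix m assume "max i j \<le> m"
    then have "al m \<le> al i" "be j \<le> be m" using al_dec be_inc by (auto simp: decseq_def incseq_def)
    then show "al m < x \<and> x \<le> be m" using i j s by auto
  qed
qed

lemma tr_SUP:
  assumes "x \<notin> einterval a b \<Longrightarrow> h x = 0" "h x < top"
  shows "(SUP n. tr n h x) = h x"
proof (cases "x \<in> einterval a b")
  case True
  obtain n where n: "\<And>m. m \<ge> n \<Longrightarrow> al m < x \<and> x \<le> be m" using above_al[OF True] by blast
  obtain k where k: "h x < of_nat k" using ennreal_Ex_less_of_nat[OF assms(2)] by blast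
  have "h x \<le> of_nat (max n k)" using k by (auto intro: order_trans less_imp_le simp: of_nat_max le_max_iff_disj)
  then have "h x = tr (max n k) h x" using n[of "max n k"] by (simp add: tr_def min_absorb1)
  then have "h x \<le> (SUP n. tr n h x)" by (metis SUP_upper UNIV_I)
  moreover have "(SUP n. tr n h x) \<le> h x" by (intro SUP_least tr_le)
  ultimately show ?thesis by (rule antisym[rotated])
next
  case False
  then have "h x = 0" by (rule assms(1))
  then have "tr n h x = 0" for n using tr_le[of n h x] by simp
  then show ?thesis using \<open>h x = 0\<close> by simp
qed

lemma tr_u: "(SUP n. tr n u x) = u x" and tr_w: "(SUP n. tr n w x) = w x"
  using zero fin by (auto intro!: tr_SUP)

lemma tr_finite: "(\<integral>\<^sup>+x. tr n h x \<partial>lebesgue) < top"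
proof -
  have "(\<integral>\<^sup>+x. tr n h x \<partial>lebesgue) \<le> (\<integral>\<^sup>+x. of_nat n * indicator {al n..be n} x \<partial>lebesgue)"
    unfolding tr_def by (intro nn_integral_mono mult_right_mono) auto
  also have "\<dots> = of_nat n * emeasure lebesgue {al n..be n}" by (rule nn_integral_cmult_indicator) simp
  also have "\<dots> < top" by (cases "al n \<le> be n") (auto simp: ennreal_mult_less_top emeasure_lborel_Icc_eq of_nat_less_top)
  finally show ?thesis .
qed

text \<open>The half-line is open, so the cut function vanishes at al n itself. This is the
  condition f (y 0) = 0 for blocks starting at y 0 = al n.\<close>

definition cut :: "nat \<Rightarrow> (real \<Rightarrow> ennreal) \<Rightarrow> real \<Rightarrow> ennreal" where
  "cut n f x = f x * indicator {al n<..} x"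

lemma cut_le: "cut n f x \<le> f x"
  unfolding cut_def by (auto split: split_indicator)

lemma mono_cut: "mono f \<Longrightarrow> mono (cut n f)"
  unfolding cut_def by (intro monoI) (auto dest: monoD split: split_indicator)

lemma cut_incseq: "incseq (\<lambda>n. cut n f x)"
proof (rule incseq_SucI)
  fix n
  show "cut n f x \<le> cut (Suc n) f x"
    using decseqD[OF al_dec, of n "Suc n"] unfolding cut_def
    by (intro mult_left_mono) (auto split: split_indicator)
qed

lemma cut_SUP: "x \<in> einterval a b \<Longrightarrow> (SUP n. cut n f x) = f x"
proof (rule antisym)
  assume "x \<in> einterval a b"
  then obtain n where "al n < x" using above_al by blast
  then have "f x = cut n f x" by (simp add: cut_def)
  then show "f x \<le> (SUP n. cut n f x)" by (metis SUP_upper UNIV_I)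
qed (intro SUP_least cut_le)

lemma seg_incseq: "incseq (\<lambda>n. seg (tr n u) t x)"
  unfolding seg_def using tr_incseq by (intro incseq_nn_integral incseq_mult_ennreal) auto

lemma seg_SUP: "(SUP n. seg (tr n u) t x) = seg u t x"
  unfolding seg_def using tr_incseq
  by (intro nn_integral_limit incseq_mult_ennreal) (auto simp: SUP_mult_right_ennreal[symmetric] tr_u)

lemma tail_incseq: "incseq (\<lambda>n. tail (tr n w) x)"
  unfolding tail_def using tr_incseq by (intro incseq_nn_integral incseq_mult_ennreal) auto

lemma tail_SUP: "(SUP n. tail (tr n w) x) = tail w x"
  unfolding tail_def using tr_incseq
  by (intro nn_integral_limit incseq_mult_ennreal) (auto simp: SUP_mult_right_ennreal[symmetric] tr_w)

lemma hardy_op_incseq: "incseq (\<lambda>n. hardy_op f (tr n u) x)"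
  unfolding hardy_op_def using tr_incseq by (intro incseq_nn_integral incseq_mult_ennreal) auto

lemma hardy_op_SUP:
  assumes "mono f" shows "(SUP n. hardy_op f (tr n u) x) = hardy_op f u x"
  unfolding hardy_op_def
proof (intro nn_integral_limit incseq_mult_ennreal tr_incseq)
  note [measurable] = borel_measurable_mono_lebesgue[OF assms]
  show "(\<lambda>s. f s * tr n u s * indicator {..<x} s) \<in> borel_measurable lebesgue" for n by measurable
qed (auto simp: SUP_mult_right_ennreal[symmetric] SUP_mult_left_ennreal[symmetric] tr_u)

lemma hardy_op_cut_incseq: "incseq (\<lambda>n. hardy_op (cut n f) (tr n u) x)"
  unfolding hardy_op_def using tr_incseq cut_incseq by (intro incseq_nn_integral incseq_mult_ennreal) auto

lemma hardy_op_cut_SUP: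
  assumes "mono f" shows "(SUP n. hardy_op (cut n f) (tr n u) x) = hardy_op f u x"
  unfolding hardy_op_def
proof (intro nn_integral_limit incseq_mult_ennreal tr_incseq cut_incseq)
  note [measurable] = borel_measurable_mono_lebesgue[OF mono_cut[OF assms]]
  show "(\<lambda>s. cut n f s * tr n u s * indicator {..<x} s) \<in> borel_measurable lebesgue" for n by measurable
  show "(SUP n. cut n f s * tr n u s * indicator {..<x} s) = f s * u s * indicator {..<x} s" for s
    using zero(1)[of s] cut_SUP[of s f]
    by (cases "s \<in> einterval a b")
       (auto simp: SUP_mult_right_ennreal[symmetric] SUP_mult_incseq[OF cut_incseq tr_incseq] tr_u)
qed auto

lemma mono_imp_seg_measurable [measurable]: "(\<lambda>s. seg h x s) \<in> borel_measurable lebesgue"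
  by (intro borel_measurable_mono_lebesgue monoI seg_mono) auto

lemma antimono_imp_seg_measurable [measurable]: "(\<lambda>s. seg h s x) \<in> borel_measurable lebesgue"
  by (intro borel_measurable_antimono_lebesgue antimonoI seg_mono) auto

lemma tail_measurable [measurable]: "(\<lambda>s. tail h s) \<in> borel_measurable lebesgue"
  by (intro borel_measurable_antimono_lebesgue antimonoI tail_antimono) auto

lemma hardy_op_measurable [measurable]: "(\<lambda>x. hardy_op f h x) \<in> borel_measurable lebesgue"
  by (intro borel_measurable_mono_lebesgue monoI hardy_op_mono) auto

lemma dual_norm_measurable [measurable]: "(\<lambda>x. dual_norm p h h' x) \<in> borel_measurable lebesgue"
  using mono_dual_norm[of p h h'] by (intro borel_measurable_mono_lebesgue) (simp add: mono_def)

lemma kernel_tail_measurable: "0 < q \<Longrightarrow> (\<lambda>x. kernel_tail q h h' x) \<in> borel_measurable lebesgue"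
  by (intro borel_measurable_antimono_lebesgue antimonoI kernel_tail_antimono) auto

lemma sup_quotient_measurable: "0 < q \<Longrightarrow> (\<lambda>x. sup_quotient q r h h' x) \<in> borel_measurable lebesgue"
  using mono_sup_quotient[of q r h h'] by (intro borel_measurable_mono_lebesgue) (simp add: mono_def)

lemma kernel_tail_incseq: "0 \<le> q \<Longrightarrow> incseq (\<lambda>n. kernel_tail q (tr n u) (tr n w) x)"
  unfolding kernel_tail_def using tr_incseq seg_incseq
  by (intro incseq_nn_integral incseq_mult_ennreal incseq_epowr) auto

lemma kernel_tail_SUP:
  assumes "0 < q" shows "(SUP n. kernel_tail q (tr n u) (tr n w) x) = kernel_tail q u w x"
  unfolding kernel_tail_def
proof (intro nn_integral_limit)
  show "incseq (\<lambda>n. tr n w s * seg (tr n u) x s powe q * indicator {x<..} s)" for s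
    using tr_incseq seg_incseq assms by (intro incseq_mult_ennreal incseq_epowr) auto
  show "(SUP n. tr n w s * seg (tr n u) x s powe q * indicator {x<..} s) = w s * seg u x s powe q * indicator {x<..} s" for s
    using SUP_mult_incseq[OF tr_incseq incseq_epowr[OF seg_incseq], of q w s x s] assms
    by (simp add: SUP_mult_right_ennreal[symmetric] tr_w epowr_SUP[symmetric] seg_SUP)
qed measurable

lemma dual_norm_incseq: "incseq (\<lambda>n. dual_norm p (tr n u) v x)"
  unfolding dual_norm_def using hardy_op_incseq unfolding incseq_def by (auto intro!: SUP_mono')

lemma dual_norm_SUP: "(SUP n. dual_norm p (tr n u) v x) = dual_norm p u v x"
  unfolding dual_norm_def by (subst SUP_commute) (auto intro!: SUP_cong hardy_op_SUP)

lemma sup_quotient_incseq: "0 \<le> q \<Longrightarrow> incseq (\<lambda>n. sup_quotient q r (tr n u) v x)"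
  unfolding sup_quotient_def using seg_incseq unfolding incseq_def
  by (auto intro!: SUP_mono' mult_right_mono epowr_mono)

lemma sup_quotient_SUP: "0 < q \<Longrightarrow> (SUP n. sup_quotient q r (tr n u) v x) = sup_quotient q r u v x"
  unfolding sup_quotient_def
  by (subst SUP_commute) (auto intro!: SUP_cong simp: SUP_mult_right_ennreal[symmetric] epowr_SUP[symmetric] seg_SUP)

lemma tail_v_pos:
  assumes "ereal t < b" shows "0 < tail v t"
proof (rule ccontr)
  assume "\<not> 0 < tail v t"
  then have "AE s in lebesgue. v s * indicator {t<..} s = 0"
    unfolding tail_def by (subst (asm) not_less, subst (asm) le_zero_eq, subst (asm) nn_integral_0_iff_AE) auto
  moreover obtain c where c: "max a (ereal t) < ereal c" "ereal c < b"
    using ereal_dense2[of "max a (ereal t)" b] assms ab by auto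
  then obtain d where d: "ereal c < ereal d" "ereal d < b" using ereal_dense2[of "ereal c" b] by auto
  have "v s * indicator {t<..} s \<noteq> 0" if "s \<in> {c<..<d}" for s
  proof -
    have "ereal c < ereal s" "ereal s < ereal d" using that by auto
    then have "a < ereal s" "ereal s < b" "t < s" using c d by (auto intro: less_trans simp: less_ereal.simps(1)[symmetric] simp del: less_ereal.simps)
    then show ?thesis using v_pos[of s] by (simp add: einterval_iff)
  qed
  ultimately have "AE s in lebesgue. s \<notin> {c<..<d}" by (auto elim!: eventually_mono)
  then have "emeasure lebesgue {c<..<d} = 0" by (subst (asm) AE_iff_measurable[of "{c<..<d}"]) auto
  then show False using d by simp
qed

text \<open>By positivity of v the tail can vanish only from b onwards, where u is 0. This
  discharges the compatibility condition of the embeddings for q < p.\<close>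

lemma tail_v_0: "tail v t = 0 \<Longrightarrow> seg u t x = 0"
proof -
  assume "tail v t = 0"
  then have "b \<le> ereal t" using tail_v_pos[of t] by (auto simp: not_less[symmetric])
  then have "u s * indicator {t<..<x} s = 0" for s
  proof (cases "t < s")
    case True
    then have "ereal t \<le> ereal s" by simp
    then have "b \<le> ereal s" using \<open>b \<le> ereal t\<close> by (rule order_trans[rotated])
    then have "s \<notin> einterval a b" by (simp add: einterval_iff not_less)
    then show ?thesis using zero(1) by simp
  qed simp
  then show ?thesis by (simp only: seg_def nn_integral_const mult_zero_left)
qed

lemma seg_tr_le: "seg (tr n u) t x \<le> seg u t x"
  by (intro seg_mono_fun tr_le)

lemma tail_v_0_tr: "tail v t = 0 \<Longrightarrow> seg (tr n u) t x = 0"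
  using seg_tr_le[of n t x] tail_v_0[of t x] by simp

lemma nn_integral_tr_al:
  "(\<integral>\<^sup>+x. h x * tr n w x * indicator {al n<..} x \<partial>lebesgue) = (\<integral>\<^sup>+x. h x * tr n w x \<partial>lebesgue)"
proof (rule nn_integral_cong_AE, use AE_lebesgue_neq[of "al n"] in eventually_elim)
  fix x assume "x \<noteq> al n"
  then show "h x * tr n w x * indicator {al n<..} x = h x * tr n w x"
    by (auto simp: tr_def split: split_indicator)
qed

lemma kernel_tail_tr_finite:
  assumes "0 < q" shows "kernel_tail q (tr n u) (tr n w) x < top"
proof -
  have "kernel_tail q (tr n u) (tr n w) x \<le> (\<integral>\<^sup>+s. tr n w s * (\<integral>\<^sup>+s. tr n u s \<partial>lebesgue) powe q \<partial>lebesgue)"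
    unfolding kernel_tail_def
  proof (intro nn_integral_mono)
    fix s
    have "seg (tr n u) x s \<le> (\<integral>\<^sup>+s. tr n u s \<partial>lebesgue)"
      unfolding seg_def by (intro nn_integral_mono) (auto split: split_indicator)
    then have "tr n w s * seg (tr n u) x s powe q \<le> tr n w s * (\<integral>\<^sup>+s. tr n u s \<partial>lebesgue) powe q"
      using assms by (intro mult_left_mono epowr_mono) auto
    then show "tr n w s * seg (tr n u) x s powe q * indicator {x<..} s \<le> tr n w s * (\<integral>\<^sup>+s. tr n u s \<partial>lebesgue) powe q"
      by (auto split: split_indicator)
  qed
  also have "\<dots> < top" using tr_finite assms by (simp add: nn_integral_multc ennreal_mult_less_top)
  finally show ?thesis .
qed

text \<open>Blocks need a finite positive total mass to the right of al n. Truncation makes it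
  finite, and if it is 0 every integral against the truncated weight vanishes.\<close>

lemma truncated_blocks:
  assumes q: "0 < q"
  obtains "\<And>h. (\<integral>\<^sup>+x. h x * tr n w x \<partial>lebesgue) = 0"
  | y \<omega> where "hardy_blocks (tr n w) y q \<omega> (tr n u)" "y 0 = al n" 
proof (cases "tail (tr n w) (al n)" rule: ennreal_cases3)
  case 1
  have "(\<integral>\<^sup>+x. 1 * tr n w x \<partial>lebesgue) = 0"
    unfolding nn_integral_tr_al[symmetric] using 1 by (simp add: tail_def)
  then have AE: "AE x in lebesgue. tr n w x = 0" by (simp add: nn_integral_0_iff_AE)
  have "(\<integral>\<^sup>+x. h x * tr n w x \<partial>lebesgue) = (\<integral>\<^sup>+x. 0 \<partial>(lebesgue :: real measure))" for h
    by (rule nn_integral_cong_AE, use AE in eventually_elim) simp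
  then show ?thesis using that(1) by simp
next
  case 2
  have "tail (tr n w) (al n) \<le> (\<integral>\<^sup>+x. tr n w x \<partial>lebesgue)"
    unfolding tail_def by (intro nn_integral_mono) (auto split: split_indicator)
  then show ?thesis using 2 tr_finite[of n w] by (simp add: top_unique)
next
  case (3 \<omega>)
  obtain y where y: "weight_blocks (tr n w) y q \<omega>" "y 0 = al n"
    using weight_blocks_exist[OF _ q 3] by (metis tr_measurable w)
  then have "hardy_blocks (tr n w) y q \<omega> (tr n u)"
    by (intro hardy_blocks.intro hardy_blocks_axioms.intro) auto
  then show ?thesis using that(2) y by blast
qed

lemma hardy_limit_le:
  assumes q: "0 < q" and f: "mono f"
    and le: "\<And>n. wint q (tr n w) (hardy_op (cut n f) (tr n u)) \<le> C"
  shows "wint q w (hardy_op f u) \<le> C"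
proof (rule nn_integral_limit_le[OF _ _ _ le])
  show "incseq (\<lambda>n. hardy_op (cut n f) (tr n u) x powe q * tr n w x)" for x
    using q by (intro incseq_mult_ennreal incseq_epowr hardy_op_cut_incseq tr_incseq) auto
  show "(SUP n. hardy_op (cut n f) (tr n u) x powe q * tr n w x) = hardy_op f u x powe q * w x" for x
    using SUP_mult_incseq[OF incseq_epowr[OF hardy_op_cut_incseq] tr_incseq, of q f x w x] q f
    by (simp add: epowr_SUP[symmetric] hardy_op_cut_SUP tr_w)
qed measurable

context
  fixes p q :: real and f :: "real \<Rightarrow> ennreal" and A :: "real \<Rightarrow> ennreal"
  assumes p: "0 < p" and q: "0 < q" and f: "mono f"
    and fin_f: "wint p v f < top"
    and A: "\<And>n x g. mono g \<Longrightarrow> wint p v g < top \<Longrightarrow>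
       hardy_op g (tr n u) x \<le> A x * wint p v g powe (1 / p)"
begin

lemma cut_integral_le: "wint p v (cut n f) \<le> wint p v f"
  using p by (intro nn_integral_mono mult_right_mono epowr_mono cut_le) auto

lemma setting_bound_le:
  assumes pq: "p \<le> q"
    and K1: "\<And>x. x \<in> einterval a b \<Longrightarrow> tail v x < top \<Longrightarrow> kernel_tail q u w x \<le> K1 * tail v x powe (q / p)"
    and K2: "\<And>x. x \<in> einterval a b \<Longrightarrow> tail w x * A x powe q \<le> K2"
  shows "wint q w (hardy_op f u)
    \<le> cS1 q p * ((K1 + K2) * wint p v f powe (q / p))"
proof (rule hardy_limit_le[OF q f])
  fix n
  show "wint q (tr n w) (hardy_op (cut n f) (tr n u))
    \<le> cS1 q p * ((K1 + K2) * wint p v f powe (q / p))"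
  proof (cases rule: truncated_blocks[OF q, of n])
    case 1
    then show ?thesis by simp
  next
    case (2 y \<omega>)
    interpret hb: hardy_blocks "tr n w" y q \<omega> "tr n u" by (rule 2)
    \<comment> \<open>To the right of the interval both tails vanish, so K1 and K2 have to be
      supplied only inside it.\<close>
    have w0: "tail w x = 0" "kernel_tail q u w x = 0" if "x \<notin> einterval a b" "a < ereal x" for x
    proof -
      have "w s = 0" if "x < s" for s
      proof -
        have "b \<le> ereal x" using \<open>x \<notin> einterval a b\<close> \<open>a < ereal x\<close> by (auto simp: einterval_iff)
        then have "b \<le> ereal s" using that by (meson ereal_less_eq(3) less_imp_le order_trans)
        then have "s \<notin> einterval a b" by (simp add: einterval_iff not_less)
        then show ?thesis by (rule zero(2))
      qed
      then have "w s * indicator {x<..} s = 0" "w s * seg u x s powe q * indicator {x<..} s = 0" for s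
        by (auto split: split_indicator)
      then show "tail w x = 0" "kernel_tail q u w x = 0" by (simp_all only: tail_def kernel_tail_def nn_integral_const mult_zero_left)
    qed
    have a_y: "a < ereal (y k)" for k
      using a_al[of n] hb.y_le[of 0 k] 2 by (metis ereal_less_eq(3) less_le_trans zero_le)
    have "wint q (tr n w) (hardy_op (cut n f) (tr n u))
      \<le> cS1 q p * ((K1 + K2) * wint p v (cut n f) powe (q / p))"
    proof (rule hb.hardy_bound_le[OF p pq mono_cut[OF f] _ v _ A])
      show "cut n f (y 0) = 0" by (simp add: cut_def 2)
      show "wint p v (cut n f) < top"
        using cut_integral_le fin_f by (rule le_less_trans)
      show "kernel_tail q (tr n u) (tr n w) (y k) \<le> K1 * tail v (y k) powe (q / p)" if "tail v (y k) < top" for k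
      proof -
        have "kernel_tail q (tr n u) (tr n w) (y k) \<le> kernel_tail q u w (y k)"
          using q by (intro kernel_tail_mono_fun tr_le) auto
        also have "\<dots> \<le> K1 * tail v (y k) powe (q / p)"
          using K1[OF _ that] w0(2)[OF _ a_y] by (cases "y k \<in> einterval a b") auto
        finally show ?thesis .
      qed
      show "tail (tr n w) (y (Suc k)) * A (y (Suc k)) powe q \<le> K2" for k
      proof -
        have "tail (tr n w) (y (Suc k)) * A (y (Suc k)) powe q \<le> tail w (y (Suc k)) * A (y (Suc k)) powe q"
          by (intro mult_right_mono tail_mono_fun tr_le) auto
        also have "\<dots> \<le> K2"
          using K2 w0(1)[OF _ a_y] by (cases "y (Suc k) \<in> einterval a b") auto
        finally show ?thesis .
      qed
    qed
    also have "\<dots> \<le> cS1 q p * ((K1 + K2) * wint p v f powe (q / p))"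
      using p q by (intro mult_left_mono epowr_mono cut_integral_le) auto
    finally show ?thesis .
  qed
qed

lemma setting_bound_gt:
  assumes pq: "q < p" and r_def: "r = q / (p - q)" and A_mono: "mono A"
    and \<Psi>: "\<And>t x. a < ereal t \<Longrightarrow> t < x \<Longrightarrow> seg u t x powe q * tail v t powe (- r) \<le> \<Psi> x" "mono \<Psi>"
  shows "wint q w (hardy_op f u)
    \<le> cS2 q p * (((\<integral>\<^sup>+x. tail w x powe r * A x powe (p * r) * w x \<partial>lebesgue) +
     (\<integral>\<^sup>+x. kernel_tail q u w x powe r * \<Psi> x * w x \<partial>lebesgue)) powe (1 - q / p) *
      wint p v f powe (q / p))"
    (is "_ \<le> cS2 q p * ((?D + ?E) powe _ * ?X powe _)")
proof (rule hardy_limit_le[OF q f])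
  fix n
  have r: "0 < r" using pq q by (simp add: r_def)
  let ?Dn = "\<integral>\<^sup>+x. tail (tr n w) x powe r * A x powe (p * r) * tr n w x \<partial>lebesgue"
  let ?En = "\<integral>\<^sup>+x. kernel_tail q (tr n u) (tr n w) x powe r * \<Psi> x * tr n w x \<partial>lebesgue"
  show "wint q (tr n w) (hardy_op (cut n f) (tr n u))
    \<le> cS2 q p * ((?D + ?E) powe (1 - q / p) * ?X powe (q / p))"
  proof (cases rule: truncated_blocks[OF q, of n])
    case 1
    then show ?thesis by simp
  next
    case (2 y \<omega>)
    interpret hb: hardy_blocks "tr n w" y q \<omega> "tr n u" by (rule 2)
    have "wint q (tr n w) (hardy_op (cut n f) (tr n u))
      \<le> cS2 q p * ((?Dn + ?En) powe (1 - q / p) * wint p v (cut n f) powe (q / p))"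
    proof (rule hb.hardy_bound_gt[OF pq r_def mono_cut[OF f] _ v _ A A_mono _ \<Psi>(2) tail_v_0_tr])
      show "cut n f (y 0) = 0" by (simp add: cut_def 2)
      show "wint p v (cut n f) < top"
        using cut_integral_le fin_f by (rule le_less_trans)
      show "kernel_tail q (tr n u) (tr n w) (y 0) < top" by (rule kernel_tail_tr_finite[OF q])
      show "seg (tr n u) t x powe q * tail v t powe (- r) \<le> \<Psi> x" if "y 0 \<le> t" "t < x" for t x
      proof -
        have "a < ereal t" using a_al[of n] that 2 by (metis ereal_less_eq(3) less_le_trans)
        then show ?thesis using \<Psi>(1)[OF _ that(2)] q
          by (meson order_trans mult_right_mono epowr_mono seg_tr_le less_imp_le zero_le)
      qed
    qed
    also have "\<dots> \<le> cS2 q p * ((?D + ?E) powe (1 - q / p) * ?X powe (q / p))"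
    proof (intro mult_left_mono mult_mono epowr_mono add_mono cut_integral_le nn_integral_mono)
      show "0 \<le> 1 - q / p" using pq p by simp
    qed (use p q r in \<open>auto intro!: tail_mono_fun kernel_tail_mono_fun tr_le\<close>)
    finally show ?thesis .
  qed
qed

end

section \<open>Necessity for q < p: the discrete bounds without truncation\<close>

context
  fixes p q r :: real and K :: ennreal
  assumes pq: "q < p" and q: "0 < q" and r_def: "r = q / (p - q)" and K: "K < top"
    and hardy: "\<And>g. mono g \<Longrightarrow> wint p v g < top \<Longrightarrow>
      wint q w (hardy_op g u) \<le> K * wint p v g powe (q / p)"
begin

lemma hardy_truncated:
  assumes "mono g" "wint p v g < top"
  shows "wint q (tr n w) (hardy_op g (tr n u)) \<le> K * wint p v g powe (q / p)"
  using q by (intro order_trans[OF _ hardy[OF assms]] nn_integral_mono mult_mono epowr_mono hardy_op_mono_weight tr_le) auto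

lemma setting_dual_norm_le:
  "(\<integral>\<^sup>+x. tail w x powe r * dual_norm p u v x powe (p * r) * w x \<partial>lebesgue) \<le> cN1 q r * K powe (1 + r)"
proof (rule nn_integral_limit_le)
  have r: "0 < r" "0 < p * r" using pq q by (simp_all add: r_def)
  let ?F = "\<lambda>n x. tail (tr n w) x powe r * dual_norm p (tr n u) v x powe (p * r) * tr n w x"
  show "?F n \<in> borel_measurable lebesgue" for n by measurable
  show "incseq (\<lambda>n. ?F n x)" for x
    using r by (intro incseq_mult_ennreal incseq_epowr tail_incseq dual_norm_incseq tr_incseq) auto
  have "(SUP n. ?F n x) = (SUP n. tail (tr n w) x powe r) * (SUP n. dual_norm p (tr n u) v x powe (p * r)) * (SUP n. tr n w x)" for x
    using r by (subst SUP_mult_incseq, intro incseq_mult_ennreal incseq_epowr tail_incseq dual_norm_incseq, simp_all add: tr_incseq,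
      subst SUP_mult_incseq, auto intro!: incseq_epowr tail_incseq dual_norm_incseq)
  then show "(SUP n. ?F n x) = tail w x powe r * dual_norm p u v x powe (p * r) * w x" for x
    using r by (simp add: epowr_SUP[symmetric] tail_SUP dual_norm_SUP tr_w)
  show "(\<integral>\<^sup>+x. ?F n x \<partial>lebesgue) \<le> cN1 q r * K powe (1 + r)" for n
  proof (cases rule: truncated_blocks[OF q, of n])
    case (2 y \<omega>)
    interpret hb: hardy_blocks "tr n w" y q \<omega> "tr n u" by (rule 2)
    show ?thesis
      using hb.dual_norm_integral_le[OF pq r_def v K hardy_truncated] unfolding 2 nn_integral_tr_al .
  qed simp
qed

lemma setting_kernel_le:
  "(\<integral>\<^sup>+x. kernel_tail q u w x powe r * sup_quotient q r u v x * w x \<partial>lebesgue) \<le> cN3 q r * K powe (1 + r)"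
proof (rule nn_integral_limit_le)
  have r: "0 < r" using pq q by (simp_all add: r_def)
  let ?F = "\<lambda>n x. kernel_tail q (tr n u) (tr n w) x powe r * sup_quotient q r (tr n u) v x * tr n w x"
  note [measurable] = kernel_tail_measurable[OF q] sup_quotient_measurable[OF q]
  show "?F n \<in> borel_measurable lebesgue" for n by measurable
  show "incseq (\<lambda>n. ?F n x)" for x
    using r q by (intro incseq_mult_ennreal incseq_epowr kernel_tail_incseq sup_quotient_incseq tr_incseq) auto
  have "(SUP n. ?F n x) = (SUP n. kernel_tail q (tr n u) (tr n w) x powe r) * (SUP n. sup_quotient q r (tr n u) v x) * (SUP n. tr n w x)" for x
    using r q by (subst SUP_mult_incseq, intro incseq_mult_ennreal incseq_epowr kernel_tail_incseq sup_quotient_incseq, simp_all add: tr_incseq,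
      subst SUP_mult_incseq, auto intro!: incseq_epowr kernel_tail_incseq sup_quotient_incseq)
  then show "(SUP n. ?F n x) = kernel_tail q u w x powe r * sup_quotient q r u v x * w x" for x
    using r q by (simp add: epowr_SUP[symmetric] kernel_tail_SUP sup_quotient_SUP tr_w)
  show "(\<integral>\<^sup>+x. ?F n x \<partial>lebesgue) \<le> cN3 q r * K powe (1 + r)" for n
  proof (cases rule: truncated_blocks[OF q, of n])
    case (2 y \<omega>)
    interpret hb: hardy_blocks "tr n w" y q \<omega> "tr n u" by (rule 2)
    show ?thesis
      using hb.kernel_integral_le[OF pq r_def v K hardy_truncated tail_v_0_tr kernel_tail_tr_finite[OF q]]
      unfolding 2 nn_integral_tr_al .
  qed simp
qed

end

end

section \<open>The quotients that occur in the constants, compared with the norm of the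
  functional\<close>

lemma incseq_multc_ennreal: "incseq f \<Longrightarrow> incseq (\<lambda>n. f n * c :: ennreal)"
  unfolding incseq_def by (auto intro: mult_right_mono)

context hardy_setting
begin

definition quot_sup :: "real \<Rightarrow> real \<Rightarrow> ennreal" where
  "quot_sup p x = (SUP t\<in>{t. a < ereal t}. seg u t x * tail v t powe (- (1 / p)))"

definition quot_int :: "real \<Rightarrow> real \<Rightarrow> ennreal" where
  "quot_int p x = (\<integral>\<^sup>+t. seg u t x powe (1 / (p - 1)) * u t * tail v t powe (- (1 / (p - 1))) * indicator {..<x} t \<partial>lebesgue)"

definition ker_sup :: "real \<Rightarrow> real \<Rightarrow> real \<Rightarrow> ennreal" where
  "ker_sup q r x = (SUP t\<in>{t. a < ereal t}. seg u t x powe q * tail v t powe (- r))"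

lemma mono_quot_sup: "mono (quot_sup p)"
  unfolding quot_sup_def by (intro monoI SUP_mono' mult_right_mono seg_mono) auto

lemma mono_ker_sup: "0 < q \<Longrightarrow> mono (ker_sup q r)"
  unfolding ker_sup_def by (intro monoI SUP_mono' mult_right_mono epowr_mono seg_mono) auto

lemma mono_quot_int:
  assumes "1 < p" shows "mono (quot_int p)"
  unfolding quot_int_def
proof (intro monoI nn_integral_mono)
  fix x y t :: real assume "x \<le> y"
  then have "seg u t x powe (1 / (p - 1)) \<le> seg u t y powe (1 / (p - 1))"
    using assms by (intro epowr_mono seg_mono) auto
  then have "seg u t x powe (1 / (p - 1)) * u t * tail v t powe - (1 / (p - 1)) \<le> seg u t y powe (1 / (p - 1)) * u t * tail v t powe - (1 / (p - 1))"
    by (intro mult_right_mono) auto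
  then show "seg u t x powe (1 / (p - 1)) * u t * tail v t powe - (1 / (p - 1)) * indicator {..<x} t
    \<le> seg u t y powe (1 / (p - 1)) * u t * tail v t powe - (1 / (p - 1)) * indicator {..<y} t"
    using \<open>x \<le> y\<close> by (auto split: split_indicator)
qed

lemma ker_sup_le: "ker_sup q r x \<le> sup_quotient q r u v x"
  unfolding ker_sup_def sup_quotient_def by (intro SUP_subset_mono) auto

lemma ker_sup_upper: "a < ereal t \<Longrightarrow> seg u t x powe q * tail v t powe (- r) \<le> ker_sup q r x"
  unfolding ker_sup_def by (rule SUP_upper) simp

lemma quot_sup_le_dual_norm: "0 < p \<Longrightarrow> quot_sup p x \<le> dual_norm p u v x"
  unfolding quot_sup_def by (intro SUP_least seg_le_dual_norm tail_v_0) auto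

text \<open>\<open>integral_quotient_le_dual_norm\<close> needs an integrable u and a tail of v
  bounded away from 0; both hold for the truncated u, and the bound survives the limit.\<close>

lemma quot_int_le_dual_norm:
  assumes p: "1 < p"
  shows "quot_int p x powe (1 - 1 / p) \<le> cW1 (1 / (p - 1)) powe (1 / p) * dual_norm p u v x"
proof -
  let ?r = "1 / (p - 1)"
  let ?F = "\<lambda>n t. seg (tr n u) t x powe ?r * tr n u t * tail v t powe (- ?r) * indicator {..<x} t"
  have r: "0 < ?r" using p by simp
  have s: "0 < 1 - 1 / p" using p by simp
  \<comment> \<open>The bound is solved for the integral itself, since the limit lemma speaks of
    integrals and not of their powers.\<close>
  let ?C = "(cW1 ?r powe (1 / p) * dual_norm p u v x) powe (1 / (1 - 1 / p))"
  have "quot_int p x \<le> ?C"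
    unfolding quot_int_def
  proof (rule nn_integral_limit_le)
    show "?F n \<in> borel_measurable lebesgue" for n by measurable
    show "incseq (\<lambda>n. ?F n t)" for t
      by (intro incseq_multc_ennreal incseq_mult_ennreal incseq_epowr seg_incseq tr_incseq less_imp_le[OF r])
    show "(SUP n. ?F n t) = seg u t x powe ?r * u t * tail v t powe (- ?r) * indicator {..<x} t" for t
      using SUP_mult_incseq[OF incseq_epowr[OF seg_incseq] tr_incseq, of ?r t x u t] r
      by (simp add: SUP_mult_right_ennreal[symmetric] epowr_SUP[symmetric] seg_SUP tr_u)
    show "(\<integral>\<^sup>+t. ?F n t \<partial>lebesgue) \<le> ?C" for n
    proof -
      have "(\<integral>\<^sup>+t. ?F n t \<partial>lebesgue) powe (1 - 1 / p) \<le> cW1 ?r powe (1 / p) * dual_norm p (tr n u) v x"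
      proof (rule integral_quotient_le_dual_norm[OF p])
        show "(\<integral>\<^sup>+s. tr n u s \<partial>lebesgue) < top" by (rule tr_finite)
        \<comment> \<open>This tail serves as \<delta>: where the tail of v is smaller, t lies
          beyond be n and the truncated u vanishes to its right.\<close>
        show "0 < tail v (be n)" using be_b by (rule tail_v_pos)
        fix t assume "tail v t < tail v (be n)"
        then have "be n < t" using tail_antimono[of t "be n" v] by (auto simp: not_le[symmetric])
        then have "tr n u s * indicator {t<..<x} s = 0" for s
          by (auto simp: tr_def split: split_indicator)
        then show "seg (tr n u) t x = 0" by (simp only: seg_def nn_integral_const mult_zero_left)
      qed measurable
      also have "\<dots> \<le> cW1 ?r powe (1 / p) * dual_norm p u v x"
        unfolding dual_norm_SUP[symmetric] by (intro mult_left_mono SUP_upper) auto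
      finally show ?thesis by (simp add: epowr_le_iff[OF s])
    qed
  qed
  then show ?thesis by (simp add: epowr_le_iff[OF s])
qed

lemma below_al: obtains t where "a < ereal t" "t < al n"
  using ereal_dense2[OF a_al[of n]] by auto

text \<open>\<open>quot_sup\<close> ranges over t > a only, but the embedding asks for all real t.
  Since the truncated u vanishes to the left of al n, a point t <= a can be replaced by one between
  a and al n, and this does not increase the tail of v.\<close>

lemma seg_tr_le_quot_sup:
  assumes p: "0 < p" and Vt: "tail v t < top"
  shows "seg (tr n u) t x \<le> quot_sup p x * tail v t powe (1 / p)"
proof -
  have *: "seg u t x \<le> quot_sup p x * tail v t powe (1 / p)" if "a < ereal t" "tail v t < top" for t
  proof (cases "tail v t = 0")
    case True
    then show ?thesis using tail_v_0 by simp
  next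
    case False
    have "seg u t x = seg u t x * tail v t powe (- (1 / p) + 1 / p)" by simp
    also have "\<dots> = seg u t x * tail v t powe (- (1 / p)) * tail v t powe (1 / p)"
      using False that by (subst epowr_add_finite) (auto simp: mult.assoc zero_less_iff_neq_zero)
    also have "\<dots> \<le> quot_sup p x * tail v t powe (1 / p)"
      unfolding quot_sup_def using that by (intro mult_right_mono SUP_upper) auto
    finally show ?thesis .
  qed
  show ?thesis
  proof (cases "a < ereal t")
    case True
    show ?thesis by (rule order_trans[OF seg_tr_le *[OF True Vt]])
  next
    case False
    obtain t' where t': "a < ereal t'" "t' < al n" by (rule below_al)
    then have "ereal t < ereal t'" using False by (auto simp only: not_less intro: le_less_trans)
    then have tt': "t < t'" by simp
    have V: "tail v t' \<le> tail v t" using tt' by (intro tail_antimono) simp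
    have "seg (tr n u) t x \<le> seg (tr n u) t' x"
      unfolding seg_def using t' by (intro nn_integral_mono) (auto simp: tr_def split: split_indicator)
    also have "\<dots> \<le> seg u t' x" by (rule seg_tr_le)
    also have "\<dots> \<le> quot_sup p x * tail v t' powe (1 / p)"
      using t' Vt V by (intro *) (auto intro: le_less_trans)
    also have "\<dots> \<le> quot_sup p x * tail v t powe (1 / p)"
      using p V by (intro mult_left_mono epowr_mono) auto
    finally show ?thesis .
  qed
qed

lemma hardy_op_le_quot_sup:
  assumes "0 < p" "p \<le> 1" "mono g" "wint p v g < top"
  shows "hardy_op g (tr n u) x \<le> cB1 p 1 * quot_sup p x * wint p v g powe (1 / p)"
  unfolding mult.assoc
  by (intro hardy_op_le_sup_quotient seg_tr_le_quot_sup assms) measurable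

lemma hardy_op_le_quot_int:
  assumes p: "1 < p" and g: "mono g" "wint p v g < top"
  shows "hardy_op g (tr n u) x \<le> cB2 p 1 * quot_int p x powe (1 - 1 / p) * wint p v g powe (1 / p)"
proof -
  have "hardy_op g (tr n u) x \<le> cB2 p 1 * ((\<integral>\<^sup>+t. seg (tr n u) t x powe (1 / (p - 1)) * tr n u t * tail v t powe (- (1 / (p - 1))) * indicator {..<x} t \<partial>lebesgue) powe (1 - 1 / p)
     * wint p v g powe (1 / p))"
  proof (rule hardy_op_le_integral_quotient[OF p g(1) tr_measurable[OF u] v g(2) _ tail_v_0_tr])
    show "seg (tr n u) t x < top" for t
    proof -
      have "seg (tr n u) t x \<le> (\<integral>\<^sup>+x. tr n u x \<partial>lebesgue)"
        unfolding seg_def by (intro nn_integral_mono) (auto split: split_indicator)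
      then show ?thesis using tr_finite by (rule le_less_trans)
    qed
  qed
  also have "\<dots> \<le> cB2 p 1 * (quot_int p x powe (1 - 1 / p) * wint p v g powe (1 / p))"
    unfolding quot_int_def using p
    by (intro mult_left_mono mult_right_mono epowr_mono nn_integral_mono mult_mono tr_le seg_tr_le) auto
  finally show ?thesis by (simp add: mult.assoc)
qed

lemma tail_mult_seg_le:
  assumes "0 < q" "t \<le> x" shows "tail w x * seg u t x powe q \<le> kernel_tail q u w t"
proof -
  have "tail w x * seg u t x powe q = (\<integral>\<^sup>+s. w s * indicator {x<..} s * seg u t x powe q \<partial>lebesgue)"
    unfolding tail_def by (rule nn_integral_multc[symmetric]) measurable
  also have "\<dots> \<le> kernel_tail q u w t"
    unfolding kernel_tail_def
  proof (intro nn_integral_mono)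
    fix s
    have "seg u t x powe q \<le> seg u t s powe q" if "x < s"
      using assms that by (intro epowr_mono seg_mono) auto
    then show "w s * indicator {x<..} s * seg u t x powe q \<le> w s * seg u t s powe q * indicator {t<..} s"
      using assms(2) by (auto split: split_indicator intro: mult_left_mono)
  qed
  finally show ?thesis .
qed

text \<open>For t < x, tail w x * seg u t x^q is at most \<open>kernel_tail\<close> at t, because
  \<open>seg u t\<close> grows to the right of x. So for p <= 1 the condition on increments already
  follows from the condition on the kernel, and \<open>C\<^sub>1\<close> alone suffices in the first
  case.\<close>

lemma tail_quot_sup_le:
  assumes p: "0 < p" "0 < q" and K: "\<And>x. x \<in> einterval a b \<Longrightarrow> tail v x < top \<Longrightarrow> kernel_tail q u w x \<le> K * tail v x powe (q / p)"
    and x: "x \<in> einterval a b"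
  shows "tail w x * quot_sup p x powe q \<le> K"
proof -
  have "tail w x * quot_sup p x powe q = (SUP t\<in>{t. a < ereal t}. tail w x * (seg u t x * tail v t powe (- (1 / p))) powe q)"
    unfolding quot_sup_def using p x
    by (subst epowr_SUP) (auto simp: SUP_mult_left_ennreal einterval_iff)
  also have "\<dots> \<le> K"
  proof (rule SUP_least)
    fix t assume "t \<in> {t. a < ereal t}"
    then have t: "a < ereal t" by simp
    show "tail w x * (seg u t x * tail v t powe (- (1 / p))) powe q \<le> K"
    proof (cases "t < x \<and> tail v t < top")
      case True
      then have "ereal t < ereal x" by simp
      then have tI: "t \<in> einterval a b" using t x by (auto simp: einterval_iff intro: less_trans[of "ereal t" "ereal x"])
      then have "0 < tail v t" by (intro tail_v_pos) (simp add: einterval_iff)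
      have "tail w x * (seg u t x * tail v t powe (- (1 / p))) powe q = tail w x * seg u t x powe q * tail v t powe (- (q / p))"
        using p by (simp add: epowr_mult epowr_epowr mult.assoc)
      also have "\<dots> \<le> K * tail v t powe (q / p) * tail v t powe (- (q / p))"
        using True p tI by (intro mult_right_mono order_trans[OF tail_mult_seg_le K]) auto
      also have "\<dots> = K * tail v t powe (q / p + - (q / p))"
        using True \<open>0 < tail v t\<close> by (subst epowr_add_finite) (auto simp: mult.assoc)
      finally show ?thesis by simp
    next
      case False
      then have z: "seg u t x * tail v t powe (- (1 / p)) = 0"
        using p by (auto simp: not_less top_unique)
      show ?thesis unfolding z using p by simp
    qed
  qed
  finally show ?thesis .
qed

section \<open>Necessity at a single point, used for p <= q\<close>

context
  fixes p q :: real and K :: ennreal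
  assumes p: "0 < p" and q: "0 < q"
    and hardy: "\<And>g. mono g \<Longrightarrow> wint p v g < top \<Longrightarrow>
      wint q w (hardy_op g u) \<le> K * wint p v g powe (q / p)"
begin

lemma kernel_tail_necessary:
  assumes "tail v t < top" shows "kernel_tail q u w t \<le> K * tail v t powe (q / p)"
proof -
  let ?g = "indicator {t<..} :: real \<Rightarrow> ennreal"
  have g: "mono ?g" by (intro monoI) (auto split: split_indicator)
  have gX: "wint p v ?g = tail v t"
    unfolding tail_def using p by (intro nn_integral_cong) (auto split: split_indicator)
  have H: "hardy_op ?g u x = seg u t x" for x
    unfolding seg_def hardy_op_def by (intro nn_integral_cong) (auto split: split_indicator)
  have "kernel_tail q u w t \<le> wint q w (hardy_op ?g u)"
    unfolding kernel_tail_def H by (intro nn_integral_mono) (auto split: split_indicator simp: mult.commute)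
  also have "\<dots> \<le> K * tail v t powe (q / p)" using hardy[OF g] assms unfolding gX .
  finally show ?thesis .
qed

lemma dual_norm_necessary: "tail w x * dual_norm p u v x powe q \<le> K"
proof -
  let ?S = "{g. mono g \<and> wint p v g \<le> 1}"
  have S: "?S \<noteq> {}" using zero_in_dual_ball[OF p, of v] by blast
  have "tail w x * dual_norm p u v x powe q = (SUP g\<in>?S. tail w x * hardy_op g u x powe q)"
    unfolding dual_norm_def using q S by (subst epowr_SUP) (auto simp: SUP_mult_left_ennreal)
  also have "\<dots> \<le> K"
  proof (rule SUP_least)
    fix g assume "g \<in> ?S"
    then have g: "mono g" "wint p v g \<le> 1" by auto
    have "tail w x * hardy_op g u x powe q \<le> wint q w (hardy_op g u)"
      by (rule tail_mult_hardy_op_le[OF q w])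
    also have "\<dots> \<le> K * wint p v g powe (q / p)"
      using g by (intro hardy) (auto intro: le_less_trans)
    also have "\<dots> \<le> K * 1 powe (q / p)" using g p q by (intro mult_left_mono epowr_mono) auto
    finally show "tail w x * hardy_op g u x powe q \<le> K" by simp
  qed
  finally show ?thesis .
qed

end

end

section \<open>Essential suprema of one-sided continuous functions\<close>

lemma SUP_indicator_Ioi: "(SUP n. indicator {t + 1 / real (Suc n)<..} s :: ennreal) = indicator {t<..} s"
proof (cases "t < s")
  case True
  then obtain n where "1 / real (Suc n) < s - t"
    using reals_Archimedean[of "s - t"] by (auto simp: inverse_eq_divide)
  then have "(1::ennreal) \<le> indicator {t + 1 / real (Suc n)<..} s" by simp
  also have "\<dots> \<le> (SUP n. indicator {t + 1 / real (Suc n)<..} s)" by (rule SUP_upper) simp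
  finally have "1 \<le> (SUP n. indicator {t + 1 / real (Suc n)<..} s :: ennreal)" .
  moreover have "(SUP n. indicator {t + 1 / real (Suc n)<..} s :: ennreal) \<le> 1"
    by (intro SUP_least) (auto split: split_indicator)
  ultimately show ?thesis using True by (simp add: antisym)
next
  case False
  have "t < t + 1 / real (Suc n)" for n by simp
  then have "s \<le> t + 1 / real (Suc n)" for n using False by (meson le_less_trans less_imp_le not_le)
  then have "indicator {t + 1 / real (Suc n)<..} s = (0::ennreal)" for n by (simp add: not_less)
  then show ?thesis using False by (simp only: SUP_const indicator_simps) simp
qed

lemma incseq_indicator_Ioi: "incseq (\<lambda>n. indicator {t + 1 / real (Suc n)<..} s :: ennreal)"
proof (rule incseq_SucI)
  fix n
  have "1 / real (Suc (Suc n)) \<le> 1 / real (Suc n)" by (simp add: field_simps)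
  then show "(indicator {t + 1 / real (Suc n)<..} s :: ennreal) \<le> indicator {t + 1 / real (Suc (Suc n))<..} s"
    by (auto split: split_indicator)
qed

lemma decseq_above: "decseq (\<lambda>n. t + 1 / real (Suc n))"
  by (auto simp: decseq_def field_simps)

lemma seg_right_continuous:
  assumes [measurable]: "u \<in> borel_measurable lebesgue"
  shows "seg u t x = (SUP n. seg u (t + 1 / real (Suc n)) x)"
proof -
  have ind: "indicator {t<..<x} s = (indicator {t<..} s * indicator {..<x} s :: ennreal)" for t s
    by (auto split: split_indicator)
  show ?thesis
    unfolding seg_def ind
  proof (rule nn_integral_limit[symmetric])
    show "incseq (\<lambda>n. u s * (indicator {t + 1 / real (Suc n)<..} s * indicator {..<x} s))" for s
      by (intro incseq_mult_ennreal incseq_indicator_Ioi) auto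
    show "(SUP n. u s * (indicator {t + 1 / real (Suc n)<..} s * indicator {..<x} s)) = u s * (indicator {t<..} s * indicator {..<x} s)" for s
      by (simp only: SUP_mult_left_ennreal[symmetric] SUP_mult_right_ennreal[symmetric] SUP_indicator_Ioi)
  qed measurable
qed

lemma kernel_tail_right_continuous:
  assumes [measurable]: "u \<in> borel_measurable lebesgue" "w \<in> borel_measurable lebesgue" and q: "0 < q"
  shows "kernel_tail q u w t = (SUP n. kernel_tail q u w (t + 1 / real (Suc n)))"
  unfolding kernel_tail_def
proof (rule nn_integral_limit[symmetric])
  have [measurable]: "(\<lambda>s. seg u x s) \<in> borel_measurable lebesgue" for x
    by (intro borel_measurable_mono_lebesgue monoI seg_mono) auto
  show "(\<lambda>s. w s * seg u (t + 1 / real (Suc n)) s powe q * indicator {t + 1 / real (Suc n)<..} s) \<in> borel_measurable lebesgue" for n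
    by measurable
  have inc: "incseq (\<lambda>n. w s * seg u (t + 1 / real (Suc n)) s powe q)" for s
    using q decseq_above[of t] unfolding incseq_def decseq_def
    by (auto intro!: mult_left_mono epowr_mono seg_mono)
  show "incseq (\<lambda>n. w s * seg u (t + 1 / real (Suc n)) s powe q * indicator {t + 1 / real (Suc n)<..} s)" for s
    by (rule incseq_mult_ennreal[OF inc incseq_indicator_Ioi])
  show "(SUP n. w s * seg u (t + 1 / real (Suc n)) s powe q * indicator {t + 1 / real (Suc n)<..} s) = w s * seg u t s powe q * indicator {t<..} s" for s
    unfolding SUP_mult_incseq[OF inc incseq_indicator_Ioi] SUP_indicator_Ioi
    using q by (simp only: SUP_mult_left_ennreal[symmetric] epowr_SUP[symmetric, OF _ UNIV_not_empty] seg_right_continuous[OF assms(1), of t s, symmetric])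
qed

text \<open>If h t exceeds the essential supremum, then by right continuity of R so does R (t + 1 /
  (n + 1)) * G t for some n. On a short interval to the right of t this is a lower bound for h,
  because R decreases and G increases, and the interval has positive measure.\<close>

lemma ess_sup_eq_SUP:
  assumes h: "\<And>t. t \<in> einterval c d \<Longrightarrow> h t = R t * G t"
    and R: "antimono R" "\<And>t. R t = (SUP n. R (t + 1 / real (Suc n)))" and G: "mono G"
  shows "ess_sup c d h = (SUP t\<in>einterval c d. h t)"
proof (rule antisym)
  let ?M = "lebesgue_on (einterval c d)"
  have sp: "space ?M = einterval c d" by (simp add: space_restrict_space)
  have [measurable]: "R \<in> borel_measurable lebesgue" "G \<in> borel_measurable lebesgue"
    using R(1) G by (auto intro: borel_measurable_antimono_lebesgue borel_measurable_mono_lebesgue)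
  have "(\<lambda>t. R t * G t) \<in> borel_measurable ?M" by (rule measurable_restrict_space1) measurable
  then have meas: "h \<in> borel_measurable ?M"
    by (rule subst[OF measurable_cong, rotated]) (auto simp: sp h)
  show "ess_sup c d h \<le> (SUP t\<in>einterval c d. h t)"
    unfolding ess_sup_def by (rule esssup_I[OF meas]) (auto intro!: AE_I2 SUP_upper simp: sp)
  show "(SUP t\<in>einterval c d. h t) \<le> ess_sup c d h"
  proof (rule SUP_least, rule ccontr)
    fix t assume t: "t \<in> einterval c d" and less: "\<not> h t \<le> ess_sup c d h"
    have "h t = (SUP n. R (t + 1 / real (Suc n)) * G t)"
      using h[OF t] R(2)[of t] by (simp add: SUP_mult_right_ennreal)
    then obtain n where n: "ess_sup c d h < R (t + 1 / real (Suc n)) * G t"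
      using less by (auto simp: not_le less_SUP_iff)
    obtain d' where d': "t < d'" "ereal d' < d"
      using t ereal_dense2[of "ereal t" d] by (auto simp: einterval_iff)
    \<comment> \<open>The point d' keeps the interval inside the domain, the other bound keeps R
      above the chosen value.\<close>
    define e where "e = min d' (t + 1 / real (Suc n))"
    have te: "t < e" using d' by (simp add: e_def)
    have sub: "s \<in> einterval c d \<and> ess_sup c d h < h s" if "s \<in> {t<..<e}" for s
    proof -
      have s: "t < s" "s < d'" "s < t + 1 / real (Suc n)" using that by (auto simp: e_def)
      then have "ereal t < ereal s" "ereal s < ereal d'" by simp_all
      then have "c < ereal s" "ereal s < d" using t d' unfolding einterval_iff by (blast intro: less_trans)+
      then have sI: "s \<in> einterval c d" by (simp add: einterval_iff)
      have "R (t + 1 / real (Suc n)) * G t \<le> R s * G s"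
        using s by (intro mult_mono antimonoD[OF R(1)] monoD[OF G]) auto
      then show ?thesis using n sI h[OF sI] by auto
    qed
    have "AE s in ?M. h s \<le> ess_sup c d h" unfolding ess_sup_def by (rule esssup_AE)
    then have "AE s in lebesgue. s \<in> einterval c d \<longrightarrow> h s \<le> ess_sup c d h"
      by (subst (asm) AE_restrict_space_iff) auto
    then have "AE s in lebesgue. s \<notin> {t<..<e}"
    proof eventually_elim
      fix s assume "s \<in> einterval c d \<longrightarrow> h s \<le> ess_sup c d h"
      then show "s \<notin> {t<..<e}" using sub[of s] by (auto simp del: greaterThanLessThan_iff)
    qed
    then have "emeasure lebesgue {t<..<e} = 0" by (subst (asm) AE_iff_measurable[of "{t<..<e}"]) auto
    then show False using te by simp
  qed
qed

section \<open>The best constant\<close>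

text \<open>Comparability of B with the best constant, free of division and without assuming B
  finite: c * B works for all f of finite norm, and every admissible C is at least B up to the
  factor c.\<close>

definition two_sided ::
  "real \<Rightarrow> real \<Rightarrow> ereal \<Rightarrow> ereal \<Rightarrow> (real \<Rightarrow> ennreal) \<Rightarrow> (real \<Rightarrow> ennreal) \<Rightarrow> (real \<Rightarrow> ennreal)
     \<Rightarrow> ennreal \<Rightarrow> ennreal \<Rightarrow> bool" where
  "two_sided p q a b u v w c B \<longleftrightarrow>
    (\<forall>f \<in> M_up a b. intg a b (\<lambda>x. f x powe p * v x) < top \<longrightarrow>
       intg a b (\<lambda>x. intg a x (\<lambda>s. f s * u s) powe q * w x) powe (1 / q)
         \<le> c * B * intg a b (\<lambda>x. f x powe p * v x) powe (1 / p)) \<and>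
    (\<forall>C. admissible_const p q a b u v w C \<longrightarrow> B \<le> c * ennreal C)"

lemma two_sided_admissible:
  assumes "two_sided p q a b u v w c B" and p: "0 < p" and C: "0 < C" "c * B \<le> ennreal C"
  shows "admissible_const p q a b u v w C"
  unfolding admissible_const_def hardy_ineq_def
proof (intro conjI ballI C(1))
  fix f assume f: "f \<in> M_up a b"
  let ?X = "intg a b (\<lambda>x. f x powe p * v x)"
  show "intg a b (\<lambda>x. intg a (ereal x) (\<lambda>s. f s * u s) powe q * w x) powe (1 / q) \<le> ennreal C * ?X powe (1 / p)"
  proof (cases "?X < top")
    case True
    then have "intg a b (\<lambda>x. intg a (ereal x) (\<lambda>s. f s * u s) powe q * w x) powe (1 / q) \<le> c * B * ?X powe (1 / p)"
      using assms(1) f by (simp add: two_sided_def)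
    also have "\<dots> \<le> ennreal C * ?X powe (1 / p)" using C(2) by (rule mult_right_mono) simp
    finally show ?thesis .
  next
    case False
    then have "?X = top" by (simp add: less_top[symmetric])
    then have "ennreal C * ?X powe (1 / p) = top" using p C(1) by (simp add: ennreal_mult_top)
    then show ?thesis by simp
  qed
qed

lemma two_sided_imp:
  assumes ts: "two_sided p q a b u v w c B" and p: "0 < p" and c: "c < top"
  shows "((\<exists>C. admissible_const p q a b u v w C) \<longleftrightarrow> B < \<infinity>) \<and>
    equiv_upto (enn2real c + 1) (best_const p q a b u v w) B"
proof -
  define c' where "c' = enn2real c + 1"
  have c'pos: "0 < c'" by (simp add: c'_def add_nonneg_pos)
  have "c = ennreal (enn2real c)" using c by simp
  also have "\<dots> \<le> ennreal c'" unfolding c'_def by (rule ennreal_leI) simp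
  finally have cc': "c \<le> ennreal c'" .
  have nec: "B \<le> ennreal c' * ennreal C" if "admissible_const p q a b u v w C" for C
  proof -
    have "B \<le> c * ennreal C" using ts that by (simp add: two_sided_def)
    also have "\<dots> \<le> ennreal c' * ennreal C" using cc' by (rule mult_right_mono) simp
    finally show ?thesis .
  qed
  have suff: "best_const p q a b u v w \<le> c * B" "\<exists>C. admissible_const p q a b u v w C" if "B < top"
  proof -
    have cB: "c * B < top" using that c by (simp add: ennreal_mult_less_top)
    \<comment> \<open>The summand e is there because an admissible constant has to be positive,
      while c * B may be 0.\<close>
    have adm: "admissible_const p q a b u v w (enn2real (c * B) + e)" if "0 < e" for e
    proof (rule two_sided_admissible[OF ts p])
      show "0 < enn2real (c * B) + e" using that by (simp add: add_nonneg_pos)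
      have "c * B = ennreal (enn2real (c * B))" using cB by simp
      also have "\<dots> \<le> ennreal (enn2real (c * B) + e)" using that by (intro ennreal_leI) simp
      finally show "c * B \<le> ennreal (enn2real (c * B) + e)" .
    qed
    show "\<exists>C. admissible_const p q a b u v w C" using adm[of 1] by auto
    show "best_const p q a b u v w \<le> c * B"
    proof (rule ennreal_le_epsilon)
      fix e :: real assume e: "0 < e"
      have "best_const p q a b u v w \<le> ennreal (enn2real (c * B) + e)"
        unfolding best_const_def using adm[OF e] by (intro INF_lower) simp
      also have "\<dots> = ennreal (enn2real (c * B)) + ennreal e" using e by (intro ennreal_plus) auto
      also have "\<dots> = c * B + ennreal e" using cB by simp
      finally show "best_const p q a b u v w \<le> c * B + ennreal e" .
    qed
  qed
  have "(\<exists>C. admissible_const p q a b u v w C) \<longleftrightarrow> B < \<infinity>"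
  proof
    assume "\<exists>C. admissible_const p q a b u v w C"
    then obtain C where "B \<le> ennreal c' * ennreal C" using nec by blast
    also have "\<dots> < \<infinity>" by (simp add: ennreal_mult_less_top)
    finally show "B < \<infinity>" .
  qed (use suff in simp)
  moreover have "best_const p q a b u v w \<le> ennreal c' * B"
  proof (cases "B < top")
    case True
    then have "best_const p q a b u v w \<le> c * B" by (rule suff)
    also have "\<dots> \<le> ennreal c' * B" by (rule mult_right_mono[OF cc']) simp
    finally show ?thesis .
  next
    case False
    then show ?thesis using c'pos by (simp add: less_top[symmetric] ennreal_mult_top)
  qed
  moreover have "B \<le> ennreal c' * best_const p q a b u v w"
  proof -
    have inv: "ennreal c' * (ennreal (1 / c') * x) = x" "ennreal (1 / c') * (ennreal c' * x) = x" for x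
      using c'pos by (simp_all add: mult.assoc[symmetric] ennreal_mult[symmetric])
    have "ennreal (1 / c') * B \<le> best_const p q a b u v w"
      unfolding best_const_def
    proof (rule INF_greatest)
      fix C assume "C \<in> {C. admissible_const p q a b u v w C}"
      then have "ennreal (1 / c') * B \<le> ennreal (1 / c') * (ennreal c' * ennreal C)"
        using nec by (intro mult_left_mono) auto
      then show "ennreal (1 / c') * B \<le> ennreal C" unfolding inv .
    qed
    then have "ennreal c' * (ennreal (1 / c') * B) \<le> ennreal c' * best_const p q a b u v w"
      by (rule mult_left_mono) simp
    then show ?thesis unfolding inv .
  qed
  ultimately show ?thesis by (simp add: equiv_upto_def c'_def)
qed

lemma epowr_inverse_mono:
  assumes "0 < s" "D \<le> k * z powe s" shows "D powe (1 / s) \<le> k powe (1 / s) * z"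
proof -
  have "D powe (1 / s) \<le> (k * z powe s) powe (1 / s)" using assms by (intro epowr_mono) auto
  then show ?thesis using assms by (simp add: epowr_mult epowr_epowr)
qed

definition cI :: "real \<Rightarrow> real \<Rightarrow> ennreal" where
  "cI p q = (cS1 q p * (1 + cB1 p 1 powe q)) powe (1 / q) + 1"

definition cIII :: "real \<Rightarrow> real \<Rightarrow> ennreal" where
  "cIII p q = (cS1 q p * (1 + cB2 p 1 powe q)) powe (1 / q) + (1 + cW1 (1 / (p - 1)) powe (1 / p))"

text \<open>k1 is the constant in bounding the functional by A times the norm, k2 the one in
  bounding A by the norm of the functional. The first summand serves sufficiency, the rest
  necessity.\<close>

definition cGt :: "real \<Rightarrow> real \<Rightarrow> ennreal \<Rightarrow> ennreal \<Rightarrow> ennreal" where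
  "cGt p q k1 k2 = (let r = q / (p - q) in
     (cS2 q p * (k1 powe (p * r) + 1) powe (1 - q / p)) powe (1 / q)
       + ((k2 powe (p * r) * cN1 q r) powe (1 / (p * r)) + cN3 q r powe (1 / (p * r))))"

section \<open>Weights on the interval extended by zero, and the five constants in these
  terms\<close>

locale hardy_problem =
  hardy_setting a b "\<lambda>x. u x * indicator (einterval a b) x" "\<lambda>x. v x * indicator (einterval a b) x"
    "\<lambda>x. w x * indicator (einterval a b) x" al be
  for a b :: ereal and u v w :: "real \<Rightarrow> ennreal" and al be
begin

abbreviation "u0 \<equiv> \<lambda>x. u x * indicator (einterval a b) x"
abbreviation "v0 \<equiv> \<lambda>x. v x * indicator (einterval a b) x"
abbreviation "w0 \<equiv> \<lambda>x. w x * indicator (einterval a b) x"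

lemma intg_seg:
  assumes "a \<le> ereal t" "ereal x \<le> b" shows "intg (ereal t) (ereal x) u = seg u0 t x"
  unfolding intg_def seg_def
proof (intro nn_integral_cong)
  fix s
  have "s \<in> einterval a b" if "t < s" "s < x"
  proof -
    have "ereal t < ereal s" "ereal s < ereal x" using that by simp_all
    then have "a < ereal s" "ereal s < b" using assms by (blast intro: le_less_trans less_le_trans)+
    then show ?thesis by (simp add: einterval_iff)
  qed
  then show "u s * indicator (einterval (ereal t) (ereal x)) s = u0 s * indicator {t<..<x} s"
    by (auto split: split_indicator)
qed

lemma intg_tail:
  assumes "a \<le> ereal x" shows "intg (ereal x) b h = tail (\<lambda>x. h x * indicator (einterval a b) x) x"
  unfolding intg_def tail_def
proof (intro nn_integral_cong)
  fix s
  have "a < ereal s" if "x < s" using that assms by (auto intro: le_less_trans)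
  then show "h s * indicator (einterval (ereal x) b) s = h s * indicator (einterval a b) s * indicator {x<..} s"
    by (auto split: split_indicator simp: einterval_iff)
qed

lemma in_initial:
  assumes "x \<in> einterval a b" shows "s \<in> einterval a (ereal x) \<longleftrightarrow> s \<in> einterval a b \<and> s < x"
  using assms by (auto simp: einterval_iff intro: less_trans[of "ereal s" "ereal x"])

lemma intg_hardy_op:
  assumes x: "x \<in> einterval a b" and f: "\<And>s. s \<in> einterval a b \<Longrightarrow> f s = g s"
  shows "intg a (ereal x) (\<lambda>s. f s * u s) = hardy_op g u0 x"
  unfolding intg_def hardy_op_def
  using f in_initial[OF x] by (intro nn_integral_cong) (auto split: split_indicator)

lemma intg_kernel_tail:
  assumes x: "x \<in> einterval a b"
  shows "intg (ereal x) b (\<lambda>t. w t * intg (ereal x) (ereal t) u powe q) = kernel_tail q u0 w0 x"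
proof -
  have ax: "a \<le> ereal x" using x by (simp add: einterval_iff less_imp_le)
  have "w t * intg (ereal x) (ereal t) u powe q * indicator (einterval a b) t * indicator {x<..} t
    = w0 t * seg u0 x t powe q * indicator {x<..} t" for t
    using intg_seg[OF ax, of t] by (auto split: split_indicator simp: einterval_iff less_imp_le)
  then show ?thesis unfolding intg_tail[OF ax] tail_def kernel_tail_def by simp
qed

lemma intg_quot_int:
  assumes x: "x \<in> einterval a b"
  shows "intg a (ereal x) (\<lambda>t. intg (ereal t) (ereal x) u powe (1 / (p - 1)) * u t * intg (ereal t) b v powe (- (1 / (p - 1))))
    = quot_int p x"
  unfolding intg_def[of a "ereal x"] quot_int_def
proof (intro nn_integral_cong)
  fix t
  show "intg (ereal t) (ereal x) u powe (1 / (p - 1)) * u t * intg (ereal t) b v powe (- (1 / (p - 1))) * indicator (einterval a (ereal x)) t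
    = seg u0 t x powe (1 / (p - 1)) * u0 t * tail v0 t powe (- (1 / (p - 1))) * indicator {..<x} t"
  proof (cases "t \<in> einterval a b \<and> t < x")
    case True
    then have "a \<le> ereal t" "ereal x \<le> b" using x by (auto simp: einterval_iff less_imp_le)
    then show ?thesis using True in_initial[OF x, of t] by (simp add: intg_seg intg_tail)
  next
    case False
    then show ?thesis using in_initial[OF x, of t] by (auto split: split_indicator)
  qed
qed

text \<open>In t, the first factor decreases and is right continuous and the second one increases,
  so the essential supremum is a supremum. It may then run over all t > a, since \<open>seg\<close>
  vanishes for t >= x.\<close>

lemma ess_sup_quotient:
  assumes x: "x \<in> einterval a b" and al: "0 < \<alpha>" "0 < \<beta>"
  shows "ess_sup a (ereal x) (\<lambda>t. intg (ereal t) (ereal x) u powe \<alpha> * intg (ereal t) b v powe (- \<beta>))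
    = (SUP t\<in>{t. a < ereal t}. seg u0 t x powe \<alpha> * tail v0 t powe (- \<beta>))"
proof -
  have eq: "intg (ereal t) (ereal x) u powe \<alpha> * intg (ereal t) b v powe (- \<beta>) = seg u0 t x powe \<alpha> * tail v0 t powe (- \<beta>)"
    if "t \<in> einterval a (ereal x)" for t
    using that x by (simp add: intg_seg intg_tail einterval_iff less_imp_le)
  have "ess_sup a (ereal x) (\<lambda>t. intg (ereal t) (ereal x) u powe \<alpha> * intg (ereal t) b v powe (- \<beta>))
    = (SUP t\<in>einterval a (ereal x). intg (ereal t) (ereal x) u powe \<alpha> * intg (ereal t) b v powe (- \<beta>))"
  proof (rule ess_sup_eq_SUP[OF eq])
    show "antimono (\<lambda>t. seg u0 t x powe \<alpha>)" using al by (intro antimonoI epowr_mono seg_mono) auto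
    show "seg u0 t x powe \<alpha> = (SUP n. seg u0 (t + 1 / real (Suc n)) x powe \<alpha>)" for t
      using al by (subst seg_right_continuous[OF u]) (simp add: epowr_SUP)
    show "mono (\<lambda>t. tail v0 t powe (- \<beta>))" using al by (intro monoI epowr_antimono tail_antimono) auto
  qed
  also have "\<dots> = (SUP t\<in>einterval a (ereal x). seg u0 t x powe \<alpha> * tail v0 t powe (- \<beta>))"
    by (rule SUP_cong[OF refl eq])
  also have "\<dots> = (SUP t\<in>{t. a < ereal t}. seg u0 t x powe \<alpha> * tail v0 t powe (- \<beta>))"
  proof (rule antisym)
    show "(SUP t\<in>einterval a (ereal x). seg u0 t x powe \<alpha> * tail v0 t powe (- \<beta>))
      \<le> (SUP t\<in>{t. a < ereal t}. seg u0 t x powe \<alpha> * tail v0 t powe (- \<beta>))"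
      by (rule SUP_subset_mono) (auto simp: einterval_iff)
    show "(SUP t\<in>{t. a < ereal t}. seg u0 t x powe \<alpha> * tail v0 t powe (- \<beta>))
      \<le> (SUP t\<in>einterval a (ereal x). seg u0 t x powe \<alpha> * tail v0 t powe (- \<beta>))"
    proof (rule SUP_least)
      fix t assume "t \<in> {t. a < ereal t}"
      then show "seg u0 t x powe \<alpha> * tail v0 t powe (- \<beta>) \<le> (SUP t\<in>einterval a (ereal x). seg u0 t x powe \<alpha> * tail v0 t powe (- \<beta>))"
        using al by (cases "t < x") (auto simp: einterval_iff intro: SUP_upper)
    qed
  qed
  finally show ?thesis .
qed

lemma C1_eq:
  assumes "0 < p" "0 < q"
  shows "C\<^sub>1 p q a b u v w = (SUP x\<in>einterval a b. kernel_tail q u0 w0 x powe (1 / q) * tail v0 x powe (- (1 / p)))"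
proof -
  have eq: "intg (ereal x) b (\<lambda>t. w t * intg (ereal x) (ereal t) u powe q) powe (1 / q) * intg (ereal x) b v powe (- (1 / p))
    = kernel_tail q u0 w0 x powe (1 / q) * tail v0 x powe (- (1 / p))" if "x \<in> einterval a b" for x
    using that intg_tail[of x v] by (simp add: intg_kernel_tail einterval_iff less_imp_le)
  have "C\<^sub>1 p q a b u v w = (SUP x\<in>einterval a b. intg (ereal x) b (\<lambda>t. w t * intg (ereal x) (ereal t) u powe q) powe (1 / q) * intg (ereal x) b v powe (- (1 / p)))"
    unfolding C\<^sub>1_def
  proof (rule ess_sup_eq_SUP[OF eq])
    show "antimono (\<lambda>t. kernel_tail q u0 w0 t powe (1 / q))"
      using assms by (intro antimonoI epowr_mono kernel_tail_antimono) auto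
    show "kernel_tail q u0 w0 t powe (1 / q) = (SUP n. kernel_tail q u0 w0 (t + 1 / real (Suc n)) powe (1 / q))" for t
      using assms by (subst kernel_tail_right_continuous[OF u w]) (simp_all add: epowr_SUP)
    show "mono (\<lambda>t. tail v0 t powe (- (1 / p)))" using assms by (intro monoI epowr_antimono tail_antimono) auto
  qed
  also have "\<dots> = (SUP x\<in>einterval a b. kernel_tail q u0 w0 x powe (1 / q) * tail v0 x powe (- (1 / p)))"
    by (rule SUP_cong[OF refl eq])
  finally show ?thesis .
qed

lemma kernel_tail_le_C1:
  assumes pq: "0 < p" "0 < q" and x: "x \<in> einterval a b" "tail v0 x < top"
  shows "kernel_tail q u0 w0 x \<le> C\<^sub>1 p q a b u v w powe q * tail v0 x powe (q / p)"
proof -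
  have V: "0 < tail v0 x" using x by (intro tail_v_pos) (simp add: einterval_iff)
  have "kernel_tail q u0 w0 x = kernel_tail q u0 w0 x powe (1 / q * q) * tail v0 x powe (- (q / p) + q / p)"
    using pq by simp
  also have "\<dots> = (kernel_tail q u0 w0 x powe (1 / q) * tail v0 x powe (- (1 / p))) powe q * tail v0 x powe (q / p)"
    using pq V x by (subst epowr_add_finite) (auto simp: epowr_mult epowr_epowr mult.assoc)
  also have "\<dots> \<le> C\<^sub>1 p q a b u v w powe q * tail v0 x powe (q / p)"
    unfolding C1_eq[OF pq] using pq x by (intro mult_right_mono epowr_mono SUP_upper) auto
  finally show ?thesis .
qed

text \<open>Where the tail of v is infinite the quotient is 0, so the hypothesis at finite tails is
  enough.\<close>

lemma C1_le:
  assumes pq: "0 < p" "0 < q"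
    and K: "\<And>x. tail v0 x < top \<Longrightarrow> kernel_tail q u0 w0 x \<le> ennreal C powe q * tail v0 x powe (q / p)"
  shows "C\<^sub>1 p q a b u v w \<le> ennreal C"
  unfolding C1_eq[OF pq]
proof (rule SUP_least)
  fix x assume x: "x \<in> einterval a b"
  show "kernel_tail q u0 w0 x powe (1 / q) * tail v0 x powe (- (1 / p)) \<le> ennreal C"
  proof (cases "tail v0 x < top")
    case True
    have V: "0 < tail v0 x" using x by (intro tail_v_pos) (simp add: einterval_iff)
    have "kernel_tail q u0 w0 x powe (1 / q) * tail v0 x powe (- (1 / p)) \<le>
       (ennreal C powe q * tail v0 x powe (q / p)) powe (1 / q) * tail v0 x powe (- (1 / p))"
      using pq True by (intro mult_right_mono epowr_mono K) auto
    also have "\<dots> = ennreal C * tail v0 x powe (1 / p + - (1 / p))"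
      using pq V True by (subst epowr_add_finite) (auto simp: epowr_mult epowr_epowr mult.assoc)
    finally show ?thesis by simp
  next
    case False
    then show ?thesis using pq by (simp add: less_top[symmetric])
  qed
qed

lemma intg_whole: "intg a b g = (\<integral>\<^sup>+x. g x * indicator (einterval a b) x \<partial>lebesgue)"
  by (simp add: intg_def)

lemma C2_eq:
  assumes q: "0 < q" "q < p" and r: "r = q / (p - q)"
  shows "C\<^sub>2 p q a b u v w = (\<integral>\<^sup>+x. tail w0 x powe r * quot_sup p x powe (p * r) * w0 x \<partial>lebesgue) powe (1 / (p * r))"
proof -
  have e: "p * q / (p - q) = p * r" "(p - q) / (p * q) = 1 / (p * r)" "0 < p * r" "0 < r"
    using q by (simp_all add: r)
  have "intg (ereal x) b w powe r * w x
      * ess_sup a (ereal x) (\<lambda>t. intg (ereal t) (ereal x) u powe (p * r) * intg (ereal t) b v powe (- r)) * indicator (einterval a b) x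
    = tail w0 x powe r * quot_sup p x powe (p * r) * w0 x" for x
  proof (cases "x \<in> einterval a b")
    case True
    then have ne: "{t. a < ereal t} \<noteq> {}" by (auto simp: einterval_iff)
    have "quot_sup p x powe (p * r) = (SUP t\<in>{t. a < ereal t}. seg u0 t x powe (p * r) * tail v0 t powe (- r))"
      unfolding quot_sup_def epowr_SUP[OF e(3) ne] using e q by (simp add: epowr_mult epowr_epowr)
    moreover have "intg (ereal x) b w = tail w0 x" using True intg_tail[of x w] by (simp add: einterval_iff less_imp_le)
    ultimately show ?thesis
      using True by (simp only: ess_sup_quotient[OF True e(3,4)]) (simp add: mult_ac)
  qed simp
  then show ?thesis unfolding C\<^sub>2_def intg_whole e r[symmetric] by simp
qed

lemma C3_eq:
  assumes q: "0 < q" "q < p" and r: "r = q / (p - q)"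
  shows "C\<^sub>3 p q a b u v w = (\<integral>\<^sup>+x. kernel_tail q u0 w0 x powe r * ker_sup q r x * w0 x \<partial>lebesgue) powe (1 / (p * r))"
proof -
  have e: "(p - q) / (p * q) = 1 / (p * r)" "0 < r"
    using q by (simp_all add: r)
  have "intg (ereal x) b (\<lambda>s. w s * intg (ereal x) (ereal s) u powe q) powe r * w x
      * ess_sup a (ereal x) (\<lambda>t. intg (ereal t) (ereal x) u powe q * intg (ereal t) b v powe (- r)) * indicator (einterval a b) x
    = kernel_tail q u0 w0 x powe r * ker_sup q r x * w0 x" for x
  proof (cases "x \<in> einterval a b")
    case True
    then show ?thesis
      unfolding ess_sup_quotient[OF True q(1) e(2)] intg_kernel_tail[OF True] ker_sup_def by (simp add: mult_ac)
  qed simp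
  then show ?thesis unfolding C\<^sub>3_def intg_whole e r[symmetric] by simp
qed

lemma C4_eq:
  "C\<^sub>4 p q a b u v w = (SUP x\<in>einterval a b. tail w0 x powe (1 / q) * quot_int p x powe ((p - 1) / p))"
  unfolding C\<^sub>4_def
proof (rule SUP_cong[OF refl])
  fix x assume x: "x \<in> einterval a b"
  then have "intg (ereal x) b w = tail w0 x" using intg_tail[of x w] by (simp add: einterval_iff less_imp_le)
  then show "intg (ereal x) b w powe (1 / q) *
      intg a (ereal x) (\<lambda>t. intg (ereal t) (ereal x) u powe (1 / (p - 1)) * u t * intg (ereal t) b v powe (- (1 / (p - 1)))) powe ((p - 1) / p)
    = tail w0 x powe (1 / q) * quot_int p x powe ((p - 1) / p)"
    by (simp only: intg_quot_int[OF x])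
qed

lemma C5_eq:
  assumes q: "0 < q" "q < p" "1 < p" and r: "r = q / (p - q)"
  shows "C\<^sub>5 p q a b u v w = (\<integral>\<^sup>+x. tail w0 x powe r * (quot_int p x powe (1 - 1 / p)) powe (p * r) * w0 x \<partial>lebesgue) powe (1 / (p * r))"
proof -
  have e: "q * (p - 1) / (p - q) = (1 - 1 / p) * (p * r)" "(p - q) / (p * q) = 1 / (p * r)"
    using q by (simp_all add: r field_simps)
  have "intg (ereal x) b w powe r * w x *
      intg a (ereal x) (\<lambda>t. intg (ereal t) (ereal x) u powe (1 / (p - 1)) * u t * intg (ereal t) b v powe (- (1 / (p - 1)))) powe ((1 - 1 / p) * (p * r)) * indicator (einterval a b) x
    = tail w0 x powe r * (quot_int p x powe (1 - 1 / p)) powe (p * r) * w0 x" for x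
  proof (cases "x \<in> einterval a b")
    case True
    then have "intg (ereal x) b w = tail w0 x" using intg_tail[of x w] by (simp add: einterval_iff less_imp_le)
    then show ?thesis using True by (simp only: intg_quot_int[OF True] epowr_epowr) (simp add: mult_ac)
  qed simp
  then show ?thesis unfolding C\<^sub>5_def intg_whole e r[symmetric] by simp
qed

text \<open>Functions in the cone are monotone on the interval only. The values chosen outside do
  not enter the integrals, because the weights are 0 there.\<close>

lemma M_up_extend:
  assumes f: "f \<in> M_up a b"
  obtains g where "mono g" "\<And>x. x \<in> einterval a b \<Longrightarrow> f x = g x"
proof
  let ?g = "\<lambda>x. SUP s\<in>{s \<in> einterval a b. s \<le> x}. f s"
  show "mono ?g" by (rule mono_SUP_le)
  show "f x = ?g x" if "x \<in> einterval a b" for x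
    using f that by (intro antisym SUP_upper SUP_least) (auto simp: M_up_def mono_on_def)
qed

lemma mono_in_M_up:
  assumes "mono g" shows "g \<in> M_up a b"
  using measurable_restrict_space1[OF borel_measurable_mono_lebesgue[OF assms]] assms
  by (auto simp: M_up_def M_plus_def mono_on_def mono_def)

lemma intg_eqs:
  assumes f: "\<And>x. x \<in> einterval a b \<Longrightarrow> f x = g x"
  shows "intg a b (\<lambda>x. intg a (ereal x) (\<lambda>s. f s * u s) powe q * w x) = wint q w0 (hardy_op g u0)"
    and "intg a b (\<lambda>x. f x powe p * v x) = wint p v0 g"
proof -
  have "intg a (ereal x) (\<lambda>s. f s * u s) powe q * w x * indicator (einterval a b) x = hardy_op g u0 x powe q * w0 x" for x
    using intg_hardy_op[of x f g] f by (cases "x \<in> einterval a b") auto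
  then show "intg a b (\<lambda>x. intg a (ereal x) (\<lambda>s. f s * u s) powe q * w x) = wint q w0 (hardy_op g u0)"
    unfolding intg_whole by simp
  show "intg a b (\<lambda>x. f x powe p * v x) = wint p v0 g"
    unfolding intg_whole using f by (intro nn_integral_cong) (auto split: split_indicator)
qed

lemma two_sidedI:
  assumes pq: "0 < p" "0 < q"
    and suff: "\<And>g. mono g \<Longrightarrow> wint p v0 g < top \<Longrightarrow>
      wint q w0 (hardy_op g u0) \<le> S * wint p v0 g powe (q / p)"
    and S: "S \<le> (c * B) powe q"
    and nec: "\<And>C. 0 < C \<Longrightarrow> (\<And>g. mono g \<Longrightarrow> wint p v0 g < top \<Longrightarrow>
      wint q w0 (hardy_op g u0) \<le> ennreal C powe q * wint p v0 g powe (q / p))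
      \<Longrightarrow> B \<le> c * ennreal C"
  shows "two_sided p q a b u v w c B"
  unfolding two_sided_def
proof (intro conjI ballI allI impI)
  fix f assume f: "f \<in> M_up a b" and X: "intg a b (\<lambda>x. f x powe p * v x) < top"
  obtain g where g: "mono g" "\<And>x. x \<in> einterval a b \<Longrightarrow> f x = g x" using M_up_extend[OF f] by blast
  have eqs: "intg a b (\<lambda>x. intg a (ereal x) (\<lambda>s. f s * u s) powe q * w x) = wint q w0 (hardy_op g u0)"
    "intg a b (\<lambda>x. f x powe p * v x) = wint p v0 g"
    by (intro intg_eqs g(2); assumption)+
  have "wint q w0 (hardy_op g u0) \<le> S * wint p v0 g powe (q / p)"
    using X unfolding eqs by (rule suff[OF g(1)])
  also have "\<dots> \<le> (c * B) powe q * wint p v0 g powe (q / p)"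
    by (rule mult_right_mono[OF S]) simp
  finally have "wint q w0 (hardy_op g u0) \<le> (c * B * wint p v0 g powe (1 / p)) powe q"
    using pq by (simp add: epowr_mult epowr_epowr)
  then show "intg a b (\<lambda>x. intg a (ereal x) (\<lambda>s. f s * u s) powe q * w x) powe (1 / q)
    \<le> c * B * intg a b (\<lambda>x. f x powe p * v x) powe (1 / p)"
    unfolding eqs
    using pq by (simp add: epowr_le_iff)
next
  fix C assume adm: "admissible_const p q a b u v w C"
  show "B \<le> c * ennreal C"
  proof (rule nec)
    show "0 < C" using adm by (simp add: admissible_const_def)
    fix g :: "real \<Rightarrow> ennreal" assume g: "mono g"
    have "wint q w0 (hardy_op g u0) powe (1 / q) \<le> ennreal C * wint p v0 g powe (1 / p)"
    proof -
      have eqs: "intg a b (\<lambda>x. intg a (ereal x) (\<lambda>s. g s * u s) powe q * w x) = wint q w0 (hardy_op g u0)"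
        "intg a b (\<lambda>x. g x powe p * v x) = wint p v0 g"
        by (intro intg_eqs refl)+
      have "hardy_ineq p q a b u v w C g"
        using adm mono_in_M_up[OF g] by (simp add: admissible_const_def)
      then show ?thesis unfolding hardy_ineq_def eqs .
    qed
    then have "wint q w0 (hardy_op g u0) \<le> (ennreal C * wint p v0 g powe (1 / p)) powe q"
      using pq by (simp add: epowr_le_iff)
    also have "\<dots> = ennreal C powe q * wint p v0 g powe (q / p)"
      using pq by (simp add: epowr_mult epowr_epowr)
    finally show "wint q w0 (hardy_op g u0) \<le> ennreal C powe q * wint p v0 g powe (q / p)" .
  qed
qed


section \<open>The four ranges of exponents\<close>

lemma two_sided_I:
  assumes p: "0 < p" "p \<le> q" "p \<le> 1"
  shows "two_sided p q a b u v w (cI p q) (C\<^sub>1 p q a b u v w)"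
proof (rule two_sidedI)
  show q: "0 < q" "0 < p" using p by simp_all
  let ?C = "C\<^sub>1 p q a b u v w"
  let ?S = "cS1 q p * (?C powe q + cB1 p 1 powe q * ?C powe q)"
  show "wint q w0 (hardy_op g u0) \<le> ?S * wint p v0 g powe (q / p)"
    if g: "mono g" "wint p v0 g < top" for g
    unfolding mult.assoc
  proof (rule setting_bound_le[OF p(1) q(1) g _ p(2)])
    show "hardy_op g (tr n u0) x \<le> cB1 p 1 * quot_sup p x * wint p v0 g powe (1 / p)"
      if "mono g" "wint p v0 g < top" for n x g
      using p that by (intro hardy_op_le_quot_sup) auto
    show "kernel_tail q u0 w0 x \<le> ?C powe q * tail v0 x powe (q / p)" if "x \<in> einterval a b" "tail v0 x < top" for x
      by (rule kernel_tail_le_C1[OF p(1) q(1) that])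
    \<comment> \<open>The condition on increments is not a separate requirement here but a
      consequence of the bound by \<open>C\<^sub>1\<close>.\<close>
    show "tail w0 x * (cB1 p 1 * quot_sup p x) powe q \<le> cB1 p 1 powe q * ?C powe q" if x: "x \<in> einterval a b" for x
    proof -
      have "tail w0 x * quot_sup p x powe q \<le> ?C powe q"
        by (rule tail_quot_sup_le[OF p(1) q(1) _ x]) (rule kernel_tail_le_C1[OF p(1) q(1)])
      then have "cB1 p 1 powe q * (tail w0 x * quot_sup p x powe q) \<le> cB1 p 1 powe q * ?C powe q"
        by (rule mult_left_mono) simp
      then show ?thesis using q by (simp add: epowr_mult mult_ac)
    qed
  qed
  have "?S = ((cS1 q p * (1 + cB1 p 1 powe q)) powe (1 / q) * ?C) powe q"
    using q by (simp add: epowr_mult epowr_epowr algebra_simps)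
  also have "\<dots> \<le> (cI p q * ?C) powe q"
    unfolding cI_def using q by (intro epowr_mono mult_right_mono) auto
  finally show "?S \<le> (cI p q * ?C) powe q" .
  fix C :: real
  assume C: "0 < C" and hardy: "\<And>g. mono g \<Longrightarrow> wint p v0 g < top \<Longrightarrow>
      wint q w0 (hardy_op g u0) \<le> ennreal C powe q * wint p v0 g powe (q / p)"
  have "?C \<le> ennreal C"
    by (rule C1_le[OF q(2,1)]) (rule kernel_tail_necessary[OF q(2,1) hardy])
  also have "\<dots> \<le> cI p q * ennreal C"
    using mult_right_mono[of 1 "cI p q" "ennreal C"] by (simp add: cI_def)
  finally show "?C \<le> cI p q * ennreal C" .
qed

text \<open>For p > 1 the norm of the functional is Sawyer's integral, so the condition on
  increments is exactly \<open>C\<^sub>4\<close>. Its necessity goes through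
  \<open>dual_norm\<close>.\<close>

lemma two_sided_III:
  assumes p: "1 < p" "p \<le> q"
  shows "two_sided p q a b u v w (cIII p q) (C\<^sub>1 p q a b u v w + C\<^sub>4 p q a b u v w)"
proof (rule two_sidedI)
  show q: "0 < q" "0 < p" using p by simp_all
  let ?C1 = "C\<^sub>1 p q a b u v w" and ?C4 = "C\<^sub>4 p q a b u v w"
  let ?S = "cS1 q p * (?C1 powe q + cB2 p 1 powe q * ?C4 powe q)"
  have e: "(p - 1) / p = 1 - 1 / p" using p by (simp add: field_simps)
  show "wint q w0 (hardy_op g u0) \<le> ?S * wint p v0 g powe (q / p)"
    if g: "mono g" "wint p v0 g < top" for g
    unfolding mult.assoc
  proof (rule setting_bound_le[OF q(2,1) g _ p(2)])
    show "hardy_op g (tr n u0) x \<le> cB2 p 1 * quot_int p x powe (1 - 1 / p) * wint p v0 g powe (1 / p)"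
      if "mono g" "wint p v0 g < top" for n x g
      using p that by (intro hardy_op_le_quot_int) auto
    show "kernel_tail q u0 w0 x \<le> ?C1 powe q * tail v0 x powe (q / p)" if "x \<in> einterval a b" "tail v0 x < top" for x
      by (rule kernel_tail_le_C1[OF q(2,1) that])
    show "tail w0 x * (cB2 p 1 * quot_int p x powe (1 - 1 / p)) powe q \<le> cB2 p 1 powe q * ?C4 powe q" if x: "x \<in> einterval a b" for x
    proof -
      have "tail w0 x powe (1 / q) * quot_int p x powe (1 - 1 / p) \<le> ?C4"
        unfolding C4_eq e using x by (intro SUP_upper)
      then have "(tail w0 x powe (1 / q) * quot_int p x powe (1 - 1 / p)) powe q \<le> ?C4 powe q"
        using q by (intro epowr_mono) auto
      then have "cB2 p 1 powe q * (tail w0 x powe (1 / q) * quot_int p x powe (1 - 1 / p)) powe q \<le> cB2 p 1 powe q * ?C4 powe q"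
        by (rule mult_left_mono) simp
      then show ?thesis using q by (simp add: epowr_mult epowr_epowr mult_ac)
    qed
  qed
  have "?S \<le> cS1 q p * ((?C1 + ?C4) powe q + cB2 p 1 powe q * (?C1 + ?C4) powe q)"
    using q by (intro mult_left_mono add_mono epowr_mono) auto
  also have "\<dots> = ((cS1 q p * (1 + cB2 p 1 powe q)) powe (1 / q) * (?C1 + ?C4)) powe q"
    using q by (simp add: epowr_mult epowr_epowr) (simp add: algebra_simps)
  also have "\<dots> \<le> (cIII p q * (?C1 + ?C4)) powe q"
    unfolding cIII_def using q by (intro epowr_mono mult_right_mono) auto
  finally show "?S \<le> (cIII p q * (?C1 + ?C4)) powe q" .
  fix C :: real
  assume C: "0 < C" and hardy: "\<And>g. mono g \<Longrightarrow> wint p v0 g < top \<Longrightarrow>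
      wint q w0 (hardy_op g u0) \<le> ennreal C powe q * wint p v0 g powe (q / p)"
  let ?k = "cW1 (1 / (p - 1)) powe (1 / p)"
  have C1: "?C1 \<le> ennreal C"
    by (rule C1_le[OF q(2,1)]) (rule kernel_tail_necessary[OF q(2,1) hardy])
  have C4: "?C4 \<le> ?k * ennreal C"
    unfolding C4_eq e
  proof (rule SUP_least)
    fix x
    have "tail w0 x powe (1 / q) * quot_int p x powe (1 - 1 / p) \<le> tail w0 x powe (1 / q) * (?k * dual_norm p u0 v0 x)"
      by (intro mult_left_mono quot_int_le_dual_norm p) auto
    also have "\<dots> = ?k * (tail w0 x * dual_norm p u0 v0 x powe q) powe (1 / q)"
      using q by (simp add: epowr_mult epowr_epowr mult_ac)
    also have "\<dots> \<le> ?k * (ennreal C powe q) powe (1 / q)"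
      using q by (intro mult_left_mono epowr_mono dual_norm_necessary[OF q(2,1) hardy]) auto
    finally show "tail w0 x powe (1 / q) * quot_int p x powe (1 - 1 / p) \<le> ?k * ennreal C"
      using q by (simp add: epowr_epowr)
  qed
  have "?C1 + ?C4 \<le> (1 + ?k) * ennreal C"
    using add_mono[OF C1 C4] by (simp add: distrib_right)
  also have "\<dots> \<le> cIII p q * ennreal C"
    unfolding cIII_def by (intro mult_right_mono) auto
  finally show "?C1 + ?C4 \<le> cIII p q * ennreal C" .
qed

text \<open>Common to both ranges with q < p: A is the explicit expression for the norm of the
  functional, and D becomes \<open>C\<^sub>2\<close> or \<open>C\<^sub>5\<close>. The factor from
  \<open>ka\<close> enters sufficiency, the one from \<open>kb\<close> enters necessity;
  \<open>C\<^sub>3\<close> is treated alike in both.\<close>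

lemma two_sided_gt:
  assumes q: "0 < q" "q < p" and r: "r = q / (p - q)" and A_mono: "mono A"
    and A: "\<And>n x g. mono g \<Longrightarrow> wint p v0 g < top \<Longrightarrow>
       hardy_op g (tr n u0) x \<le> ka * A x * wint p v0 g powe (1 / p)"
    and A_dual: "\<And>x. A x \<le> kb * dual_norm p u0 v0 x"
    and D: "D = (\<integral>\<^sup>+x. tail w0 x powe r * A x powe (p * r) * w0 x \<partial>lebesgue) powe (1 / (p * r))"
    and c: "c = (cS2 q p * (ka powe (p * r) + 1) powe (1 - q / p)) powe (1 / q)
       + ((kb powe (p * r) * cN1 q r) powe (1 / (p * r)) + cN3 q r powe (1 / (p * r)))"
  shows "two_sided p q a b u v w c (D + C\<^sub>3 p q a b u v w)"
proof (rule two_sidedI)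
  show q0: "0 < q" and p0: "0 < p" using q by simp_all
  have e: "0 < p * r" "0 < r" "0 < 1 - q / p" "p * r * (1 - q / p) = q" "q * (1 + r) = p * r"
    using q by (simp_all add: r field_simps)
  let ?C3 = "C\<^sub>3 p q a b u v w"
  let ?D = "\<integral>\<^sup>+x. tail w0 x powe r * A x powe (p * r) * w0 x \<partial>lebesgue"
  let ?E = "\<integral>\<^sup>+x. kernel_tail q u0 w0 x powe r * ker_sup q r x * w0 x \<partial>lebesgue"
  note [measurable] = borel_measurable_mono_lebesgue[OF A_mono]
  have Dp: "?D = D powe (p * r)" and Ep: "?E = ?C3 powe (p * r)"
    unfolding D C3_eq[OF q r] using e p0 by (simp_all add: epowr_epowr)
  have kA: "(\<integral>\<^sup>+x. tail w0 x powe r * (ka * A x) powe (p * r) * w0 x \<partial>lebesgue) = ka powe (p * r) * ?D"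
  proof -
    have "tail w0 x powe r * (ka * A x) powe (p * r) * w0 x = ka powe (p * r) * (tail w0 x powe r * A x powe (p * r) * w0 x)" for x
      unfolding epowr_mult[OF less_imp_le[OF e(1)]] by (simp only: mult_ac)
    moreover have "(\<integral>\<^sup>+x. ka powe (p * r) * (tail w0 x powe r * A x powe (p * r) * w0 x) \<partial>lebesgue) = ka powe (p * r) * ?D"
      by (rule nn_integral_cmult) measurable
    ultimately show ?thesis by simp
  qed
  let ?S = "cS2 q p * (ka powe (p * r) * ?D + ?E) powe (1 - q / p)"
  show "wint q w0 (hardy_op g u0) \<le> ?S * wint p v0 g powe (q / p)"
    if g: "mono g" "wint p v0 g < top" for g
  proof -
    have "wint q w0 (hardy_op g u0) \<le> cS2 q p *
      (((\<integral>\<^sup>+x. tail w0 x powe r * (ka * A x) powe (p * r) * w0 x \<partial>lebesgue) + ?E) powe (1 - q / p)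
        * wint p v0 g powe (q / p))"
    proof (rule setting_bound_gt[OF p0 q0 g _ q(2) r _ _ mono_ker_sup[OF q0]])
      show "mono (\<lambda>x. ka * A x)" using monoD[OF A_mono] by (intro monoI mult_left_mono) auto
      show "seg u0 t x powe q * tail v0 t powe (- r) \<le> ker_sup q r x" if "a < ereal t" for t x
        using that by (rule ker_sup_upper)
    qed (rule A)
    then show ?thesis unfolding kA by (simp only: mult.assoc)
  qed
  have "?S \<le> cS2 q p * ((ka powe (p * r) + 1) * (D + ?C3) powe (p * r)) powe (1 - q / p)"
  proof (intro mult_left_mono epowr_mono)
    have "ka powe (p * r) * ?D + ?E \<le> ka powe (p * r) * (D + ?C3) powe (p * r) + (D + ?C3) powe (p * r)"
      unfolding Dp Ep using e by (intro add_mono mult_left_mono epowr_mono) auto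
    then show "ka powe (p * r) * ?D + ?E \<le> (ka powe (p * r) + 1) * (D + ?C3) powe (p * r)"
      by (simp add: distrib_right)
  qed (use e in auto)
  also have "\<dots> = cS2 q p * (ka powe (p * r) + 1) powe (1 - q / p) * (D + ?C3) powe q"
    using e by (simp add: epowr_mult epowr_epowr mult.assoc)
  also have "\<dots> = ((cS2 q p * (ka powe (p * r) + 1) powe (1 - q / p)) powe (1 / q) * (D + ?C3)) powe q"
    using q by (simp add: epowr_mult epowr_epowr)
  also have "\<dots> \<le> (c * (D + ?C3)) powe q"
    unfolding c using q by (intro epowr_mono mult_right_mono) auto
  finally show "?S \<le> (c * (D + ?C3)) powe q" .
  fix C :: real
  assume C: "0 < C" and hardy: "\<And>g. mono g \<Longrightarrow> wint p v0 g < top \<Longrightarrow>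
      wint q w0 (hardy_op g u0) \<le> ennreal C powe q * wint p v0 g powe (q / p)"
  have K: "ennreal C powe q < top" using q by simp
  have KC: "(ennreal C powe q) powe (1 + r) = ennreal C powe (p * r)" using e by (simp add: epowr_epowr)
  have dual: "(\<integral>\<^sup>+x. tail w0 x powe r * dual_norm p u0 v0 x powe (p * r) * w0 x \<partial>lebesgue) \<le> cN1 q r * ennreal C powe (p * r)"
    unfolding KC[symmetric] by (rule setting_dual_norm_le[OF q(2,1) r K hardy])
  have "?D \<le> (\<integral>\<^sup>+x. kb powe (p * r) * (tail w0 x powe r * dual_norm p u0 v0 x powe (p * r) * w0 x) \<partial>lebesgue)"
  proof (intro nn_integral_mono)
    fix x
    have "A x powe (p * r) \<le> kb powe (p * r) * dual_norm p u0 v0 x powe (p * r)"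
      using epowr_mono[OF A_dual less_imp_le[OF e(1)]] e by (simp add: epowr_mult)
    then have "tail w0 x powe r * A x powe (p * r) * w0 x \<le> tail w0 x powe r * (kb powe (p * r) * dual_norm p u0 v0 x powe (p * r)) * w0 x"
      by (intro mult_right_mono mult_left_mono) auto
    then show "tail w0 x powe r * A x powe (p * r) * w0 x \<le> kb powe (p * r) * (tail w0 x powe r * dual_norm p u0 v0 x powe (p * r) * w0 x)"
      by (simp only: mult_ac)
  qed
  also have "\<dots> = kb powe (p * r) * (\<integral>\<^sup>+x. tail w0 x powe r * dual_norm p u0 v0 x powe (p * r) * w0 x \<partial>lebesgue)"
    by (rule nn_integral_cmult) measurable
  also have "\<dots> \<le> kb powe (p * r) * (cN1 q r * ennreal C powe (p * r))"
    by (rule mult_left_mono[OF dual zero_le])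
  finally have "?D \<le> (kb powe (p * r) * cN1 q r) * ennreal C powe (p * r)" by (simp add: mult.assoc)
  then have 1: "D \<le> (kb powe (p * r) * cN1 q r) powe (1 / (p * r)) * ennreal C"
    unfolding D by (rule epowr_inverse_mono[OF e(1)])
  have "?E \<le> (\<integral>\<^sup>+x. kernel_tail q u0 w0 x powe r * sup_quotient q r u0 v0 x * w0 x \<partial>lebesgue)"
    by (intro nn_integral_mono mult_right_mono mult_left_mono ker_sup_le) auto
  also have "\<dots> \<le> cN3 q r * ennreal C powe (p * r)"
    unfolding KC[symmetric] by (rule setting_kernel_le[OF q(2,1) r K hardy])
  finally have 2: "?C3 \<le> cN3 q r powe (1 / (p * r)) * ennreal C"
    unfolding C3_eq[OF q r] by (rule epowr_inverse_mono[OF e(1)])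
  have "D + ?C3 \<le> ((kb powe (p * r) * cN1 q r) powe (1 / (p * r)) + cN3 q r powe (1 / (p * r))) * ennreal C"
    using add_mono[OF 1 2] by (simp add: distrib_right)
  also have "\<dots> \<le> c * ennreal C" unfolding c by (intro mult_right_mono) auto
  finally show "D + ?C3 \<le> c * ennreal C" .
qed

end

lemma (in hardy_problem) two_sided_II:
  assumes q: "0 < q" "q < p" and p: "p \<le> 1"
  shows "two_sided p q a b u v w (cGt p q (cB1 p 1) 1) (C\<^sub>2 p q a b u v w + C\<^sub>3 p q a b u v w)"
  by (rule two_sided_gt[where ka = "cB1 p 1" and kb = 1, OF q refl mono_quot_sup _ _ C2_eq[OF q refl]])
     (use q p in \<open>auto simp: cGt_def Let_def intro!: hardy_op_le_quot_sup quot_sup_le_dual_norm\<close>)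

lemma (in hardy_problem) two_sided_IV:
  assumes q: "0 < q" "q < p" and p: "1 < p"
  shows "two_sided p q a b u v w (cGt p q (cB2 p 1) (cW1 (1 / (p - 1)) powe (1 / p)))
    (C\<^sub>3 p q a b u v w + C\<^sub>5 p q a b u v w)"
proof -
  have "mono (\<lambda>x. quot_int p x powe (1 - 1 / p))" using p by (intro mono_epowr mono_quot_int) auto
  then have "two_sided p q a b u v w (cGt p q (cB2 p 1) (cW1 (1 / (p - 1)) powe (1 / p)))
    (C\<^sub>5 p q a b u v w + C\<^sub>3 p q a b u v w)"
    by (rule two_sided_gt[where ka = "cB2 p 1" and kb = "cW1 (1 / (p - 1)) powe (1 / p)", OF q refl _ _ _ C5_eq[OF q p refl]])
       (use q p in \<open>auto simp: cGt_def Let_def intro!: hardy_op_le_quot_int quot_int_le_dual_norm\<close>)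
  then show ?thesis by (simp add: add.commute)
qed

lemma cGt_finite: "0 < q \<Longrightarrow> q < p \<Longrightarrow> k1 < top \<Longrightarrow> k2 < top \<Longrightarrow> cGt p q k1 k2 < top"
  by (auto simp: cGt_def Let_def ennreal_mult_less_top)

lemma cW1_finite: "0 < r \<Longrightarrow> cW1 r < top"
  by (simp add: cW1_def)

lemma hardy_problem_exists:
  assumes ab: "a < b" and weights: "weight a b u" "weight a b v" "weight a b w"
  obtains al be where "hardy_problem a b u v w al be"
proof (rule einterval_Icc_approximation[OF ab])
  fix al be :: "nat \<Rightarrow> real"
  assume lu: "einterval a b = (\<Union>i. {al i..be i})" "incseq be" "decseq al"
    "\<And>i. a < ereal (al i)" "\<And>i. ereal (be i) < b"
  have sets: "einterval a b \<inter> space lebesgue \<in> sets lebesgue" by simp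
  have meas: "(\<lambda>x. h x * indicator (einterval a b) x) \<in> borel_measurable lebesgue" if "weight a b h" for h
    using that unfolding weight_def borel_measurable_restrict_space_iff_ennreal[OF sets] by blast
  have "hardy_problem a b u v w al be"
    unfolding hardy_problem_def
    using lu weights meas ab by unfold_locales (auto simp: weight_def split: split_indicator)
  then show ?thesis by (rule that)
qed

theorem theorem1p2:
  fixes p q :: real
  assumes "0 < p" and "0 < q"
  shows "\<exists>c::real. 0 < c \<and>
    (\<forall>(a::ereal) (b::ereal) (u::real \<Rightarrow> ennreal) (v::real \<Rightarrow> ennreal) (w::real \<Rightarrow> ennreal).
      a < b \<longrightarrow> weight a b u \<longrightarrow> weight a b v \<longrightarrow> weight a b w \<longrightarrow>
        (p \<le> q \<and> p \<le> 1 \<longrightarrow>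
          ((\<exists>C. admissible_const p q a b u v w C) \<longleftrightarrow> C\<^sub>1 p q a b u v w < \<infinity>) \<and>
          equiv_upto c (best_const p q a b u v w) (C\<^sub>1 p q a b u v w)) \<and>
        (q < p \<and> p \<le> 1 \<longrightarrow>
          ((\<exists>C. admissible_const p q a b u v w C) \<longleftrightarrow>
             C\<^sub>2 p q a b u v w < \<infinity> \<and> C\<^sub>3 p q a b u v w < \<infinity>) \<and>
          equiv_upto c (best_const p q a b u v w) (C\<^sub>2 p q a b u v w + C\<^sub>3 p q a b u v w)) \<and>
        (1 < p \<and> p \<le> q \<longrightarrow>
          ((\<exists>C. admissible_const p q a b u v w C) \<longleftrightarrow>
             C\<^sub>1 p q a b u v w < \<infinity> \<and> C\<^sub>4 p q a b u v w < \<infinity>) \<and>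
          equiv_upto c (best_const p q a b u v w) (C\<^sub>1 p q a b u v w + C\<^sub>4 p q a b u v w)) \<and>
        (q < p \<and> 1 < p \<longrightarrow>
          ((\<exists>C. admissible_const p q a b u v w C) \<longleftrightarrow>
             C\<^sub>3 p q a b u v w < \<infinity> \<and> C\<^sub>5 p q a b u v w < \<infinity>) \<and>
          equiv_upto c (best_const p q a b u v w) (C\<^sub>3 p q a b u v w + C\<^sub>5 p q a b u v w)))"
proof -
  \<comment> \<open>All ingredients are functions of p and q alone, so the constant can be fixed
    before the interval and the weights.\<close>
  define c where "c = (if p \<le> q then if p \<le> 1 then cI p q else cIII p q
    else if p \<le> 1 then cGt p q (cB1 p 1) 1 else cGt p q (cB2 p 1) (cW1 (1 / (p - 1)) powe (1 / p)))"
  have c: "c < top"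
    using assms by (auto simp: c_def cI_def cIII_def ennreal_mult_less_top cW1_finite intro!: cGt_finite)
  have *: "two_sided p q a b u v w c B \<Longrightarrow> ((\<exists>C. admissible_const p q a b u v w C) \<longleftrightarrow> B < \<infinity>) \<and>
    equiv_upto (enn2real c + 1) (best_const p q a b u v w) B" for a b u v w B
    by (rule two_sided_imp[OF _ assms(1) c])
  show ?thesis
  proof (intro exI[of _ "enn2real c + 1"] conjI[of "0 < _"] allI impI)
    show "0 < enn2real c + 1" by (simp add: add_nonneg_pos)
    fix a b :: ereal and u v w :: "real \<Rightarrow> ennreal"
    assume "a < b" "weight a b u" "weight a b v" "weight a b w"
    then obtain al be where "hardy_problem a b u v w al be" by (rule hardy_problem_exists)
    then interpret hardy_problem a b u v w al be .
    have "two_sided p q a b u v w c (C\<^sub>1 p q a b u v w)" if "p \<le> q" "p \<le> 1"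
      using two_sided_I[OF assms(1) that] that by (simp add: c_def)
    moreover have "two_sided p q a b u v w c (C\<^sub>2 p q a b u v w + C\<^sub>3 p q a b u v w)" if "q < p" "p \<le> 1"
      using two_sided_II[OF assms(2) that] that by (simp add: c_def)
    moreover have "two_sided p q a b u v w c (C\<^sub>1 p q a b u v w + C\<^sub>4 p q a b u v w)" if "1 < p" "p \<le> q"
      using two_sided_III[OF that] that by (simp add: c_def)
    moreover have "two_sided p q a b u v w c (C\<^sub>3 p q a b u v w + C\<^sub>5 p q a b u v w)" if "q < p" "1 < p"
      using two_sided_IV[OF assms(2) that] that by (simp add: c_def)
    moreover have add: "x + y < \<infinity> \<longleftrightarrow> x < \<infinity> \<and> y < \<infinity>" for x y :: ennreal by simp
    ultimately show "(p \<le> q \<and> p \<le> 1 \<longrightarrow>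
          ((\<exists>C. admissible_const p q a b u v w C) \<longleftrightarrow> C\<^sub>1 p q a b u v w < \<infinity>) \<and>
          equiv_upto (enn2real c + 1) (best_const p q a b u v w) (C\<^sub>1 p q a b u v w)) \<and>
        (q < p \<and> p \<le> 1 \<longrightarrow>
          ((\<exists>C. admissible_const p q a b u v w C) \<longleftrightarrow>
             C\<^sub>2 p q a b u v w < \<infinity> \<and> C\<^sub>3 p q a b u v w < \<infinity>) \<and>
          equiv_upto (enn2real c + 1) (best_const p q a b u v w) (C\<^sub>2 p q a b u v w + C\<^sub>3 p q a b u v w)) \<and>
        (1 < p \<and> p \<le> q \<longrightarrow>
          ((\<exists>C. admissible_const p q a b u v w C) \<longleftrightarrow>
             C\<^sub>1 p q a b u v w < \<infinity> \<and> C\<^sub>4 p q a b u v w < \<infinity>) \<and>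
          equiv_upto (enn2real c + 1) (best_const p q a b u v w) (C\<^sub>1 p q a b u v w + C\<^sub>4 p q a b u v w)) \<and>
        (q < p \<and> 1 < p \<longrightarrow>
          ((\<exists>C. admissible_const p q a b u v w C) \<longleftrightarrow>
             C\<^sub>3 p q a b u v w < \<infinity> \<and> C\<^sub>5 p q a b u v w < \<infinity>) \<and>
          equiv_upto (enn2real c + 1) (best_const p q a b u v w) (C\<^sub>3 p q a b u v w + C\<^sub>5 p q a b u v w))"
      unfolding add[symmetric] by (intro conjI[of "_ \<longrightarrow> _"] impI *) blast+
  qed
qed

end
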